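(* Let $(\mathbb{M},\mathcal{H},g,\mathcal{V})$ be a sub-Riemannian manifold with transverse symmetries, with $\mathcal{H}$ of rank $d$, sub-Laplacian $L$ and forms $\Gamma,\Gamma^Z,\Gamma_2,\Gamma_2^Z,\mathcal{R},\mathcal{T}$ as defined in the context. Suppose that there exist constants $\rho_1\in\mathbb{R}$, $\rho_2>0$ and $\kappa\ge0$ such that for every $f\in C^\infty(\mathbb{M})$ $$\mathcal{R}(f)\ge\rho_1\Gamma(f)+\rho_2\Gamma^Z(f),\qquad \mathcal{T}(f)\le\kappa\,\Gamma(f).$$ Then $\mathbb{M}$ satisfies the generalized curvature-dimension inequality $\mathrm{CD}(\rho_1,\rho_2,\kappa,d)$ with respect to $L$ and $\Gamma^Z$; i.e. for every $f\in C^\infty(\mathbb{M})$ and every $\nu>0$, $$\Gamma_2(f)+\nu\,\Gamma_2^Z(f)\ \ge\ \frac1d(Lf)^2+\Big(\rho_1-\frac\kappa\nu\Big)\Gamma(f)+\rho_2\,\Gamma^Z(f).$$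
   Context: Setting. $\mathbb{M}$ is a smooth connected manifold, $\mathcal{H}$ a bracket generating distribution of rank $d$ (horizontal directions), $g$ a fiberwise inner product on $\mathcal{H}$. A vector field $Z$ is a sub-Riemannian Killing field if $(\mathcal{L}_Zg)(u,v)=0$ for all $x$ and $u,v\in\mathcal{H}(x)$, and $[Z,X]\in\mathcal{H}$ for every horizontal field $X$; $\mathfrak{iso}$ is the Lie algebra of such fields. It is assumed that there is a Lie subalgebra $\mathcal{V}\subset\mathfrak{iso}$ (vertical directions) with $T_x\mathbb{M}=\mathcal{H}(x)\oplus\mathcal{V}(x)$ for all $x$, where $\mathcal{V}(x)=\{Z(x):Z\in\mathcal{V}\}$ has dimension $\mathfrak{h}=\dim\mathcal{V}$. Fix an inner product on the Lie algebra $\mathcal{V}$; it induces a Riemannian metric $g_R=\langle\cdot,\cdot\rangle$ extending $g$, making $\mathcal{H}(x)\perp\mathcal{V}(x)$ and the evaluation $\mathcal{V}\to\mathcal{V}(x)$ isometric. $\mu$ is the Riemannian measure of $g_R$. $\nabla_{\mathcal H}f$, $\nabla_{\mathcal V}f$ are the projections of the Riemannian gradient of $f$ on $\mathcal{H}$ and $\mathcal{V}$. The sub-Laplacian $L$ is the diffusion operator, symmetric with respect to $\mu$, with $\frac12(L(fg)-fLg-gLf)=\langle\nabla_{\mathcal H}f,\nabla_{\mathcal H}g\rangle=:\Gamma(f,g)$ (so $Lf=\mathrm{div}_\mu\nabla_{\mathcal H}f$). Put $\Gamma^Z(f,g)=\langle\nabla_{\mathcal V}f,\nabla_{\mathcal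 V}g\rangle$, $\Gamma(f)=\Gamma(f,f)$, $\Gamma^Z(f)=\Gamma^Z(f,f)$, and $$\Gamma_2(f)=\tfrac12[L\Gamma(f)-2\Gamma(f,Lf)],\qquad \Gamma_2^Z(f)=\tfrac12[L\Gamma^Z(f)-2\Gamma^Z(f,Lf)].$$ Canonical connection. $\nabla$ is the unique affine connection such that: $\nabla g=0$; $\nabla_XY$ is horizontal for horizontal $X,Y$; $\nabla Z=0$ for $Z\in\mathcal{V}$; the torsion $T(X,Y)$ is vertical and $T(X,Z)=0$ for horizontal $X,Y$ and $Z\in\mathcal{V}$. $\mathrm{Ric}$ and $T$ denote its Ricci and torsion tensors. Forms. For a local orthonormal horizontal frame $X_1,\dots,X_d$ (the results are frame independent), $$\mathcal{R}(f)=\mathrm{Ric}(\nabla_{\mathcal H}f,\nabla_{\mathcal H}f)+\sum_{\ell,k=1}^d\Big(-\big((\nabla_{X_\ell}T)(X_\ell,X_k)f\big)(X_kf)+\tfrac14\big(T(X_\ell,X_k)f\big)^2\Big),$$ $$\mathcal{T}(f)=\sum_{i=1}^d\|T(X_i,\nabla_{\mathcal H}f)\|^2 .$$ *)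

theory Defs
  imports "HOL-Analysis.Analysis" "HOL-Library.Function_Algebras"
begin

section \<open>Functions into a real vector space\<close>

text \<open>Tangent vectors and vector fields below are functions; with this instance the library's
  subspace, span and dim apply to them.\<close>

instantiation "fun" :: (type, real_vector) real_vector
begin

definition scaleR_fun :: "real \<Rightarrow> ('a \<Rightarrow> 'b) \<Rightarrow> 'a \<Rightarrow> 'b"
  where "scaleR_fun c f = (\<lambda>x. c *\<^sub>R f x)"

instance
  by standard (auto simp: scaleR_fun_def fun_eq_iff scaleR_add_right scaleR_add_left)

end

definition inner_product_on :: "'v::real_vector set \<Rightarrow> ('v \<Rightarrow> 'v \<Rightarrow> real) \<Rightarrow> bool"
  where "inner_product_on S B \<longleftrightarrow> subspace S
    \<and> (\<forall>u\<in>S. \<forall>v\<in>S. B u v = B v u)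
    \<and> (\<forall>u\<in>S. \<forall>v\<in>S. \<forall>w\<in>S. B (u + v) w = B u w + B v w)
    \<and> (\<forall>c. \<forall>u\<in>S. \<forall>v\<in>S. B (c *\<^sub>R u) v = c * B u v)
    \<and> (\<forall>u\<in>S. u \<noteq> 0 \<longrightarrow> 0 < B u u)"


section \<open>Smooth manifolds\<close>

type_synonym 'a tvec = "('a \<Rightarrow> real) \<Rightarrow> real"
type_synonym 'a vfield = "'a \<Rightarrow> 'a tvec"

text \<open>Both predicates are meant for open sets only.\<close>

primrec Ck_on :: "nat \<Rightarrow> 'e::euclidean_space set \<Rightarrow> ('e \<Rightarrow> 'b::euclidean_space) \<Rightarrow> bool"
  where
    "Ck_on 0 S f \<longleftrightarrow> continuous_on S f"
  | "Ck_on (Suc k) S f \<longleftrightarrow> f differentiable_on S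
       \<and> (\<forall>v. Ck_on k S (\<lambda>x. frechet_derivative f (at x) v))"

definition Cinf_on :: "'e::euclidean_space set \<Rightarrow> ('e \<Rightarrow> 'b::euclidean_space) \<Rightarrow> bool"
  where "Cinf_on S f \<longleftrightarrow> (\<forall>k. Ck_on k S f)"

text \<open>The manifold is the whole (Hausdorff, second countable) type \<open>'a\<close>, its dimension is
  \<open>CARD('n)\<close>. A chart is a pair \<open>(U, \<phi>)\<close>; the values of \<open>\<phi>\<close> outside \<open>U\<close> are irrelevant. The
  atlas need not be maximal, since the notions below depend only on the smooth structure it
  generates.\<close>

locale smooth_manifold =
  fixes atlas :: "('a::{t2_space, second_countable_topology} set
                   \<times> ('a \<Rightarrow> real ^ 'n::finite)) set"
  assumes chart_open: "(U, \<phi>) \<in> atlas \<Longrightarrow> open U \<and> open (\<phi> ` U)"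
    and chart_homeomorphism: "(U, \<phi>) \<in> atlas \<Longrightarrow> homeomorphism U (\<phi> ` U) \<phi> (inv_into U \<phi>)"
    and charts_cover: "(\<Union>(U, \<phi>)\<in>atlas. U) = UNIV"
    and charts_compatible: "(U, \<phi>) \<in> atlas \<Longrightarrow> (W, \<psi>) \<in> atlas
          \<Longrightarrow> Cinf_on (\<phi> ` (U \<inter> W)) (\<psi> \<circ> inv_into U \<phi>)"
begin

definition smooth_fun_on :: "'a set \<Rightarrow> ('a \<Rightarrow> real) \<Rightarrow> bool"
  where "smooth_fun_on W f \<longleftrightarrow> (\<forall>(U, \<phi>)\<in>atlas. Cinf_on (\<phi> ` (U \<inter> W)) (f \<circ> inv_into U \<phi>))"

definition smooth_funs :: "('a \<Rightarrow> real) set"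
  where "smooth_funs = {f. smooth_fun_on UNIV f}"

text \<open>Tangent vectors at \<open>p\<close> are the point derivations of the algebra of smooth functions. They
  are set to 0 on functions that are not smooth, so that equality of derivations is equality
  in HOL.\<close>

definition tangent_space :: "'a \<Rightarrow> 'a tvec set"
  where "tangent_space p = {v.
      (\<forall>f\<in>smooth_funs. \<forall>g\<in>smooth_funs. v (\<lambda>q. f q + g q) = v f + v g)
    \<and> (\<forall>c. \<forall>f\<in>smooth_funs. v (\<lambda>q. c * f q) = c * v f)
    \<and> (\<forall>f\<in>smooth_funs. \<forall>g\<in>smooth_funs. v (\<lambda>q. f q * g q) = f p * v g + g p * v f)
    \<and> (\<forall>f. f \<notin> smooth_funs \<longrightarrow> v f = 0)}"

definition vector_field_on :: "'a set \<Rightarrow> 'a vfield \<Rightarrow> bool"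
  where "vector_field_on W X \<longleftrightarrow> (\<forall>p\<in>W. X p \<in> tangent_space p)
    \<and> (\<forall>f\<in>smooth_funs. smooth_fun_on W (\<lambda>p. X p f))"

definition vector_fields :: "'a vfield set"
  where "vector_fields = {X. vector_field_on UNIV X}"

definition lie_bracket ::
    "'a vfield \<Rightarrow> 'a vfield \<Rightarrow> 'a vfield"
  where "lie_bracket X Y = (\<lambda>p f. X p (\<lambda>q. Y q f) - Y p (\<lambda>q. X q f))"

definition lie_closed :: "'a vfield set \<Rightarrow> bool"
  where "lie_closed A \<longleftrightarrow> subspace A \<and> (\<forall>X\<in>A. \<forall>Y\<in>A. lie_bracket X Y \<in> A)"

definition coord_vector :: "'a set \<Rightarrow> ('a \<Rightarrow> real ^ 'n) \<Rightarrow> 'n \<Rightarrow> 'a vfield"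
  where "coord_vector U \<phi> i p = (\<lambda>f. if f \<in> smooth_funs
    then frechet_derivative (f \<circ> inv_into U \<phi>) (at (\<phi> p)) (axis i 1) else 0)"


subsection \<open>Distributions, sub-Riemannian metrics and Killing fields\<close>

definition smooth_distribution :: "nat \<Rightarrow> ('a \<Rightarrow> 'a tvec set) \<Rightarrow> bool"
  where "smooth_distribution d H \<longleftrightarrow>
      (\<forall>p. subspace (H p) \<and> H p \<subseteq> tangent_space p \<and> dim (H p) = d)
    \<and> (\<forall>p. \<exists>W X. open W \<and> p \<in> W \<and> (\<forall>i<d. vector_field_on W (X i))
          \<and> (\<forall>q\<in>W. H q = span ((\<lambda>i. X i q) ` {..<d})))"

definition horizontal_fields ::
    "('a \<Rightarrow> 'a tvec set) \<Rightarrow> 'a vfield set"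
  where "horizontal_fields H = {X \<in> vector_fields. \<forall>p. X p \<in> H p}"

definition bracket_generating :: "('a \<Rightarrow> 'a tvec set) \<Rightarrow> bool"
  where "bracket_generating H \<longleftrightarrow>
    (\<forall>p. (\<lambda>X. X p) ` (lie_closed hull horizontal_fields H) = tangent_space p)"

text \<open>In \<open>g p u v\<close> only \<open>u, v \<in> H p\<close> are relevant.\<close>

definition sub_riemannian_metric ::
    "('a \<Rightarrow> 'a tvec set)
      \<Rightarrow> ('a \<Rightarrow> 'a tvec \<Rightarrow> 'a tvec \<Rightarrow> real) \<Rightarrow> bool"
  where "sub_riemannian_metric H g \<longleftrightarrow> (\<forall>p. inner_product_on (H p) (g p))
    \<and> (\<forall>X\<in>horizontal_fields H. \<forall>Y\<in>horizontal_fields H. (\<lambda>p. g p (X p) (Y p)) \<in> smooth_funs)"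

text \<open>\<open>(\<L>\<^sub>Z g)(X, Y)\<close> for horizontal \<open>X\<close>, \<open>Y\<close>; it is used only when the brackets \<open>[Z, X]\<close> and
  \<open>[Z, Y]\<close> are horizontal, and is then tensorial in \<open>X\<close> and \<open>Y\<close>.\<close>

definition lie_derivative_metric ::
    "('a \<Rightarrow> 'a tvec \<Rightarrow> 'a tvec \<Rightarrow> real)
      \<Rightarrow> 'a vfield \<Rightarrow> 'a vfield \<Rightarrow> 'a vfield \<Rightarrow> 'a \<Rightarrow> real"
  where "lie_derivative_metric g Z X Y p = Z p (\<lambda>q. g q (X q) (Y q))
    - g p (lie_bracket Z X p) (Y p) - g p (X p) (lie_bracket Z Y p)"

definition killing_fields ::
    "('a \<Rightarrow> 'a tvec set)
      \<Rightarrow> ('a \<Rightarrow> 'a tvec \<Rightarrow> 'a tvec \<Rightarrow> real)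
      \<Rightarrow> 'a vfield set"
  where "killing_fields H g = {Z \<in> vector_fields.
      (\<forall>X\<in>horizontal_fields H. lie_bracket Z X \<in> horizontal_fields H)
    \<and> (\<forall>X\<in>horizontal_fields H. \<forall>Y\<in>horizontal_fields H. \<forall>p. lie_derivative_metric g Z X Y p = 0)}"

end

text \<open>A nonzero \<open>V\<close> may be infinite-dimensional with \<open>dim V = 0\<close> in the library's convention, hence
  the explicit finiteness assumption.\<close>

locale transverse_symmetries = smooth_manifold atlas
  for atlas :: "('a::{t2_space, second_countable_topology} set \<times> ('a \<Rightarrow> real ^ 'n::finite)) set" +
  fixes d :: nat
    and H :: "'a \<Rightarrow> 'a tvec set"
    and g :: "'a \<Rightarrow> 'a tvec \<Rightarrow> 'a tvec \<Rightarrow> real"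
    and V :: "'a vfield set"
    and vip :: "'a vfield \<Rightarrow> 'a vfield \<Rightarrow> real"
  assumes connected_manifold: "connected (UNIV :: 'a set)"
    and distribution: "smooth_distribution d H"
    and generating: "bracket_generating H"
    and metric: "sub_riemannian_metric H g"
    and V_killing: "V \<subseteq> killing_fields H g"
    and V_lie_subalgebra: "lie_closed V"
    and V_finite_dim: "\<exists>B. finite B \<and> V = span B"
    and V_dim: "dim ((\<lambda>Z. Z p) ` V) = dim V"
    and transversal: "H p \<inter> (\<lambda>Z. Z p) ` V = {0}"
    and splitting: "tangent_space p = {u + Z p | u Z. u \<in> H p \<and> Z \<in> V}"
    and V_inner_product: "inner_product_on V vip"
begin

definition vert_space :: "'a \<Rightarrow> 'a tvec set"
  where "vert_space p = (\<lambda>Z. Z p) ` V"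

definition hproj :: "'a \<Rightarrow> 'a tvec \<Rightarrow> 'a tvec"
  where "hproj p u = (THE h. h \<in> H p \<and> u - h \<in> vert_space p)"

definition vproj :: "'a \<Rightarrow> 'a tvec \<Rightarrow> 'a tvec"
  where "vproj p u = u - hproj p u"

text \<open>The inverse of the evaluation map \<open>V \<rightarrow> vert_space p\<close>.\<close>

definition eval_inv :: "'a \<Rightarrow> 'a tvec \<Rightarrow> 'a vfield"
  where "eval_inv p w = (THE Z. Z \<in> V \<and> Z p = w)"

definition gR :: "'a \<Rightarrow> 'a tvec \<Rightarrow> 'a tvec \<Rightarrow> real"
  where "gR p u v = g p (hproj p u) (hproj p v)
    + vip (eval_inv p (vproj p u)) (eval_inv p (vproj p v))"

definition grad :: "('a \<Rightarrow> real) \<Rightarrow> 'a vfield"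
  where "grad f p = (THE v. v \<in> tangent_space p \<and> (\<forall>u\<in>tangent_space p. gR p v u = u f))"

definition gradH :: "('a \<Rightarrow> real) \<Rightarrow> 'a vfield"
  where "gradH f p = hproj p (grad f p)"

definition gradV :: "('a \<Rightarrow> real) \<Rightarrow> 'a vfield"
  where "gradV f p = vproj p (grad f p)"

definition Gam :: "('a \<Rightarrow> real) \<Rightarrow> ('a \<Rightarrow> real) \<Rightarrow> 'a \<Rightarrow> real"
  where "Gam f1 f2 p = gR p (gradH f1 p) (gradH f2 p)"

definition GamZ :: "('a \<Rightarrow> real) \<Rightarrow> ('a \<Rightarrow> real) \<Rightarrow> 'a \<Rightarrow> real"
  where "GamZ f1 f2 p = gR p (gradV f1 p) (gradV f2 p)"


subsection \<open>Riemannian measure and sub-Laplacian\<close>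

definition riemannian_measure :: "'a measure \<Rightarrow> bool"
  where "riemannian_measure \<mu> \<longleftrightarrow> sets \<mu> = sets borel
    \<and> (\<forall>(U, \<phi>)\<in>atlas. \<forall>B\<in>sets borel. B \<subseteq> U \<longrightarrow>
         emeasure \<mu> B = (\<integral>\<^sup>+x\<in>\<phi> ` B. ennreal (sqrt (det (\<chi> i j.
             gR (inv_into U \<phi> x) (coord_vector U \<phi> i (inv_into U \<phi> x))
                                 (coord_vector U \<phi> j (inv_into U \<phi> x))))) \<partial>lborel))"

definition compact_support :: "('a \<Rightarrow> real) \<Rightarrow> bool"
  where "compact_support f \<longleftrightarrow> compact (closure {p. f p \<noteq> 0})"

text \<open>A linear operator whose carre du champ is the first-order form \<open>Gam\<close> is automatically a
  second-order differential operator without zeroth-order term, i.e. a diffusion operator; symmetry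
  with respect to the Riemannian measure then determines it.\<close>

definition sub_laplacian :: "'a measure \<Rightarrow> (('a \<Rightarrow> real) \<Rightarrow> 'a \<Rightarrow> real) \<Rightarrow> bool"
  where "sub_laplacian \<mu> L \<longleftrightarrow>
      (\<forall>f\<in>smooth_funs. L f \<in> smooth_funs)
    \<and> (\<forall>f1\<in>smooth_funs. \<forall>f2\<in>smooth_funs. L (\<lambda>p. f1 p + f2 p) = (\<lambda>p. L f1 p + L f2 p))
    \<and> (\<forall>c. \<forall>f\<in>smooth_funs. L (\<lambda>p. c * f p) = (\<lambda>p. c * L f p))
    \<and> (\<forall>f1\<in>smooth_funs. \<forall>f2\<in>smooth_funs. \<forall>p.
         (L (\<lambda>q. f1 q * f2 q) p - f1 p * L f2 p - f2 p * L f1 p) / 2 = Gam f1 f2 p)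
    \<and> (\<forall>f1\<in>smooth_funs. \<forall>f2\<in>smooth_funs. compact_support f1 \<longrightarrow> compact_support f2 \<longrightarrow>
         (\<integral>p. f1 p * L f2 p \<partial>\<mu>) = (\<integral>p. f2 p * L f1 p \<partial>\<mu>))"

definition Gam2 :: "(('a \<Rightarrow> real) \<Rightarrow> 'a \<Rightarrow> real) \<Rightarrow> ('a \<Rightarrow> real) \<Rightarrow> 'a \<Rightarrow> real"
  where "Gam2 L f p = (L (Gam f f) p - 2 * Gam f (L f) p) / 2"

definition GamZ2 :: "(('a \<Rightarrow> real) \<Rightarrow> 'a \<Rightarrow> real) \<Rightarrow> ('a \<Rightarrow> real) \<Rightarrow> 'a \<Rightarrow> real"
  where "GamZ2 L f p = (L (GamZ f f) p - 2 * GamZ f (L f) p) / 2"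


subsection \<open>The canonical connection\<close>

text \<open>A connection acts on global smooth vector fields; its values on other arguments are
  irrelevant.\<close>

definition affine_connection :: "('a vfield \<Rightarrow> 'a vfield \<Rightarrow> 'a vfield) \<Rightarrow> bool"
  where "affine_connection D \<longleftrightarrow>
      (\<forall>X\<in>vector_fields. \<forall>Y\<in>vector_fields. D X Y \<in> vector_fields)
    \<and> (\<forall>X\<in>vector_fields. \<forall>Y\<in>vector_fields. \<forall>W\<in>vector_fields. D (X + Y) W = D X W + D Y W)
    \<and> (\<forall>X\<in>vector_fields. \<forall>Y\<in>vector_fields. \<forall>W\<in>vector_fields. D X (Y + W) = D X Y + D X W)
    \<and> (\<forall>f\<in>smooth_funs. \<forall>X\<in>vector_fields. \<forall>Y\<in>vector_fields.
         D (\<lambda>p. f p *\<^sub>R X p) Y = (\<lambda>p. f p *\<^sub>R D X Y p))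
    \<and> (\<forall>f\<in>smooth_funs. \<forall>X\<in>vector_fields. \<forall>Y\<in>vector_fields.
         D X (\<lambda>p. f p *\<^sub>R Y p) = (\<lambda>p. X p f *\<^sub>R Y p + f p *\<^sub>R D X Y p))"

definition torsion :: "('a vfield \<Rightarrow> 'a vfield \<Rightarrow> 'a vfield) \<Rightarrow> 'a vfield \<Rightarrow> 'a vfield \<Rightarrow> 'a vfield"
  where "torsion D X Y = D X Y - D Y X - lie_bracket X Y"

text \<open>In the first condition \<open>D X Y\<close> is horizontal for every \<open>X\<close>: for \<open>X \<in> V\<close> the last condition
  gives \<open>D X Y = [X, Y]\<close>.\<close>

definition canonical_connection :: "('a vfield \<Rightarrow> 'a vfield \<Rightarrow> 'a vfield) \<Rightarrow> bool"
  where "canonical_connection D \<longleftrightarrow> affine_connection D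
    \<and> (\<forall>X\<in>vector_fields. \<forall>Y\<in>horizontal_fields H. \<forall>W\<in>horizontal_fields H. \<forall>p.
         X p (\<lambda>q. g q (Y q) (W q)) = g p (D X Y p) (W p) + g p (Y p) (D X W p))
    \<and> (\<forall>X\<in>horizontal_fields H. \<forall>Y\<in>horizontal_fields H. D X Y \<in> horizontal_fields H)
    \<and> (\<forall>X\<in>vector_fields. \<forall>Z\<in>V. D X Z = 0)
    \<and> (\<forall>X\<in>horizontal_fields H. \<forall>Y\<in>horizontal_fields H. \<forall>p. torsion D X Y p \<in> vert_space p)
    \<and> (\<forall>X\<in>horizontal_fields H. \<forall>Z\<in>V. torsion D X Z = 0)"

definition cov_torsion :: "('a vfield \<Rightarrow> 'a vfield \<Rightarrow> 'a vfield) \<Rightarrow> 'a vfield \<Rightarrow> 'a vfield \<Rightarrow> 'a vfield \<Rightarrow> 'a vfield"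
  where "cov_torsion D W X Y =
    D W (torsion D X Y) - torsion D (D W X) Y - torsion D X (D W Y)"

definition curvature :: "('a vfield \<Rightarrow> 'a vfield \<Rightarrow> 'a vfield) \<Rightarrow> 'a vfield \<Rightarrow> 'a vfield \<Rightarrow> 'a vfield \<Rightarrow> 'a vfield"
  where "curvature D X Y W = D X (D Y W) - D Y (D X W) - D (lie_bracket X Y) W"

text \<open>\<open>Ric(Y, W)\<close> is the trace of \<open>u \<mapsto> R(u, Y)W\<close> (positive on round spheres), computed in vector
  fields that are \<open>gR\<close>-orthonormal at the point; the choice does not matter as \<open>R\<close> is a tensor.\<close>

definition orthonormal_at :: "'a \<Rightarrow> (nat \<Rightarrow> 'a vfield) \<Rightarrow> bool"
  where "orthonormal_at p E \<longleftrightarrow> (\<forall>i<CARD('n). E i \<in> vector_fields)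
    \<and> (\<forall>i<CARD('n). \<forall>j<CARD('n). gR p (E i p) (E j p) = of_bool (i = j))"

definition ricci :: "('a vfield \<Rightarrow> 'a vfield \<Rightarrow> 'a vfield) \<Rightarrow> 'a vfield \<Rightarrow> 'a vfield \<Rightarrow> 'a \<Rightarrow> real"
  where "ricci D Y W p = (let E = (SOME E. orthonormal_at p E)
    in \<Sum>i<CARD('n). gR p (curvature D (E i) Y W p) (E i p))"


subsection \<open>The forms and the curvature-dimension inequality\<close>

text \<open>A local orthonormal horizontal frame around \<open>p\<close>, given by globally defined horizontal fields
  that are orthonormal near \<open>p\<close>. (Any local frame agrees near \<open>p\<close> with such fields after
  multiplication by a bump function, and the forms at \<open>p\<close> only depend on the germ.)\<close>

definition horizontal_frame :: "'a \<Rightarrow> (nat \<Rightarrow> 'a vfield) \<Rightarrow> bool"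
  where "horizontal_frame p X \<longleftrightarrow> (\<forall>i<d. X i \<in> horizontal_fields H)
    \<and> (\<exists>W. open W \<and> p \<in> W
         \<and> (\<forall>q\<in>W. \<forall>i<d. \<forall>j<d. g q (X i q) (X j q) = of_bool (i = j)))"

definition R_form :: "('a vfield \<Rightarrow> 'a vfield \<Rightarrow> 'a vfield) \<Rightarrow> ('a \<Rightarrow> real) \<Rightarrow> 'a \<Rightarrow> real"
  where "R_form D f p = (let X = (SOME X. horizontal_frame p X)
    in ricci D (gradH f) (gradH f) p
       + (\<Sum>l<d. \<Sum>k<d. - (cov_torsion D (X l) (X l) (X k) p f * X k p f)
                         + (torsion D (X l) (X k) p f)\<^sup>2 / 4))"

definition T_form :: "('a vfield \<Rightarrow> 'a vfield \<Rightarrow> 'a vfield) \<Rightarrow> ('a \<Rightarrow> real) \<Rightarrow> 'a \<Rightarrow> real"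
  where "T_form D f p = (let X = (SOME X. horizontal_frame p X)
    in \<Sum>i<d. gR p (torsion D (X i) (gradH f) p) (torsion D (X i) (gradH f) p))"

definition CD_inequality :: "(('a \<Rightarrow> real) \<Rightarrow> 'a \<Rightarrow> real) \<Rightarrow> real \<Rightarrow> real \<Rightarrow> real \<Rightarrow> real \<Rightarrow> bool"
  where "CD_inequality L \<rho>1 \<rho>2 \<kappa> m \<longleftrightarrow> (\<forall>f\<in>smooth_funs. \<forall>\<nu>>0. \<forall>p.
    Gam2 L f p + \<nu> * GamZ2 L f p
      \<ge> (L f p)\<^sup>2 / m + (\<rho>1 - \<kappa> / \<nu>) * Gam f f p + \<rho>2 * GamZ f f p)"

end

end

theory Submission
  imports Defs
begin

text \<open>The proof is Bochner's method. Put \<open>u = \<nabla>\<^sub>H f\<close> and \<open>h(A, B) = \<langle>\<nabla>\<^sub>A u, B\<rangle>\<close> for horizontal \<open>B\<close>.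
  Integration by parts in a chart identifies \<open>L f\<close> with the trace of \<open>h\<close>; the measure plays no
  further role. Let \<open>\<tau>\<^sub>m\<close> be the components of the torsion in an orthonormal basis \<open>Z\<^sub>m\<close> of \<open>V\<close>.
  Commuting derivatives in \<open>L \<Gamma>(f)\<close> gives
  \<open>\<Gamma>\<^sub>2(f) = \<Sum> |\<nabla>\<^sub>X\<^sub>i u|\<^sup>2 + Ric(u, u) - \<Sum> (\<nabla>\<^sub>X\<^sub>i T)(X\<^sub>i, u)f - 2 \<Sum> \<tau>\<^sub>m(X\<^sub>i, u) X\<^sub>i Z\<^sub>m f\<close>,
  and \<open>\<Gamma>\<^sub>2\<^sup>Z(f) = \<Sum> (X\<^sub>i Z\<^sub>m f)\<^sup>2\<close> because the Killing fields \<open>Z\<^sub>m\<close> commute with \<open>L\<close>. Since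
  \<open>h(A, B) - h(B, A) = - T(A, B)f\<close>, the skew part of \<open>h\<close> accounts for the quadratic torsion term of
  \<open>\<R>\<close>, while the symmetric part dominates \<open>(L f)\<^sup>2/d\<close>. Young's inequality absorbs the mixed term
  into \<open>\<T>(f)/\<nu> + \<nu> \<Gamma>\<^sub>2\<^sup>Z(f)\<close>.\<close>

subsection \<open>Smooth functions on Euclidean spaces\<close>

text \<open>The operator \<open>L\<close>, the connection \<open>D\<close> and the tangent vectors
  are given only through their action on global functions and fields, whereas the computation is
  local and uses frames that need exist only near a point. Bump functions bridge the two. They show
  that a derivation sees only germs, turn local frames into global fields, and let a function-linear
  expression be evaluated from the value of a field at one point. They also serve as test functions
  through which the integral symmetry of \<open>L\<close> becomes a pointwise formula. In the
  pointwise computation the obstacle is the torsion. Reordering the derivatives of \<open>f\<close>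
  produces the mixed terms \<open>X\<^sub>i Z\<^sub>m f\<close>, which the assumed bounds on the
  forms do not see. They occur twice, once when the torsion applied to \<open>f\<close> is
  differentiated and once inside a Lie bracket, hence the coefficient 2. This is the coefficient of
  the cross term in a square, and \<open>\<nu>\<close> only distributes the weights of its two ends.
  The vertical fields create no further terms of this kind, because they are parallel for
  \<open>D\<close>.\<close>

lemma Ck_on_cong:
  assumes "open S" "\<And>x. x \<in> S \<Longrightarrow> f x = g x" "Ck_on k S f"
  shows "Ck_on k S g"
  using assms(2,3)
proof (induction k arbitrary: f g)
  case 0
  then show ?case by (auto cong: continuous_on_cong)
next
  case (Suc k)
  have d: "f differentiable at x" if "x \<in> S" for x
    using Suc.prems(2) that assms(1) by (auto simp: differentiable_on_eq_differentiable_at)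
  have e: "frechet_derivative f (at x) = frechet_derivative g (at x)" if "x \<in> S" for x
    using frechet_derivative_transform_within_open[OF d[OF that] assms(1) that] Suc.prems(1) by auto
  have "g differentiable at x" if "x \<in> S" for x
    using d[OF that] Suc.prems(1) that assms(1)
    by (metis differentiable_def has_derivative_transform_within_open)
  moreover have "Ck_on k S (\<lambda>x. frechet_derivative g (at x) v)" for v
    by (rule Suc.IH[where f = "\<lambda>x. frechet_derivative f (at x) v"]) (use Suc.prems e in auto)
  ultimately show ?case
    using assms(1) by (auto simp: differentiable_on_eq_differentiable_at)
qed

lemma Ck_on_subset: "Ck_on k S f \<Longrightarrow> T \<subseteq> S \<Longrightarrow> Ck_on k T f"
  by (induction k arbitrary: f) (auto intro: continuous_on_subset differentiable_on_subset)

lemma Ck_on_local: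
  assumes "\<And>x. x \<in> S \<Longrightarrow> \<exists>T. open T \<and> x \<in> T \<and> Ck_on k T f"
  shows "Ck_on k S f"
  using assms
proof (induction k arbitrary: f)
  case 0
  then show ?case
    by (metis Ck_on.simps(1) continuous_at_imp_continuous_on continuous_on_eq_continuous_at)
next
  case (Suc k)
  have "f differentiable at x" if "x \<in> S" for x
    using Suc.prems[OF that] by (metis Ck_on.simps(2) differentiable_on_eq_differentiable_at)
  moreover have "Ck_on k S (\<lambda>x. frechet_derivative f (at x) v)" for v
    by (rule Suc.IH) (metis Ck_on.simps(2) Suc.prems)
  ultimately show ?case
    by (auto simp: differentiable_on_def differentiable_at_withinI)
qed

text \<open>\<open>Ck_on\<close> is built on the choice operator \<open>frechet_derivative\<close>.
  Through this rule any explicit derivative may be supplied instead, and most inductions on the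
  order below run through it.\<close>

lemma Ck_on_SucI:
  assumes "open S" "\<And>x. x \<in> S \<Longrightarrow> (f has_derivative F x) (at x)"
    "\<And>v. Ck_on k S (\<lambda>x. F x v)"
  shows "Ck_on (Suc k) S f"
proof -
  have "F x = frechet_derivative f (at x)" if "x \<in> S" for x
    using assms(2)[OF that] by (rule frechet_derivative_at)
  then have "Ck_on k S (\<lambda>x. frechet_derivative f (at x) v)" for v
    by (intro Ck_on_cong[OF assms(1) _ assms(3)[of v]]) auto
  then show ?thesis
    using assms(1,2) by (auto simp: differentiable_on_eq_differentiable_at differentiable_def)
qed

lemma Ck_on_SucD:
  assumes "Ck_on (Suc k) S f" "open S"
  shows "x \<in> S \<Longrightarrow> (f has_derivative frechet_derivative f (at x)) (at x)"
    and "Ck_on k S (\<lambda>x. frechet_derivative f (at x) v)"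
  using assms by (auto simp: differentiable_on_eq_differentiable_at frechet_derivative_works)

lemma Ck_on_continuous: "open S \<Longrightarrow> Ck_on k S f \<Longrightarrow> continuous_on S f"
  by (cases k) (auto intro: differentiable_imp_continuous_on)

lemma Ck_on_Suc_imp: "open S \<Longrightarrow> Ck_on (Suc k) S f \<Longrightarrow> Ck_on k S f"
proof (induction k arbitrary: f)
  case 0
  then show ?case using Ck_on_continuous[of S "Suc 0" f] by (simp del: Ck_on.simps add: Ck_on.simps(1))
next
  case (Suc k)
  then have "Ck_on k S (\<lambda>x. frechet_derivative f (at x) v)" for v
    by (intro Suc.IH) auto
  moreover have "f differentiable_on S" using Suc.prems by simp
  ultimately show ?case unfolding Ck_on.simps(2) by blast
qed

lemma Ck_on_const: "Ck_on k S (\<lambda>x. c)"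
  by (induction k arbitrary: c) (auto simp: frechet_derivative_const)

lemma Ck_on_bounded_linear:
  assumes "open S" "bounded_linear L" "Ck_on k S f"
  shows "Ck_on k S (\<lambda>x. L (f x))"
  using assms(3)
proof (induction k arbitrary: f)
  case 0
  then show ?case
    using assms(2) by (auto intro: bounded_linear.continuous_on)
next
  case (Suc k)
  show ?case
  proof (rule Ck_on_SucI[OF assms(1)])
    show "((\<lambda>x. L (f x)) has_derivative (\<lambda>v. L (frechet_derivative f (at x) v))) (at x)"
      if "x \<in> S" for x
      using bounded_linear.has_derivative[OF assms(2) Ck_on_SucD(1)[OF Suc.prems assms(1) that]] .
  qed (use Suc in auto)
qed

lemma Ck_on_id: assumes "open S" shows "Ck_on k S (\<lambda>x. x)"
proof (cases k)
  case (Suc m)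
  show ?thesis unfolding Suc
    by (rule Ck_on_SucI[OF assms, where F = "\<lambda>x v. v"]) (auto intro: Ck_on_const)
qed auto

lemma Ck_on_add:
  assumes "open S" "Ck_on k S f" "Ck_on k S g"
  shows "Ck_on k S (\<lambda>x. f x + g x)"
  using assms(2,3)
proof (induction k arbitrary: f g)
  case 0
  then show ?case by (auto intro: continuous_intros)
next
  case (Suc k)
  show ?case
    by (rule Ck_on_SucI[OF assms(1) has_derivative_add[OF Ck_on_SucD(1) Ck_on_SucD(1)]])
      (use Suc assms(1) in auto)
qed

lemma Ck_on_scaleR:
  assumes "open S" "Ck_on k S f" "Ck_on k S g"
  shows "Ck_on k S (\<lambda>x. f x *\<^sub>R g x)"
  using assms(2,3)
proof (induction k arbitrary: f g)
  case 0
  then show ?case by (auto intro: continuous_intros)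
next
  case (Suc k)
  show ?case
  proof (rule Ck_on_SucI[OF assms(1) has_derivative_scaleR[OF Ck_on_SucD(1) Ck_on_SucD(1)]])
    fix v
    \<comment> \<open>The product rule leaves one factor undifferentiated, so the induction needs
      both functions at the lower order as well.\<close>
    have "Ck_on k S f" "Ck_on k S g"
      using Suc.prems Ck_on_Suc_imp assms(1) by blast+
    then show "Ck_on k S (\<lambda>x. f x *\<^sub>R frechet_derivative g (at x) v
        + frechet_derivative f (at x) v *\<^sub>R g x)"
      by (intro Ck_on_add assms(1) Suc.IH) (use Suc.prems in auto)
  qed (use Suc.prems assms(1) in auto)
qed

lemma Ck_on_mult:
  assumes "open S" "Ck_on k S f" "Ck_on k S g"
  shows "Ck_on k S (\<lambda>x. f x * g x :: real)"
  using Ck_on_scaleR[OF assms] by simp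

lemma Ck_on_sum:
  assumes "open S" "\<And>i. i \<in> I \<Longrightarrow> Ck_on k S (f i)"
  shows "Ck_on k S (\<lambda>x. \<Sum>i\<in>I. f i x)"
  using assms(2)
  by (induction I rule: infinite_finite_induct) (auto intro: Ck_on_add assms(1) Ck_on_const)

lemma has_derivative_Basis_expansion:
  assumes "(f has_derivative f') F"
  shows "f' v = (\<Sum>b\<in>Basis. (v \<bullet> b) *\<^sub>R f' b)"
proof -
  interpret bounded_linear f' using assms by (rule has_derivative_bounded_linear)
  show ?thesis by (subst euclidean_representation[symmetric, of v]) (simp add: sum scaleR)
qed

text \<open>In the chain rule the outer derivative is applied to a direction that moves with
  \<open>x\<close>. Expanding that direction in the basis gives a finite sum of products in which
  the outer derivatives are taken in fixed directions, and to these the induction hypothesis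
  applies.\<close>

lemma Ck_on_compose:
  fixes f :: "'e::euclidean_space \<Rightarrow> 'f::euclidean_space"
  assumes "open S" "open T" "Ck_on k S f" "Ck_on k T h" "f ` S \<subseteq> T"
  shows "Ck_on k S (\<lambda>x. h (f x))"
  using assms(3-5)
proof (induction k arbitrary: h)
  case 0
  then show ?case by (auto intro: continuous_on_compose2)
next
  case (Suc k)
  have f: "(f has_derivative frechet_derivative f (at x)) (at x)" if "x \<in> S" for x
    using Ck_on_SucD(1)[OF Suc.prems(1) assms(1) that] .
  have h: "(h has_derivative frechet_derivative h (at (f x))) (at (f x))" if "x \<in> S" for x
    by (rule Ck_on_SucD(1)[OF Suc.prems(2) assms(2)]) (use Suc.prems(3) that in auto)
  have fk: "Ck_on k S f"
    using Ck_on_Suc_imp[OF assms(1) Suc.prems(1)] .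
  show ?case
  proof (rule Ck_on_SucI[OF assms(1)])
    show "((\<lambda>x. h (f x)) has_derivative (\<lambda>v. \<Sum>b\<in>Basis. (frechet_derivative f (at x) v \<bullet> b) *\<^sub>R
        frechet_derivative h (at (f x)) b)) (at x)" if "x \<in> S" for x
      by (rule has_derivative_eq_rhs[OF diff_chain_at[OF f[OF that] h[OF that], unfolded o_def]])
        (intro ext has_derivative_Basis_expansion[OF h[OF that]])
    fix v
    show "Ck_on k S (\<lambda>x. \<Sum>b\<in>Basis. (frechet_derivative f (at x) v \<bullet> b) *\<^sub>R
        frechet_derivative h (at (f x)) b)"
    proof (intro Ck_on_sum Ck_on_scaleR assms(1))
      fix b :: 'f
      show "Ck_on k S (\<lambda>x. frechet_derivative f (at x) v \<bullet> b)"
        by (rule Ck_on_bounded_linear[OF assms(1) bounded_linear_inner_left]) (use Suc.prems in simp)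
      show "Ck_on k S (\<lambda>x. frechet_derivative h (at (f x)) b)"
        by (rule Suc.IH[OF fk]) (use Suc.prems in simp_all)
    qed
  qed
qed

lemma Ck_on_real_SucI:
  fixes f :: "real \<Rightarrow> real"
  assumes "open S" "\<And>x. x \<in> S \<Longrightarrow> (f has_real_derivative F x) (at x)" "Ck_on k S F"
  shows "Ck_on (Suc k) S f"
proof (rule Ck_on_SucI[OF assms(1)])
  show "(f has_derivative (\<lambda>v. F x * v)) (at x)" if "x \<in> S" for x
    using assms(2)[OF that] by (simp add: has_field_derivative_def)
qed (intro Ck_on_mult assms Ck_on_const)

text \<open>The derivative is minus the product of the function with itself, so the induction on the
  order closes.\<close>

lemma Ck_on_inverse: "Ck_on k (- {0}) (inverse :: real \<Rightarrow> real)"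
proof (induction k)
  case 0
  then show ?case by (auto intro!: continuous_intros)
next
  case (Suc k)
  show ?case
  proof (rule Ck_on_real_SucI)
    show "(inverse has_real_derivative - 1 * (inverse x * inverse x)) (at x)"
      if "x \<in> - {0}" for x :: real
      using DERIV_inverse[of x UNIV] that by (simp add: power2_eq_square power_Suc)
    show "Ck_on k (- {0}) (\<lambda>x :: real. - 1 * (inverse x * inverse x))"
      by (intro Ck_on_mult Ck_on_const Suc) (simp_all add: open_Compl)
  qed (simp add: open_Compl)
qed

lemma Ck_on_sqrt: "Ck_on k {0<..} sqrt"
proof (induction k)
  case 0
  then show ?case by (auto intro!: continuous_intros)
next
  case (Suc k)
  show ?case
  proof (rule Ck_on_real_SucI)
    show "(sqrt has_real_derivative inverse (sqrt x) * (1/2)) (at x)"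
      if "x \<in> {0<..}" for x :: real
      using DERIV_real_sqrt[of x] that by simp
    show "Ck_on k {0<..} (\<lambda>x. inverse (sqrt x) * (1/2))"
    proof (rule Ck_on_mult[OF _ _ Ck_on_const])
      show "Ck_on k {0<..} (\<lambda>x. inverse (sqrt x))"
      proof (rule Ck_on_compose[OF _ _ Suc Ck_on_inverse])
        show "sqrt ` {0<..} \<subseteq> - {0}" by (clarsimp simp: image_subset_iff)
      qed (simp_all add: open_Compl)
    qed simp
  qed simp
qed

section \<open>A smooth cutoff from flat exponentials\<close>

text \<open>All derivatives of \<open>exp (- inverse x)\<close>, extended by zero to
  \<open>x \<le> 0\<close>, are combinations of these functions. The exponent \<open>m\<close> makes
  the family closed under differentiation.\<close>

definition exp_flat :: "nat \<Rightarrow> real \<Rightarrow> real"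
  where "exp_flat m x = (if x > 0 then inverse x ^ m * exp (- inverse x) else 0)"

lemma exp_flat_tendsto_0: "(exp_flat m \<longlongrightarrow> 0) (at 0)"
proof (rule filterlim_split_at)
  show "(exp_flat m \<longlongrightarrow> 0) (at_left 0)"
    by (rule tendsto_eventually) (auto simp: exp_flat_def eventually_at_filter)
  have "((\<lambda>x. inverse x ^ m / exp (inverse x)) \<longlongrightarrow> (0::real)) (at_right 0)"
    by (rule filterlim_compose[OF tendsto_power_div_exp_0 filterlim_inverse_at_top_right])
  then show "(exp_flat m \<longlongrightarrow> 0) (at_right 0)"
    by (rule Lim_transform_eventually)
      (auto simp: exp_flat_def eventually_at_filter exp_minus field_simps)
qed

lemma exp_flat_has_derivative:
  "(exp_flat m has_real_derivative exp_flat (m + 2) x - real m * exp_flat (m + 1) x) (at x)"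
proof -
  consider "x < 0" | "x = 0" | "x > 0" by linarith
  then show ?thesis
  proof cases
    case 1
    have "((\<lambda>x. 0) has_real_derivative 0) (at x)" by simp
    then have "(exp_flat m has_real_derivative 0) (at x)"
      by (rule has_field_derivative_transform_within_open[where S = "{..<0}"])
        (use 1 in \<open>auto simp: exp_flat_def\<close>)
    with 1 show ?thesis by (simp add: exp_flat_def)
  next
    case 2
    \<comment> \<open>For \<open>y \<noteq> 0\<close> the difference quotient at 0 is
      \<open>exp_flat (m + 1) y\<close>, another member of the family, and it tends to 0.\<close>
    have "((\<lambda>y. (exp_flat m y - exp_flat m 0) / (y - 0)) \<longlongrightarrow> 0) (at 0)"
      by (rule Lim_transform_eventually[OF exp_flat_tendsto_0[of "m + 1"]])
        (auto simp: exp_flat_def eventually_at_filter field_simps)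
    then have "(exp_flat m has_real_derivative 0) (at 0)"
      by (simp add: has_field_derivative_iff)
    with 2 show ?thesis by (simp add: exp_flat_def)
  next
    case 3
    have *: "((\<lambda>x. inverse x ^ m) has_real_derivative - real m * inverse x ^ (m + 1)) (at x)"
      using 3
    proof (induction m)
      case (Suc m)
      show ?case
        by (rule DERIV_cong[OF DERIV_mult[OF DERIV_inverse[of x] Suc.IH[OF Suc.prems], folded power_Suc]])
          (use Suc.prems in \<open>simp_all add: field_simps\<close>)
    qed simp
    have "((\<lambda>x. inverse x ^ m * exp (- inverse x)) has_real_derivative
        exp_flat (m + 2) x - real m * exp_flat (m + 1) x) (at x)"
      by (rule DERIV_cong[OF DERIV_mult[OF * DERIV_fun_exp[OF DERIV_minus[OF DERIV_inverse]]]])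
        (use 3 in \<open>auto simp: exp_flat_def power2_eq_square field_simps\<close>)
    then show ?thesis
      by (rule has_field_derivative_transform_within_open[where S = "{0<..}"])
        (use 3 in \<open>auto simp: exp_flat_def\<close>)
  qed
qed

lemma Ck_on_exp_flat: "Ck_on k UNIV (exp_flat m)"
proof (induction k arbitrary: m)
  case 0
  then show ?case
    using DERIV_isCont[OF exp_flat_has_derivative] by (auto intro: continuous_at_imp_continuous_on)
next
  case (Suc k)
  have "Ck_on k UNIV (\<lambda>x. exp_flat (m + 2) x + (- real m) * exp_flat (m + 1) x)"
    by (intro Ck_on_add Ck_on_mult Ck_on_const Suc; simp)
  then show ?case
    by (intro Ck_on_real_SucI[OF _ exp_flat_has_derivative]) auto
qed

lemma Cinf_on_subset: "Cinf_on S f \<Longrightarrow> T \<subseteq> S \<Longrightarrow> Cinf_on T f"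
  unfolding Cinf_on_def by (intro allI, rule Ck_on_subset[where S = S]) simp_all

lemma Cinf_on_cong:
  assumes "open S" "\<And>x. x \<in> S \<Longrightarrow> f x = g x"
  shows "Cinf_on S f \<longleftrightarrow> Cinf_on S g"
proof -
  have "Ck_on k S f \<longleftrightarrow> Ck_on k S g" for k
    using Ck_on_cong[OF assms(1), of f g k] Ck_on_cong[OF assms(1), of g f k] assms(2) by auto
  then show ?thesis by (simp add: Cinf_on_def)
qed

lemma Cinf_on_local:
  assumes "\<And>x. x \<in> S \<Longrightarrow> \<exists>T. open T \<and> x \<in> T \<and> Cinf_on T f"
  shows "Cinf_on S f"
  unfolding Cinf_on_def
proof
  fix k show "Ck_on k S f"
    by (rule Ck_on_local) (use assms in \<open>auto simp: Cinf_on_def\<close>)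
qed

lemma Cinf_on_const: "Cinf_on S (\<lambda>x. c)"
  by (simp add: Cinf_on_def Ck_on_const)

lemma Cinf_on_id: "open S \<Longrightarrow> Cinf_on S (\<lambda>x. x)"
  by (simp add: Cinf_on_def Ck_on_id)

lemma Cinf_on_bounded_linear:
  "open S \<Longrightarrow> bounded_linear L \<Longrightarrow> Cinf_on S f \<Longrightarrow> Cinf_on S (\<lambda>x. L (f x))"
  by (simp add: Cinf_on_def Ck_on_bounded_linear)

lemma Cinf_on_add: "open S \<Longrightarrow> Cinf_on S f \<Longrightarrow> Cinf_on S g \<Longrightarrow> Cinf_on S (\<lambda>x. f x + g x)"
  by (simp add: Cinf_on_def Ck_on_add)

lemma Cinf_on_mult:
  "open S \<Longrightarrow> Cinf_on S f \<Longrightarrow> Cinf_on S g \<Longrightarrow> Cinf_on S (\<lambda>x. f x * g x :: real)"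
  by (simp add: Cinf_on_def Ck_on_mult)

lemma Cinf_on_sum:
  "open S \<Longrightarrow> (\<And>i. i \<in> I \<Longrightarrow> Cinf_on S (f i)) \<Longrightarrow> Cinf_on S (\<lambda>x. \<Sum>i\<in>I. f i x)"
  by (simp add: Cinf_on_def Ck_on_sum)

lemma Cinf_on_compose:
  "open S \<Longrightarrow> open T \<Longrightarrow> Cinf_on S f \<Longrightarrow> Cinf_on T h \<Longrightarrow> f ` S \<subseteq> T \<Longrightarrow> Cinf_on S (\<lambda>x. h (f x))"
  unfolding Cinf_on_def by (intro allI, rule Ck_on_compose[where S = S and T = T and f = f and h = h]) simp_all

lemma Cinf_on_continuous: "open S \<Longrightarrow> Cinf_on S f \<Longrightarrow> continuous_on S f"
  by (rule Ck_on_continuous[where k = 0]) (simp_all add: Cinf_on_def)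

lemma Cinf_on_has_derivative:
  assumes "Cinf_on S f" "open S" "x \<in> S"
  shows "(f has_derivative frechet_derivative f (at x)) (at x)"
  using Ck_on_SucD(1)[where k = 0 and S = S and f = f and x = x] assms by (simp add: Cinf_on_def del: Ck_on.simps)

lemma Cinf_on_frechet_derivative:
  "Cinf_on S f \<Longrightarrow> Cinf_on S (\<lambda>x. frechet_derivative f (at x) v)"
proof -
  assume "Cinf_on S f"
  then have "Ck_on (Suc k) S f" for k by (simp add: Cinf_on_def del: Ck_on.simps)
  then show ?thesis by (simp add: Cinf_on_def)
qed

text \<open>The numerator vanishes from 1 on, the second summand of the denominator up to 1/2. These
  ranges are disjoint, so the denominator is positive, and the quotient is 1 up to 1/2 and 0 from 1
  on.\<close>

definition smooth_step :: "real \<Rightarrow> real"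
  where "smooth_step t = exp_flat 0 (1 - t) * inverse (exp_flat 0 (1 - t) + exp_flat 0 (t - 1/2))"

lemma exp_flat_nonneg: "0 \<le> exp_flat m x"
  and exp_flat_pos: "0 < x \<Longrightarrow> 0 < exp_flat m x"
  and exp_flat_nonpos_eq: "x \<le> 0 \<Longrightarrow> exp_flat m x = 0"
  by (auto simp: exp_flat_def)

lemma smooth_step_denominator_pos: "0 < exp_flat 0 (1 - t) + exp_flat 0 (t - 1/2)"
proof (cases "t < 1")
  case True
  then show ?thesis by (intro add_pos_nonneg exp_flat_nonneg exp_flat_pos) simp
next
  case False
  then show ?thesis by (intro add_nonneg_pos exp_flat_nonneg exp_flat_pos) simp
qed

lemma smooth_step_nonneg: "0 \<le> smooth_step t"
  using smooth_step_denominator_pos[of t] by (simp add: smooth_step_def exp_flat_nonneg)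

lemma smooth_step_eq_1: "t \<le> 1/2 \<Longrightarrow> smooth_step t = 1"
  using smooth_step_denominator_pos[of t] by (simp add: smooth_step_def exp_flat_nonpos_eq)

lemma smooth_step_eq_0: "t \<ge> 1 \<Longrightarrow> smooth_step t = 0"
  by (simp add: smooth_step_def exp_flat_nonpos_eq)

lemma Cinf_on_smooth_step: "Cinf_on UNIV smooth_step"
proof -
  have flat: "Cinf_on UNIV (exp_flat m)" for m
    by (simp add: Cinf_on_def Ck_on_exp_flat)
  have inv: "Cinf_on (- {0}) (inverse :: real \<Rightarrow> real)"
    by (simp add: Cinf_on_def Ck_on_inverse)
  have lin: "Cinf_on UNIV (\<lambda>t :: real. a + b * t)" for a b
    by (intro Cinf_on_add Cinf_on_mult Cinf_on_const Cinf_on_id open_UNIV)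
  have a: "Cinf_on UNIV (\<lambda>t. exp_flat 0 (1 - t))"
    using Cinf_on_compose[OF _ _ lin[of 1 "-1"] flat[of 0]] by simp
  have b: "Cinf_on UNIV (\<lambda>t. exp_flat 0 (t - 1/2))"
    using Cinf_on_compose[OF _ _ lin[of "-1/2" 1] flat[of 0]] by (simp add: add.commute)
  have "Cinf_on UNIV (\<lambda>t. inverse (exp_flat 0 (1 - t) + exp_flat 0 (t - 1/2)))"
  proof (rule Cinf_on_compose[OF _ _ Cinf_on_add[OF _ a b] inv])
    show "range (\<lambda>t. exp_flat 0 (1 - t) + exp_flat 0 (t - 1/2)) \<subseteq> - {0}"
      using smooth_step_denominator_pos by (auto simp: less_le)
  qed (auto simp: open_Compl)
  then show ?thesis
    unfolding smooth_step_def[abs_def] by (intro Cinf_on_mult a) auto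
qed

section \<open>Hadamard's lemma on a ball\<close>

lemma radial_in_ball:
  fixes c :: "'e::real_normed_vector"
  assumes "x \<in> ball c r" "t \<in> {0..1}"
  shows "c + t *\<^sub>R (x - c) \<in> ball c r"
proof -
  have "norm (t *\<^sub>R (x - c)) \<le> 1 * norm (x - c)"
    using assms(2) by (simp add: mult_left_le_one_le)
  then show ?thesis
    using assms(1) by (simp add: dist_norm norm_minus_commute)
qed

text \<open>Differentiation under the integral sign produces a factor \<open>t\<close> and replaces
  \<open>F\<close> by a directional derivative. The weight \<open>t ^ m\<close> absorbs the factor,
  which lets the induction on the order close.\<close>

lemma Ck_on_radial_integral:
  fixes F :: "'e::euclidean_space \<Rightarrow> real"
  assumes "Ck_on k (ball c r) F"
  shows "Ck_on k (ball c r) (\<lambda>x. integral {0..1} (\<lambda>t. t ^ m * F (c + t *\<^sub>R (x - c))))"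
  using assms
proof (induction k arbitrary: m F)
  have cont: "continuous_on (ball c r \<times> {0..1}) (\<lambda>(x, t). t ^ l * G (c + t *\<^sub>R (x - c)))"
    if "continuous_on (ball c r) G" for l and G :: "'e \<Rightarrow> real"
    unfolding split_def using radial_in_ball[of _ c r]
    by (intro continuous_intros continuous_on_compose2[OF that]) auto
  {
    case 0
    then have "continuous_on (ball c r) F" by simp
    from integral_continuous_on_param[OF cont[OF this, of m, folded cbox_interval]]
    show ?case by (simp add: cbox_interval)
  next
    case (Suc k)
    note F = Ck_on_SucD[OF Suc.prems open_ball]
    have Fcont: "continuous_on (ball c r) F"
      using Ck_on_continuous[OF open_ball Suc.prems] .
    \<comment> \<open>The Leibniz rule asks for the derivative as a jointly continuous family of
      bounded linear maps. Written in the basis, its continuity follows from that of the partial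
      derivatives.\<close>
    define fx :: "'e \<Rightarrow> real \<Rightarrow> 'e \<Rightarrow>\<^sub>L real" where
      "fx x t = (\<Sum>b\<in>Basis. (t ^ Suc m * frechet_derivative F (at (c + t *\<^sub>R (x - c))) b)
          *\<^sub>R blinfun_inner_left b)" for x t
    have fx: "blinfun_apply (fx x t) v = t ^ Suc m * frechet_derivative F (at (c + t *\<^sub>R (x - c))) v"
      if "x \<in> ball c r" "t \<in> {0..1}" for x t v
      using has_derivative_Basis_expansion[OF F(1)[OF radial_in_ball[OF that]], of v]
      by (simp add: fx_def blinfun.sum_left blinfun.scaleR_left sum_distrib_left mult_ac)
    have d: "((\<lambda>x. t ^ m * F (c + t *\<^sub>R (x - c))) has_derivative blinfun_apply (fx x t))
        (at x within ball c r)" if "x \<in> ball c r" "t \<in> cbox 0 1" for x t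
    proof -
      have t: "t \<in> {0..1}" using that by (simp add: cbox_interval)
      have lin: "linear (frechet_derivative F (at (c + t *\<^sub>R (x - c))))"
        using F(1)[OF radial_in_ball[OF that(1) t]] has_derivative_linear by blast
      have "((\<lambda>x. c + t *\<^sub>R (x - c)) has_derivative (\<lambda>v. t *\<^sub>R v)) (at x)"
        by (auto intro!: derivative_eq_intros)
      from diff_chain_at[OF this F(1)[OF radial_in_ball[OF that(1) t]]]
      have "((\<lambda>x. F (c + t *\<^sub>R (x - c))) has_derivative
          (\<lambda>v. frechet_derivative F (at (c + t *\<^sub>R (x - c))) (t *\<^sub>R v))) (at x)"
        by (simp add: o_def)
      then have "((\<lambda>x. t ^ m * F (c + t *\<^sub>R (x - c))) has_derivative
          (\<lambda>v. t ^ m * frechet_derivative F (at (c + t *\<^sub>R (x - c))) (t *\<^sub>R v))) (at x)"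
        by (rule has_derivative_mult_right)
      then have "((\<lambda>x. t ^ m * F (c + t *\<^sub>R (x - c))) has_derivative blinfun_apply (fx x t)) (at x)"
        by (rule has_derivative_eq_rhs)
          (use fx[OF that(1) t] linear_cmul[OF lin] in \<open>auto simp: mult_ac\<close>)
      then show ?thesis by (rule has_derivative_at_withinI)
    qed
    have int: "(\<lambda>t. t ^ m * F (c + t *\<^sub>R (x - c))) integrable_on cbox 0 1" if "x \<in> ball c r" for x
      unfolding cbox_interval using that radial_in_ball[of x c r]
      by (intro integrable_continuous_real continuous_intros continuous_on_compose2[OF Fcont]) auto
    have fxcont: "continuous_on (ball c r \<times> cbox 0 1) (\<lambda>(x, t). fx x t)"
      unfolding fx_def split_def cbox_interval
    proof (intro continuous_on_sum continuous_on_scaleR continuous_on_const)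
      fix b :: 'e
      have "continuous_on (ball c r) (\<lambda>y. frechet_derivative F (at y) b)"
        by (rule Ck_on_continuous[OF open_ball F(2)])
      from cont[OF this, of "Suc m"]
      show "continuous_on (ball c r \<times> {0..1})
          (\<lambda>x. snd x ^ Suc m * frechet_derivative F (at (c + snd x *\<^sub>R (fst x - c))) b)"
        by (simp add: split_def)
    qed
    have fxint: "fx x integrable_on cbox 0 1" if "x \<in> ball c r" for x
      by (rule integrable_continuous, rule continuous_on_compose2[OF fxcont, of _ "\<lambda>t. (x, t)", simplified])
        (use that in \<open>auto intro!: continuous_intros\<close>)
    have "Ck_on (Suc k) (ball c r) (\<lambda>x. integral (cbox 0 1) (\<lambda>t. t ^ m * F (c + t *\<^sub>R (x - c))))"
    proof (rule Ck_on_SucI[OF open_ball])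
      show "((\<lambda>x. integral (cbox 0 1) (\<lambda>t. t ^ m * F (c + t *\<^sub>R (x - c)))) has_derivative
          blinfun_apply (integral (cbox 0 1) (fx x))) (at x)" if "x \<in> ball c r" for x
        using leibniz_rule[OF d int fxcont that convex_ball] that
        by (simp add: at_within_open[OF that open_ball])
      fix v
      have "integral {0..1} (\<lambda>t. t ^ Suc m * frechet_derivative F (at (c + t *\<^sub>R (x - c))) v)
          = blinfun_apply (integral (cbox 0 1) (fx x)) v" if "x \<in> ball c r" for x
        unfolding blinfun_apply_integral[OF fxint[OF that], unfolded cbox_interval] cbox_interval
        by (rule integral_cong) (simp add: fx[OF that] del: power_Suc)
      then show "Ck_on k (ball c r) (\<lambda>x. blinfun_apply (integral (cbox 0 1) (fx x)) v)"
        by (rule Ck_on_cong[OF open_ball _ Suc.IH[OF F(2)]])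
    qed
    then show ?case by (simp add: cbox_interval)
  }
qed

text \<open>Integrating the derivative along the segment from \<open>c\<close> to \<open>x\<close>
  gives the increment of \<open>F\<close>, and \<open>G b\<close> is the mean of a partial
  derivative over that segment. This is what later shows that a derivation is determined by its
  values on coordinates.\<close>

lemma Cinf_on_Hadamard:
  fixes F :: "'e::euclidean_space \<Rightarrow> real"
  assumes "Cinf_on (ball c r) F"
  obtains G where "\<And>b. Cinf_on (ball c r) (G b)" "\<And>b. G b c = frechet_derivative F (at c) b"
    "\<And>x. x \<in> ball c r \<Longrightarrow> F x = F c + (\<Sum>b\<in>Basis. ((x - c) \<bullet> b) * G b x)"
proof
  define G where "G b x = integral {0..1} (\<lambda>t. frechet_derivative F (at (c + t *\<^sub>R (x - c))) b)" for b x
  show "Cinf_on (ball c r) (G b)" for b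
    unfolding Cinf_on_def G_def[abs_def]
  proof
    fix k
    have "Ck_on k (ball c r) (\<lambda>x. frechet_derivative F (at x) b)"
      using Cinf_on_frechet_derivative[OF assms, of b] by (simp add: Cinf_on_def)
    from Ck_on_radial_integral[OF this, of 0]
    show "Ck_on k (ball c r)
        (\<lambda>x. integral {0..1} (\<lambda>t. frechet_derivative F (at (c + t *\<^sub>R (x - c))) b))"
      by simp
  qed
  show "G b c = frechet_derivative F (at c) b" for b
    by (simp add: G_def)
  fix x assume x: "x \<in> ball c r"
  have cont: "continuous_on {0..1} (\<lambda>t. frechet_derivative F (at (c + t *\<^sub>R (x - c))) b)" for b
    using radial_in_ball[OF x]
    by (intro continuous_on_compose2[OF Cinf_on_continuous[OF open_ball Cinf_on_frechet_derivative[OF assms]]]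
        continuous_intros) auto
  have "((\<lambda>t. frechet_derivative F (at (c + t *\<^sub>R (x - c))) (x - c)) has_integral
      F (c + 1 *\<^sub>R (x - c)) - F (c + 0 *\<^sub>R (x - c))) {0..1}"
  proof (rule fundamental_theorem_of_calculus)
    fix t :: real assume t: "t \<in> {0..1}"
    have F: "(F has_derivative frechet_derivative F (at (c + t *\<^sub>R (x - c)))) (at (c + t *\<^sub>R (x - c)))"
      by (rule Cinf_on_has_derivative[OF assms open_ball radial_in_ball[OF x t]])
    have "((\<lambda>t. c + t *\<^sub>R (x - c)) has_derivative (\<lambda>s. s *\<^sub>R (x - c))) (at t)"
      by (auto intro!: derivative_eq_intros)
    from diff_chain_at[OF this F]
    have "((\<lambda>t. F (c + t *\<^sub>R (x - c))) has_derivative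
        (\<lambda>s. s *\<^sub>R frechet_derivative F (at (c + t *\<^sub>R (x - c))) (x - c))) (at t)"
      using linear_cmul[OF has_derivative_linear[OF F]] by (simp add: o_def)
    then show "((\<lambda>t. F (c + t *\<^sub>R (x - c))) has_vector_derivative
        frechet_derivative F (at (c + t *\<^sub>R (x - c))) (x - c)) (at t within {0..1})"
      unfolding has_vector_derivative_def by (rule has_derivative_at_withinI)
  qed simp
  then have "F x - F c = integral {0..1} (\<lambda>t. frechet_derivative F (at (c + t *\<^sub>R (x - c))) (x - c))"
    by (simp add: integral_unique)
  also have "\<dots> = integral {0..1} (\<lambda>t. \<Sum>b\<in>Basis. ((x - c) \<bullet> b) *
      frechet_derivative F (at (c + t *\<^sub>R (x - c))) b)"
    using has_derivative_Basis_expansion[OF Cinf_on_has_derivative[OF assms open_ball radial_in_ball[OF x]]]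
    by (intro integral_cong) simp
  also have "\<dots> = (\<Sum>b\<in>Basis. ((x - c) \<bullet> b) * G b x)"
    unfolding G_def
    by (subst integral_sum) (auto intro!: integrable_continuous_real continuous_intros cont)
  finally show "F x = F c + (\<Sum>b\<in>Basis. ((x - c) \<bullet> b) * G b x)" by simp
qed

subsection \<open>Smooth functions and tangent vectors on a manifold\<close>

lemma sum_fun_app: "(\<Sum>i\<in>A. f i) x = (\<Sum>i\<in>A. f i x)"
  by (induction A rule: infinite_finite_induct) simp_all

lemma scaleR_fun_app [simp]: "(c *\<^sub>R f) x = c *\<^sub>R f x"
  by (simp add: scaleR_fun_def)

lemma sum_Basis_vec:
  fixes F :: "real ^ 'n::finite \<Rightarrow> 'b::comm_monoid_add"
  shows "(\<Sum>b\<in>Basis. F b) = (\<Sum>i\<in>UNIV. F (axis i 1))"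
proof -
  have B: "(Basis :: (real ^ 'n) set) = range (\<lambda>i. axis i 1)"
    by (auto simp: Basis_vec_def)
  have "inj (\<lambda>i :: 'n. axis i (1 :: real))"
    by (auto simp: inj_def axis_eq_axis)
  then show ?thesis unfolding B by (simp add: sum.reindex)
qed

lemma Cinf_on_vec_nth: "open S \<Longrightarrow> Cinf_on S (\<lambda>x :: real ^ 'n::finite. x $ j)"
  by (intro Cinf_on_bounded_linear[OF _ bounded_linear_vec_nth] Cinf_on_id)

context smooth_manifold
begin

lemma chart_inj: "(U, \<phi>) \<in> atlas \<Longrightarrow> inj_on \<phi> U"
  by (rule inj_on_inverseI[where g = "inv_into U \<phi>"])
    (use chart_homeomorphism[of U \<phi>] in \<open>simp add: homeomorphism_def\<close>)

lemma chart_inv_into [simp]: "(U, \<phi>) \<in> atlas \<Longrightarrow> q \<in> U \<Longrightarrow> inv_into U \<phi> (\<phi> q) = q"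
  by (simp add: chart_inj)

lemma chart_continuous_on: "(U, \<phi>) \<in> atlas \<Longrightarrow> continuous_on U \<phi>"
  and chart_inv_continuous_on: "(U, \<phi>) \<in> atlas \<Longrightarrow> continuous_on (\<phi> ` U) (inv_into U \<phi>)"
  using chart_homeomorphism by (auto simp: homeomorphism_def)

lemma chart_image_open:
  assumes "(U, \<phi>) \<in> atlas" "open W"
  shows "open (\<phi> ` (U \<inter> W))"
proof -
  have "openin (top_of_set (\<phi> ` U)) (\<phi> ` (U \<inter> W))"
    by (rule homeomorphism_imp_open_map[OF chart_homeomorphism[OF assms(1)]])
      (use assms(2) in \<open>auto simp: openin_open\<close>)
  then show ?thesis using chart_open[OF assms(1)] openin_open_trans by blast
qed

lemma chart_image_open_subset: "(U, \<phi>) \<in> atlas \<Longrightarrow> open W \<Longrightarrow> W \<subseteq> U \<Longrightarrow> open (\<phi> ` W)"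
  using chart_image_open[of U \<phi> W] by (simp add: Int_absorb1)

lemma chart_vimage_open:
  assumes "(U, \<phi>) \<in> atlas" "open B"
  shows "open {q \<in> U. \<phi> q \<in> B}"
proof -
  have "open (\<phi> -` B \<inter> U)"
    using continuous_on_open_vimage[of U \<phi>] chart_open[OF assms(1)] chart_continuous_on[OF assms(1)] assms(2)
    by blast
  then show ?thesis by (simp add: vimage_def Int_def conj_commute)
qed

lemma chart_at: obtains U \<phi> where "(U, \<phi>) \<in> atlas" "p \<in> U"
proof -
  have "p \<in> (\<Union>(U, \<phi>)\<in>atlas. U)" using charts_cover by simp
  then show ?thesis using that by (auto split: prod.splits)
qed

lemma smooth_fun_onD: "smooth_fun_on W f \<Longrightarrow> (U, \<phi>) \<in> atlas \<Longrightarrow> Cinf_on (\<phi> ` (U \<inter> W)) (f \<circ> inv_into U \<phi>)"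
  unfolding smooth_fun_on_def by auto

lemma smooth_fun_onD_subset:
  "smooth_fun_on W f \<Longrightarrow> (U, \<phi>) \<in> atlas \<Longrightarrow> W \<subseteq> U \<Longrightarrow> Cinf_on (\<phi> ` W) (f \<circ> inv_into U \<phi>)"
  using smooth_fun_onD[of W f U \<phi>] by (simp add: Int_absorb1)

lemma smooth_fun_on_cong:
  assumes "open W" "\<And>q. q \<in> W \<Longrightarrow> f q = h q" "smooth_fun_on W f"
  shows "smooth_fun_on W h"
  unfolding smooth_fun_on_def
proof safe
  fix U \<phi> assume c: "(U, \<phi>) \<in> atlas"
  have "Cinf_on (\<phi> ` (U \<inter> W)) (h \<circ> inv_into U \<phi>) \<longleftrightarrow> Cinf_on (\<phi> ` (U \<inter> W)) (f \<circ> inv_into U \<phi>)"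
    by (rule Cinf_on_cong[OF chart_image_open[OF c assms(1)]]) (auto simp: c assms(2))
  then show "Cinf_on (\<phi> ` (U \<inter> W)) (h \<circ> inv_into U \<phi>)"
    using smooth_fun_onD[OF assms(3) c] by simp
qed

lemma smooth_fun_on_subset: "smooth_fun_on W f \<Longrightarrow> N \<subseteq> W \<Longrightarrow> smooth_fun_on N f"
  unfolding smooth_fun_on_def by (auto intro: Cinf_on_subset)

lemma smooth_fun_on_local:
  assumes "\<And>q. q \<in> W \<Longrightarrow> \<exists>N. open N \<and> q \<in> N \<and> smooth_fun_on N f"
  shows "smooth_fun_on W f"
  unfolding smooth_fun_on_def
proof safe
  fix U \<phi> assume c: "(U, \<phi>) \<in> atlas"
  show "Cinf_on (\<phi> ` (U \<inter> W)) (f \<circ> inv_into U \<phi>)"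
  proof (rule Cinf_on_local)
    fix x assume "x \<in> \<phi> ` (U \<inter> W)"
    then obtain q where q: "q \<in> U" "q \<in> W" "x = \<phi> q" by auto
    obtain N where N: "open N" "q \<in> N" "smooth_fun_on N f" using assms[OF q(2)] by auto
    show "\<exists>T. open T \<and> x \<in> T \<and> Cinf_on T (f \<circ> inv_into U \<phi>)"
      using chart_image_open[OF c N(1)] smooth_fun_onD[OF N(3) c] q N(2) by blast
  qed
qed

text \<open>Another chart sees \<open>f\<close> as \<open>F\<close> after a smooth transition map,
  so a test in one chart around \<open>W\<close> is enough.\<close>

lemma smooth_fun_on_chartI:
  assumes c: "(U, \<phi>) \<in> atlas" and W: "open W" "W \<subseteq> U"
    and F: "Cinf_on (\<phi> ` W) F" "\<And>q. q \<in> W \<Longrightarrow> f q = F (\<phi> q)"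
  shows "smooth_fun_on W f"
  unfolding smooth_fun_on_def
proof safe
  fix U' \<psi> assume c': "(U', \<psi>) \<in> atlas"
  have o: "open (\<psi> ` (U' \<inter> W))" "open (\<phi> ` W)"
    using chart_image_open[OF c' W(1)] chart_image_open_subset[OF c W] by auto
  have "Cinf_on (\<psi> ` (U' \<inter> W)) (\<phi> \<circ> inv_into U' \<psi>)"
    by (rule Cinf_on_subset[OF charts_compatible[OF c' c]]) (use W in auto)
  then have "Cinf_on (\<psi> ` (U' \<inter> W)) (\<lambda>x. F ((\<phi> \<circ> inv_into U' \<psi>) x))"
    by (rule Cinf_on_compose[OF o _ F(1)]) (auto simp: c')
  then show "Cinf_on (\<psi> ` (U' \<inter> W)) (f \<circ> inv_into U' \<psi>)"
    by (subst Cinf_on_cong[OF o(1), where g = "\<lambda>x. F ((\<phi> \<circ> inv_into U' \<psi>) x)"]) (auto simp: c' F(2))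
qed

lemma smooth_fun_on_const: "smooth_fun_on W (\<lambda>q. c)"
  by (auto simp: smooth_fun_on_def o_def Cinf_on_const)

lemma smooth_fun_on_add:
  "open W \<Longrightarrow> smooth_fun_on W f \<Longrightarrow> smooth_fun_on W h \<Longrightarrow> smooth_fun_on W (\<lambda>q. f q + h q)"
  unfolding smooth_fun_on_def[of _ "\<lambda>q. f q + h q"]
  using Cinf_on_add[OF chart_image_open smooth_fun_onD[of W f] smooth_fun_onD[of W h]]
  by (auto simp: o_def)

lemma smooth_fun_on_mult:
  "open W \<Longrightarrow> smooth_fun_on W f \<Longrightarrow> smooth_fun_on W h \<Longrightarrow> smooth_fun_on W (\<lambda>q. f q * h q)"
  unfolding smooth_fun_on_def[of _ "\<lambda>q. f q * h q"]
  using Cinf_on_mult[OF chart_image_open smooth_fun_onD[of W f] smooth_fun_onD[of W h]]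
  by (auto simp: o_def)

lemma smooth_fun_on_minus: "open W \<Longrightarrow> smooth_fun_on W f \<Longrightarrow> smooth_fun_on W (\<lambda>q. - f q)"
  using smooth_fun_on_mult[OF _ smooth_fun_on_const[of W "-1"], of f] by simp

lemma smooth_fun_on_diff:
  "open W \<Longrightarrow> smooth_fun_on W f \<Longrightarrow> smooth_fun_on W h \<Longrightarrow> smooth_fun_on W (\<lambda>q. f q - h q)"
  using smooth_fun_on_add[OF _ _ smooth_fun_on_minus, of W f h] by simp

lemma smooth_fun_on_sum:
  "open W \<Longrightarrow> (\<And>i. i \<in> I \<Longrightarrow> smooth_fun_on W (f i)) \<Longrightarrow> smooth_fun_on W (\<lambda>q. \<Sum>i\<in>I. f i q)"
  by (induction I rule: infinite_finite_induct) (auto intro: smooth_fun_on_add smooth_fun_on_const)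

lemma smooth_fun_on_prod:
  "open W \<Longrightarrow> (\<And>i. i \<in> I \<Longrightarrow> smooth_fun_on W (f i)) \<Longrightarrow> smooth_fun_on W (\<lambda>q. \<Prod>i\<in>I. f i q)"
  by (induction I rule: infinite_finite_induct) (auto intro: smooth_fun_on_mult smooth_fun_on_const)

lemma smooth_fun_on_compose:
  assumes "open W" "smooth_fun_on W f" "open T" "Cinf_on T h" "f ` W \<subseteq> T"
  shows "smooth_fun_on W (\<lambda>q. h (f q))"
  unfolding smooth_fun_on_def
proof safe
  fix U \<phi> assume c: "(U, \<phi>) \<in> atlas"
  have "Cinf_on (\<phi> ` (U \<inter> W)) (\<lambda>x. h ((f \<circ> inv_into U \<phi>) x))"
    by (rule Cinf_on_compose[OF chart_image_open[OF c assms(1)] assms(3) smooth_fun_onD[OF assms(2) c] assms(4)])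
      (use assms(5) c in auto)
  then show "Cinf_on (\<phi> ` (U \<inter> W)) ((\<lambda>q. h (f q)) \<circ> inv_into U \<phi>)"
    by (simp add: o_def)
qed

lemma smooth_fun_on_inverse:
  assumes "open W" "smooth_fun_on W f" "\<And>q. q \<in> W \<Longrightarrow> f q \<noteq> 0"
  shows "smooth_fun_on W (\<lambda>q. inverse (f q))"
proof (rule smooth_fun_on_compose[OF assms(1,2)])
  show "f ` W \<subseteq> - {0}" using assms(3) by force
qed (simp_all add: Cinf_on_def Ck_on_inverse open_Compl)

lemma smooth_fun_on_sqrt:
  assumes "open W" "smooth_fun_on W f" "\<And>q. q \<in> W \<Longrightarrow> f q > 0"
  shows "smooth_fun_on W (\<lambda>q. sqrt (f q))"
  by (rule smooth_fun_on_compose[OF assms(1,2), of "{0<..}"])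
    (use assms(3) in \<open>simp_all add: Cinf_on_def Ck_on_sqrt image_subset_iff\<close>)

lemma smooth_fun_on_det:
  fixes M :: "'a \<Rightarrow> real ^ 'm::finite ^ 'm"
  assumes "open W" "\<And>i j. smooth_fun_on W (\<lambda>q. M q $ i $ j)"
  shows "smooth_fun_on W (\<lambda>q. det (M q))"
  unfolding det_def
  by (intro smooth_fun_on_sum smooth_fun_on_mult smooth_fun_on_prod smooth_fun_on_const assms)

lemma smooth_fun_on_continuous_on:
  assumes "open W" "smooth_fun_on W f"
  shows "continuous_on W f"
proof (rule continuous_at_imp_continuous_on, rule ballI)
  fix q assume q: "q \<in> W"
  obtain U \<phi> where c: "(U, \<phi>) \<in> atlas" "q \<in> U" by (rule chart_at)
  have "continuous_on (U \<inter> W) (\<lambda>q. (f \<circ> inv_into U \<phi>) (\<phi> q))"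
    by (rule continuous_on_compose2[OF Cinf_on_continuous[OF chart_image_open[OF c(1) assms(1)] smooth_fun_onD[OF assms(2) c(1)]]])
      (auto intro: continuous_on_subset[OF chart_continuous_on[OF c(1)]])
  then have "continuous_on (U \<inter> W) f"
    by (rule continuous_on_eq) (simp add: c)
  then show "isCont f q"
    using continuous_on_eq_continuous_at[of "U \<inter> W" f] c q assms(1) chart_open[OF c(1)] by auto
qed

lemma smooth_funs_imp_smooth_fun_on: "f \<in> smooth_funs \<Longrightarrow> smooth_fun_on W f"
  using smooth_fun_on_subset by (auto simp: smooth_funs_def)

lemma smooth_funs_continuous: "f \<in> smooth_funs \<Longrightarrow> continuous_on UNIV f"
  by (simp add: smooth_funs_def smooth_fun_on_continuous_on)

lemma smooth_funs_local: "(\<And>q. \<exists>N. open N \<and> q \<in> N \<and> smooth_fun_on N f) \<Longrightarrow> f \<in> smooth_funs"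
  using smooth_fun_on_local[of UNIV f] by (auto simp: smooth_funs_def)

lemma smooth_funs_const: "(\<lambda>q. c) \<in> smooth_funs"
  and smooth_funs_add: "f \<in> smooth_funs \<Longrightarrow> h \<in> smooth_funs \<Longrightarrow> (\<lambda>q. f q + h q) \<in> smooth_funs"
  and smooth_funs_mult: "f \<in> smooth_funs \<Longrightarrow> h \<in> smooth_funs \<Longrightarrow> (\<lambda>q. f q * h q) \<in> smooth_funs"
  and smooth_funs_minus: "f \<in> smooth_funs \<Longrightarrow> (\<lambda>q. - f q) \<in> smooth_funs"
  and smooth_funs_diff: "f \<in> smooth_funs \<Longrightarrow> h \<in> smooth_funs \<Longrightarrow> (\<lambda>q. f q - h q) \<in> smooth_funs"
  and smooth_funs_sum: "(\<And>i. i \<in> I \<Longrightarrow> F i \<in> smooth_funs) \<Longrightarrow> (\<lambda>q. \<Sum>i\<in>I. F i q) \<in> smooth_funs"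
  by (simp_all add: smooth_funs_def smooth_fun_on_const smooth_fun_on_add smooth_fun_on_mult
      smooth_fun_on_minus smooth_fun_on_diff smooth_fun_on_sum)

lemmas smooth_funs_intros = smooth_funs_const smooth_funs_add smooth_funs_mult smooth_funs_minus
  smooth_funs_diff smooth_funs_sum

section \<open>Bump functions and extension of local data\<close>

text \<open>A radial step function in a chart, extended by zero. A closed ball inside the chart
  image makes the support compact.\<close>

lemma bump_function:
  assumes "open W" "p \<in> W"
  obtains \<eta> N where "\<eta> \<in> smooth_funs" "open N" "p \<in> N" "N \<subseteq> W" "\<And>q. q \<in> N \<Longrightarrow> \<eta> q = 1"
    "\<And>q. 0 \<le> \<eta> q" "compact (closure {q. \<eta> q \<noteq> 0})" "closure {q. \<eta> q \<noteq> 0} \<subseteq> W"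
proof -
  obtain U \<phi> where c: "(U, \<phi>) \<in> atlas" "p \<in> U" by (rule chart_at)
  have "\<phi> p \<in> \<phi> ` (U \<inter> W)" using c assms by auto
  then obtain r where r: "r > 0" "cball (\<phi> p) r \<subseteq> \<phi> ` (U \<inter> W)"
    using chart_image_open[OF c(1) assms(1)] open_contains_cball by metis
  define K where "K = inv_into U \<phi> ` cball (\<phi> p) r"
  have KW: "K \<subseteq> U \<inter> W" using r(2) c(1) by (auto simp: K_def subset_iff image_iff)
  have Kc: "compact K"
    unfolding K_def using r(2)
    by (intro compact_continuous_image continuous_on_subset[OF chart_inv_continuous_on[OF c(1)]]) auto
  \<comment> \<open>The Hausdorff property enters here: \<open>K\<close> is closed in the whole
    manifold, so the extension by zero is smooth across the boundary of \<open>U\<close>.\<close>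
  then have Kcl: "closed K" by (rule compact_imp_closed)
  \<comment> \<open>The squared distance is written as a sum of products so that smoothness follows
    from the closure rules. On \<open>N\<close> its ratio to \<open>r\<^sup>2\<close> is at most
    1/4, where the step function is 1; from ratio 1 on the step function is 0.\<close>
  define F where "F x = smooth_step ((\<Sum>b\<in>Basis. ((x - \<phi> p) \<bullet> b) * ((x - \<phi> p) \<bullet> b)) * (1 / r\<^sup>2))" for x
  have F_eq: "F x = smooth_step ((dist x (\<phi> p))\<^sup>2 / r\<^sup>2)" for x
    by (simp add: F_def dist_norm power2_norm_eq_inner euclidean_inner[symmetric])
  define \<eta> where "\<eta> q = (if q \<in> U then F (\<phi> q) else 0)" for q
  define N where "N = {q \<in> U. \<phi> q \<in> ball (\<phi> p) (r / 2)}"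
  have supp: "{q. \<eta> q \<noteq> 0} \<subseteq> K"
  proof
    fix q assume "q \<in> {q. \<eta> q \<noteq> 0}"
    then have q: "q \<in> U" "F (\<phi> q) \<noteq> 0" by (auto simp: \<eta>_def split: if_splits)
    have "(dist (\<phi> q) (\<phi> p))\<^sup>2 / r\<^sup>2 < 1"
      using q(2) smooth_step_eq_0 unfolding F_eq by (meson not_le)
    then have "dist (\<phi> q) (\<phi> p) < r"
      using r(1) by (simp add: power2_less_imp_less)
    then have "\<phi> q \<in> cball (\<phi> p) r" by (simp add: dist_commute)
    then show "q \<in> K" unfolding K_def using q(1) c(1) by (metis chart_inv_into imageI)
  qed
  have FC: "Cinf_on UNIV F"
  proof -
    have l: "Cinf_on UNIV (\<lambda>x :: real ^ 'n. (x - \<phi> p) \<bullet> b)" for b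
      unfolding diff_conv_add_uminus
      by (rule Cinf_on_bounded_linear[OF open_UNIV bounded_linear_inner_left])
        (intro Cinf_on_add Cinf_on_id Cinf_on_const open_UNIV)
    have "Cinf_on UNIV (\<lambda>x. (\<Sum>b\<in>Basis. ((x - \<phi> p) \<bullet> b) * ((x - \<phi> p) \<bullet> b)) * (1 / r\<^sup>2))"
      by (intro Cinf_on_mult Cinf_on_sum Cinf_on_const l open_UNIV)
    then show ?thesis
      unfolding F_def[abs_def] by (rule Cinf_on_compose[OF open_UNIV open_UNIV _ Cinf_on_smooth_step]) simp
  qed
  have sm: "\<eta> \<in> smooth_funs"
  proof (rule smooth_funs_local)
    fix q show "\<exists>N. open N \<and> q \<in> N \<and> smooth_fun_on N \<eta>"
    proof (cases "q \<in> U")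
      case True
      have "smooth_fun_on U \<eta>"
        by (rule smooth_fun_on_chartI[OF c(1) _ subset_refl Cinf_on_subset[OF FC]])
          (use chart_open[OF c(1)] in \<open>auto simp: \<eta>_def\<close>)
      with True chart_open[OF c(1)] show ?thesis by blast
    next
      case False
      then have "q \<in> - K" using KW by auto
      moreover have "open (- K)" using Kcl by (simp add: open_Compl)
      moreover have "smooth_fun_on (- K) \<eta>"
        by (rule smooth_fun_on_cong[OF _ _ smooth_fun_on_const[of "- K" 0]])
          (use supp Kcl in \<open>auto simp: open_Compl\<close>)
      ultimately show ?thesis by blast
    qed
  qed
  have cl: "closure {q. \<eta> q \<noteq> 0} \<subseteq> K" using supp Kcl by (rule closure_minimal)
  have "\<eta> q = 1" if "q \<in> N" for q
  proof -
    have "dist (\<phi> q) (\<phi> p) \<le> r / 2" "q \<in> U" using that by (auto simp: N_def dist_commute)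
    then have "(dist (\<phi> q) (\<phi> p))\<^sup>2 \<le> (r / 2)\<^sup>2" by (intro power_mono) auto
    then have "(dist (\<phi> q) (\<phi> p))\<^sup>2 / r\<^sup>2 \<le> 1 / 4" using r(1) by (simp add: field_simps)
    then have "smooth_step ((dist (\<phi> q) (\<phi> p))\<^sup>2 / r\<^sup>2) = 1"
      by (intro smooth_step_eq_1) linarith
    then show ?thesis using \<open>q \<in> U\<close> by (simp add: \<eta>_def F_eq)
  qed
  moreover have "N \<subseteq> W"
  proof
    fix q assume "q \<in> N"
    then have "\<phi> q \<in> cball (\<phi> p) r" "q \<in> U" using r(1) by (auto simp: N_def dist_commute)
    then have "q \<in> K" unfolding K_def using c(1) by (metis chart_inv_into imageI)
    then show "q \<in> W" using KW by auto
  qed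
  moreover have "open N" unfolding N_def by (rule chart_vimage_open[OF c(1)]) simp
  moreover have "p \<in> N" using c r by (simp add: N_def)
  moreover have "0 \<le> \<eta> q" for q by (simp add: \<eta>_def F_eq smooth_step_nonneg)
  moreover have "compact (closure {q. \<eta> q \<noteq> 0})"
    using compact_Int_closed[OF Kc, of "closure {q. \<eta> q \<noteq> 0}"] cl by (simp add: Int_absorb1)
  ultimately show ?thesis using that[OF sm] cl KW by blast
qed

lemma smooth_funs_bump_mult:
  assumes "\<eta> \<in> smooth_funs" "closure {q. \<eta> q \<noteq> 0} \<subseteq> W" "open W" "smooth_fun_on W f"
  shows "(\<lambda>q. \<eta> q * f q) \<in> smooth_funs"
proof (rule smooth_funs_local)
  fix q show "\<exists>N. open N \<and> q \<in> N \<and> smooth_fun_on N (\<lambda>q. \<eta> q * f q)"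
  proof (cases "q \<in> W")
    case True
    have "smooth_fun_on W (\<lambda>q. \<eta> q * f q)"
      by (intro smooth_fun_on_mult smooth_funs_imp_smooth_fun_on assms)
    with True assms(3) show ?thesis by blast
  next
    case False
    let ?N = "- closure {q. \<eta> q \<noteq> 0}"
    have N: "open ?N" by (rule open_Compl[OF closed_closure])
    have z: "\<eta> q' = 0" if "q' \<in> ?N" for q'
      using that closure_subset[of "{q. \<eta> q \<noteq> 0}"] by blast
    have "0 = \<eta> q' * f q'" if "q' \<in> ?N" for q'
      using z[OF that] by simp
    from smooth_fun_on_cong[OF N this smooth_fun_on_const]
    have "smooth_fun_on ?N (\<lambda>q. \<eta> q * f q)" .
    moreover have "q \<in> ?N" using False assms(2) by blast
    ultimately show ?thesis using N by blast
  qed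
qed

text \<open>Tangent vectors act on globally smooth functions, so a function known only on
  \<open>W\<close> is replaced by a global one with the same germ at \<open>p\<close>.\<close>

lemma smooth_fun_extension:
  assumes "smooth_fun_on W f" "open W" "p \<in> W"
  obtains h N where "h \<in> smooth_funs" "open N" "p \<in> N" "N \<subseteq> W" "\<And>q. q \<in> N \<Longrightarrow> h q = f q"
proof -
  obtain \<eta> N where \<eta>: "\<eta> \<in> smooth_funs" "open N" "p \<in> N" "N \<subseteq> W" "\<And>q. q \<in> N \<Longrightarrow> \<eta> q = 1"
    "\<And>q. 0 \<le> \<eta> q" "compact (closure {q. \<eta> q \<noteq> 0})" "closure {q. \<eta> q \<noteq> 0} \<subseteq> W"
    by (rule bump_function[OF assms(2,3)]) (rule that)
  show ?thesis
    by (rule that[OF smooth_funs_bump_mult[OF \<eta>(1,8) assms(2,1)] \<eta>(2-4)]) (simp add: \<eta>(5))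
qed

text \<open>Coordinates live on \<open>U\<close> only. The functions \<open>\<xi> j\<close> are
  global and agree with them on the smaller \<open>W\<close>, so derivations can be applied to
  them.\<close>

lemma local_coordinates:
  obtains U \<phi> \<xi> W where "(U, \<phi>) \<in> atlas" "open W" "p \<in> W" "W \<subseteq> U"
    "\<And>j. \<xi> j \<in> smooth_funs" "\<And>q j. q \<in> W \<Longrightarrow> \<phi> q $ j = \<xi> j q"
proof -
  obtain U \<phi> where c: "(U, \<phi>) \<in> atlas" "p \<in> U" by (rule chart_at)
  have U: "open U" using chart_open[OF c(1)] by simp
  obtain \<eta> N where \<eta>: "\<eta> \<in> smooth_funs" "open N" "p \<in> N" "N \<subseteq> U" "\<And>q. q \<in> N \<Longrightarrow> \<eta> q = 1"
    "\<And>q. 0 \<le> \<eta> q" "compact (closure {q. \<eta> q \<noteq> 0})" "closure {q. \<eta> q \<noteq> 0} \<subseteq> U"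
    by (rule bump_function[OF U c(2)]) (rule that)
  have "smooth_fun_on U (\<lambda>q. \<phi> q $ j)" for j
    by (rule smooth_fun_on_chartI[OF c(1) U subset_refl Cinf_on_vec_nth[of _ j]])
      (use chart_open[OF c(1)] in auto)
  then have "(\<lambda>q. \<eta> q * \<phi> q $ j) \<in> smooth_funs" for j
    by (rule smooth_funs_bump_mult[OF \<eta>(1,8) U])
  then show ?thesis
    by (rule that[OF c(1) \<eta>(2-4), of "\<lambda>j q. \<eta> q * \<phi> q $ j"]) (simp add: \<eta>(5))
qed

end

section \<open>Point derivations and their coordinates\<close>

context smooth_manifold
begin

lemma tangent_add: "v \<in> tangent_space p \<Longrightarrow> f \<in> smooth_funs \<Longrightarrow> h \<in> smooth_funs \<Longrightarrow> v (\<lambda>q. f q + h q) = v f + v h"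
  and tangent_cmult: "v \<in> tangent_space p \<Longrightarrow> f \<in> smooth_funs \<Longrightarrow> v (\<lambda>q. c * f q) = c * v f"
  and tangent_mult: "v \<in> tangent_space p \<Longrightarrow> f \<in> smooth_funs \<Longrightarrow> h \<in> smooth_funs \<Longrightarrow>
    v (\<lambda>q. f q * h q) = f p * v h + h p * v f"
  and tangent_nonsmooth: "v \<in> tangent_space p \<Longrightarrow> f \<notin> smooth_funs \<Longrightarrow> v f = 0"
  by (simp_all add: tangent_space_def)

lemma tangent_const:
  assumes "v \<in> tangent_space p" shows "v (\<lambda>q. c) = 0"
proof -
  have "v (\<lambda>q. 1) = 0"
    using tangent_mult[OF assms smooth_funs_const[of 1] smooth_funs_const[of 1]] by simp
  then show ?thesis using tangent_cmult[OF assms smooth_funs_const[of 1], of c] by simp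
qed

lemma tangent_minus: "v \<in> tangent_space p \<Longrightarrow> f \<in> smooth_funs \<Longrightarrow> v (\<lambda>q. - f q) = - v f"
  using tangent_cmult[of v p f "-1"] by simp

lemma tangent_diff: "v \<in> tangent_space p \<Longrightarrow> f \<in> smooth_funs \<Longrightarrow> h \<in> smooth_funs \<Longrightarrow>
    v (\<lambda>q. f q - h q) = v f - v h"
  using tangent_add[of v p f "\<lambda>q. - h q"] tangent_minus[of v p h] smooth_funs_minus by simp

lemma tangent_sum:
  assumes "v \<in> tangent_space p" "\<And>i. i \<in> I \<Longrightarrow> F i \<in> smooth_funs"
  shows "v (\<lambda>q. \<Sum>i\<in>I. F i q) = (\<Sum>i\<in>I. v (F i))"
  using assms(2)
  by (induction I rule: infinite_finite_induct)
    (auto simp: tangent_const[OF assms(1)] tangent_add[OF assms(1)] smooth_funs_sum)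

text \<open>For a bump function \<open>\<eta>\<close> supported where \<open>f\<close> and
  \<open>h\<close> agree, \<open>\<eta> * (f - h)\<close> is identically zero. The Leibniz rule at
  \<open>p\<close>, where \<open>\<eta>\<close> is 1 and the difference vanishes, leaves
  \<open>v f - v h\<close>.\<close>

lemma tangent_local:
  assumes v: "v \<in> tangent_space p" and fh: "f \<in> smooth_funs" "h \<in> smooth_funs"
    and ev: "eventually (\<lambda>q. f q = h q) (nhds p)"
  shows "v f = v h"
proof -
  obtain N where N: "open N" "p \<in> N" "\<And>q. q \<in> N \<Longrightarrow> f q = h q"
    using ev by (auto simp: eventually_nhds)
  obtain \<eta> N' where \<eta>: "\<eta> \<in> smooth_funs" "open N'" "p \<in> N'" "N' \<subseteq> N" "\<And>q. q \<in> N' \<Longrightarrow> \<eta> q = 1"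
    "\<And>q. 0 \<le> \<eta> q" "compact (closure {q. \<eta> q \<noteq> 0})" "closure {q. \<eta> q \<noteq> 0} \<subseteq> N"
    by (rule bump_function[OF N(1,2)]) (rule that)
  have "\<eta> q * (f q - h q) = 0" for q
    using N(3)[of q] \<eta>(8) closure_subset[of "{q. \<eta> q \<noteq> 0}"] by (cases "\<eta> q = 0") auto
  then have "(\<lambda>q. \<eta> q * (f q - h q)) = (\<lambda>q. 0)" by (rule ext)
  then have "0 = v (\<lambda>q. \<eta> q * (f q - h q))" using tangent_const[OF v, of 0] by (simp only:)
  also have "\<dots> = \<eta> p * v (\<lambda>q. f q - h q) + (f p - h p) * v \<eta>"
    by (rule tangent_mult[OF v \<eta>(1) smooth_funs_diff[OF fh]])
  also have "\<dots> = v f - v h" using \<eta>(3,5) N(2,3) by (simp add: tangent_diff[OF v fh])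
  finally show ?thesis by simp
qed

lemma tangent_eqI:
  assumes "v \<in> tangent_space p" "w \<in> tangent_space p" "\<And>f. f \<in> smooth_funs \<Longrightarrow> v f = w f"
  shows "v = w"
proof
  fix f show "v f = w f"
    using assms(3)[of f] tangent_nonsmooth[OF assms(1), of f] tangent_nonsmooth[OF assms(2), of f]
    by (cases "f \<in> smooth_funs") auto
qed

lemma subspace_tangent_space: "subspace (tangent_space p)"
  by (auto simp: subspace_def tangent_space_def algebra_simps)

lemma eventually_openI: "open N \<Longrightarrow> p \<in> N \<Longrightarrow> (\<And>q. q \<in> N \<Longrightarrow> P q) \<Longrightarrow> eventually P (nhds (p :: 'a))"
  by (auto simp: eventually_nhds)

text \<open>Hadamard's lemma writes \<open>f\<close> near \<open>p\<close> as a constant plus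
  products \<open>(\<xi> j - \<xi> j p) * k j\<close>. The first factors vanish at \<open>p\<close>,
  so a derivation keeps only \<open>v (\<xi> j) * k j p\<close>, and \<open>k j p\<close> is the
  partial derivative.\<close>

lemma tangent_coords:
  assumes c: "(U, \<phi>) \<in> atlas" and W: "open W" "p \<in> W" "W \<subseteq> U"
    and \<xi>: "\<And>j. \<xi> j \<in> smooth_funs" "\<And>q j. q \<in> W \<Longrightarrow> \<phi> q $ j = \<xi> j q"
    and v: "v \<in> tangent_space p" and f: "f \<in> smooth_funs"
  shows "v f = (\<Sum>j\<in>UNIV. v (\<xi> j) * frechet_derivative (f \<circ> inv_into U \<phi>) (at (\<phi> p)) (axis j 1))"
proof -
  let ?F = "f \<circ> inv_into U \<phi>"
  have "\<phi> p \<in> \<phi> ` W" using W by auto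
  then obtain r where r: "r > 0" "ball (\<phi> p) r \<subseteq> \<phi> ` W"
    using chart_image_open_subset[OF c W(1,3)] open_contains_ball by metis
  have FC: "Cinf_on (ball (\<phi> p) r) ?F"
    using Cinf_on_subset[OF smooth_fun_onD_subset[OF smooth_funs_imp_smooth_fun_on[OF f] c W(3)] r(2)] .
  obtain G where G: "\<And>b. Cinf_on (ball (\<phi> p) r) (G b)"
    "\<And>b. G b (\<phi> p) = frechet_derivative ?F (at (\<phi> p)) b"
    "\<And>x. x \<in> ball (\<phi> p) r \<Longrightarrow> ?F x = ?F (\<phi> p) + (\<Sum>b\<in>Basis. ((x - \<phi> p) \<bullet> b) * G b x)"
    by (rule Cinf_on_Hadamard[OF FC]) (rule that)
  \<comment> \<open>Hadamard's lemma works on a ball in the chart image. Its preimage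
    \<open>A\<close> stays inside \<open>W\<close> because the chart is injective, and there the
    \<open>\<xi> j\<close> are the coordinates.\<close>
  define A where "A = {q \<in> U. \<phi> q \<in> ball (\<phi> p) r}"
  have A: "open A" unfolding A_def by (rule chart_vimage_open[OF c open_ball])
  have pA: "p \<in> A" using r(1) W by (auto simp: A_def)
  have AW: "A \<subseteq> W"
  proof
    fix q assume "q \<in> A"
    then have "q \<in> U" "\<phi> q \<in> \<phi> ` W" using r(2) by (auto simp: A_def)
    then show "q \<in> W" using inj_on_image_mem_iff[OF chart_inj[OF c]] W(3) by blast
  qed
  obtain \<eta> N where \<eta>: "\<eta> \<in> smooth_funs" "open N" "p \<in> N" "N \<subseteq> A" "\<And>q. q \<in> N \<Longrightarrow> \<eta> q = 1"
    "\<And>q. 0 \<le> \<eta> q" "compact (closure {q. \<eta> q \<noteq> 0})" "closure {q. \<eta> q \<noteq> 0} \<subseteq> A"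
    by (rule bump_function[OF A pA]) (rule that)
  define k where "k j q = \<eta> q * G (axis j 1) (\<phi> q)" for j q
  have k: "k j \<in> smooth_funs" for j
    unfolding k_def[abs_def]
  proof (rule smooth_funs_bump_mult[OF \<eta>(1,8) A])
    show "smooth_fun_on A (\<lambda>q. G (axis j 1) (\<phi> q))"
      by (rule smooth_fun_on_chartI[OF c A _ Cinf_on_subset[OF G(1)]]) (auto simp: A_def)
  qed
  have eq: "f q = f p + (\<Sum>j\<in>UNIV. (\<xi> j q - \<xi> j p) * k j q)" if q: "q \<in> N" for q
  proof -
    have q': "q \<in> A" "q \<in> U" "\<phi> q \<in> ball (\<phi> p) r" using q \<eta>(4) by (auto simp: A_def)
    have qW: "q \<in> W" using q' AW by auto
    have "?F (\<phi> q) = ?F (\<phi> p) + (\<Sum>j\<in>UNIV. ((\<phi> q - \<phi> p) \<bullet> axis j 1) * G (axis j 1) (\<phi> q))"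
      using G(3)[OF q'(3)] by (simp only: sum_Basis_vec)
    moreover have "?F (\<phi> q) = f q" "?F (\<phi> p) = f p" using c q' W by auto
    moreover have "(\<phi> q - \<phi> p) \<bullet> axis j 1 = \<xi> j q - \<xi> j p" for j
      using \<xi>(2)[OF qW] \<xi>(2)[OF W(2)] by (simp add: inner_axis)
    ultimately show ?thesis by (simp add: k_def \<eta>(5)[OF q])
  qed
  have "v f = v (\<lambda>q. f p + (\<Sum>j\<in>UNIV. (\<xi> j q - \<xi> j p) * k j q))"
    by (rule tangent_local[OF v f _ eventually_openI[OF \<eta>(2,3) eq]])
      (intro smooth_funs_intros \<xi>(1) k)
  also have "\<dots> = (\<Sum>j\<in>UNIV. v (\<lambda>q. (\<xi> j q - \<xi> j p) * k j q))"
    by (simp add: tangent_add[OF v] tangent_sum[OF v] tangent_const[OF v] smooth_funs_intros \<xi>(1) k)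
  also have "\<dots> = (\<Sum>j\<in>UNIV. v (\<xi> j) * k j p)"
    by (simp add: tangent_mult[OF v] tangent_diff[OF v] tangent_const[OF v] smooth_funs_intros \<xi>(1) k mult.commute)
  also have "\<dots> = (\<Sum>j\<in>UNIV. v (\<xi> j) * frechet_derivative ?F (at (\<phi> p)) (axis j 1))"
    using G(2) \<eta>(3,5) by (simp add: k_def)
  finally show ?thesis .
qed

lemma chart_has_derivative:
  assumes "(U, \<phi>) \<in> atlas" "p \<in> U" "f \<in> smooth_funs"
  shows "((f \<circ> inv_into U \<phi>) has_derivative frechet_derivative (f \<circ> inv_into U \<phi>) (at (\<phi> p))) (at (\<phi> p))"
  by (rule Cinf_on_has_derivative[OF smooth_fun_onD_subset[OF smooth_funs_imp_smooth_fun_on[OF assms(3)] assms(1) subset_refl]])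
    (use chart_open[OF assms(1)] assms(2) in auto)

lemma coord_vector_tangent:
  assumes c: "(U, \<phi>) \<in> atlas" "p \<in> U"
  shows "coord_vector U \<phi> i p \<in> tangent_space p"
proof -
  note D = chart_has_derivative[OF c]
  have p: "inv_into U \<phi> (\<phi> p) = p" using c by simp
  have "frechet_derivative ((\<lambda>q. f q + h q) \<circ> inv_into U \<phi>) (at (\<phi> p)) x =
      frechet_derivative (f \<circ> inv_into U \<phi>) (at (\<phi> p)) x + frechet_derivative (h \<circ> inv_into U \<phi>) (at (\<phi> p)) x"
    if "f \<in> smooth_funs" "h \<in> smooth_funs" for f h x
    using fun_cong[OF frechet_derivative_at[OF has_derivative_add[OF D[OF that(1)] D[OF that(2)]]], of x]
    by (simp add: o_def)
  moreover have "frechet_derivative ((\<lambda>q. b * f q) \<circ> inv_into U \<phi>) (at (\<phi> p)) x =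
      b * frechet_derivative (f \<circ> inv_into U \<phi>) (at (\<phi> p)) x"
    if "f \<in> smooth_funs" for f b x
    using fun_cong[OF frechet_derivative_at[OF has_derivative_mult_right[OF D[OF that]]], of b x]
    by (simp add: o_def)
  moreover have "frechet_derivative ((\<lambda>q. f q * h q) \<circ> inv_into U \<phi>) (at (\<phi> p)) x =
      f p * frechet_derivative (h \<circ> inv_into U \<phi>) (at (\<phi> p)) x + h p * frechet_derivative (f \<circ> inv_into U \<phi>) (at (\<phi> p)) x"
    if "f \<in> smooth_funs" "h \<in> smooth_funs" for f h x
    using fun_cong[OF frechet_derivative_at[OF has_derivative_mult[OF D[OF that(1)] D[OF that(2)]]], of x] p
    by (simp add: o_def mult.commute[of _ "h p"])
  ultimately show ?thesis
    by (simp add: tangent_space_def coord_vector_def smooth_funs_intros)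
qed

lemma coord_vector_coordinate:
  assumes c: "(U, \<phi>) \<in> atlas" and W: "open W" "p \<in> W" "W \<subseteq> U"
    and \<xi>: "\<And>j. \<xi> j \<in> smooth_funs" "\<And>q j. q \<in> W \<Longrightarrow> \<phi> q $ j = \<xi> j q"
  shows "coord_vector U \<phi> i p (\<xi> j) = of_bool (i = j)"
proof -
  have "frechet_derivative (\<xi> j \<circ> inv_into U \<phi>) (at (\<phi> p)) = frechet_derivative (\<lambda>x. x $ j) (at (\<phi> p))"
  proof (rule frechet_derivative_transform_within_open)
    show "(\<xi> j \<circ> inv_into U \<phi>) differentiable at (\<phi> p)"
      using chart_has_derivative[OF c _ \<xi>(1)] W by (auto simp: differentiable_def)
    show "open (\<phi> ` W)" by (rule chart_image_open_subset[OF c W(1,3)])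
    show "(\<xi> j \<circ> inv_into U \<phi>) x = x $ j" if "x \<in> \<phi> ` W" for x
      using that \<xi>(2) W(3) c by auto
  qed (use W in auto)
  also have "\<dots> = (\<lambda>x. x $ j)"
    by (rule frechet_derivative_at[symmetric]) (rule bounded_linear_imp_has_derivative[OF bounded_linear_vec_nth])
  finally show ?thesis by (auto simp: coord_vector_def \<xi>(1) axis_def)
qed

lemma tangent_coord_expansion:
  assumes c: "(U, \<phi>) \<in> atlas" and W: "open W" "p \<in> W" "W \<subseteq> U"
    and \<xi>: "\<And>j. \<xi> j \<in> smooth_funs" "\<And>q j. q \<in> W \<Longrightarrow> \<phi> q $ j = \<xi> j q"
    and v: "v \<in> tangent_space p"
  shows "v = (\<Sum>j\<in>UNIV. v (\<xi> j) *\<^sub>R coord_vector U \<phi> j p)"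
proof (rule tangent_eqI[OF v])
  show "(\<Sum>j\<in>UNIV. v (\<xi> j) *\<^sub>R coord_vector U \<phi> j p) \<in> tangent_space p"
    by (intro subspace_sum subspace_scale subspace_tangent_space coord_vector_tangent[OF c]) (use W in blast)
  fix f assume "f \<in> smooth_funs"
  then show "v f = (\<Sum>j\<in>UNIV. v (\<xi> j) *\<^sub>R coord_vector U \<phi> j p) f"
    using tangent_coords[OF c W \<xi> v] by (simp add: sum_fun_app coord_vector_def)
qed

text \<open>The coordinate vectors are dual to the functions \<open>\<xi> j\<close>, which gives
  independence; they span by the coordinate expansion of a derivation.\<close>

lemma dim_tangent_space: "dim (tangent_space p) = CARD('n)"
proof -
  obtain U \<phi> \<xi> W where c: "(U, \<phi>) \<in> atlas" and W: "open W" "p \<in> W" "W \<subseteq> U"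
    and \<xi>: "\<And>j. \<xi> j \<in> smooth_funs" "\<And>q j. q \<in> W \<Longrightarrow> \<phi> q $ j = \<xi> j q"
    by (rule local_coordinates) (rule that)
  let ?d = "\<lambda>i. coord_vector U \<phi> i p"
  have \<delta>: "?d i (\<xi> j) = of_bool (i = j)" for i j
    by (rule coord_vector_coordinate[OF c W \<xi>])
  have inj: "inj ?d"
  proof (rule injI)
    fix i j assume "?d i = ?d j"
    then have "?d i (\<xi> j) = ?d j (\<xi> j)" by simp
    then show "i = j" by (simp add: \<delta> split: if_splits)
  qed
  have "independent (range ?d)"
  proof
    assume "dependent (range ?d)"
    then obtain u w where w: "w \<in> range ?d" "u w \<noteq> 0" and z: "(\<Sum>x\<in>range ?d. u x *\<^sub>R x) = 0"
      unfolding dependent_finite[OF finite_imageI[OF finite]] by blast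
    obtain j where j: "w = ?d j" using w by auto
    have "(\<Sum>i\<in>UNIV. u (?d i) *\<^sub>R ?d i) = 0" using z inj by (simp add: sum.reindex)
    then have "(\<Sum>i\<in>UNIV. u (?d i) *\<^sub>R ?d i) (\<xi> j) = 0" by simp
    then show False using w(2) by (simp add: sum_fun_app \<delta> j)
  qed
  moreover have "span (range ?d) = tangent_space p"
  proof
    have "p \<in> U" using W(2,3) by blast
    then have "range ?d \<subseteq> tangent_space p"
      by (intro image_subsetI coord_vector_tangent[OF c])
    then show "span (range ?d) \<subseteq> tangent_space p" by (intro span_minimal subspace_tangent_space)
    show "tangent_space p \<subseteq> span (range ?d)"
    proof
      fix v assume v: "v \<in> tangent_space p"
      have "v = (\<Sum>j\<in>UNIV. v (\<xi> j) *\<^sub>R ?d j)" by (rule tangent_coord_expansion[OF c W \<xi> v])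
      moreover have "(\<Sum>j\<in>UNIV. v (\<xi> j) *\<^sub>R ?d j) \<in> span (range ?d)"
        by (intro span_sum span_scale span_base rangeI)
      ultimately show "v \<in> span (range ?d)" by simp
    qed
  qed
  moreover have "span (tangent_space p) = tangent_space p"
    by (simp add: subspace_tangent_space)
  ultimately have "dim (tangent_space p) = card (range ?d)"
    by (intro dim_eq_card) (simp_all only: not_False_eq_True)
  then show ?thesis using inj by (simp add: card_image)
qed

section \<open>Vector fields and Lie brackets\<close>

lemma vector_fieldsI:
  "(\<And>p. X p \<in> tangent_space p) \<Longrightarrow> (\<And>f. f \<in> smooth_funs \<Longrightarrow> (\<lambda>p. X p f) \<in> smooth_funs) \<Longrightarrow> X \<in> vector_fields"
  by (simp add: vector_fields_def vector_field_on_def smooth_funs_def)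

lemma vector_field_tangent: "X \<in> vector_fields \<Longrightarrow> X p \<in> tangent_space p"
  and vector_field_smooth: "X \<in> vector_fields \<Longrightarrow> f \<in> smooth_funs \<Longrightarrow> (\<lambda>p. X p f) \<in> smooth_funs"
  by (simp_all add: vector_fields_def vector_field_on_def smooth_funs_def)

lemma vector_field_nonsmooth: "X \<in> vector_fields \<Longrightarrow> f \<notin> smooth_funs \<Longrightarrow> X p f = 0"
  by (rule tangent_nonsmooth[OF vector_field_tangent])

lemma vector_field_eqI:
  "X \<in> vector_fields \<Longrightarrow> Y \<in> vector_fields \<Longrightarrow> (\<And>p f. f \<in> smooth_funs \<Longrightarrow> X p f = Y p f) \<Longrightarrow> X = Y"
  by (rule ext, rule tangent_eqI) (auto intro: vector_field_tangent)

lemma vector_fields_zero: "0 \<in> vector_fields"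
  by (rule vector_fieldsI) (auto simp: subspace_0[OF subspace_tangent_space] smooth_funs_const)

lemma vector_fields_add: "X \<in> vector_fields \<Longrightarrow> Y \<in> vector_fields \<Longrightarrow> X + Y \<in> vector_fields"
  by (rule vector_fieldsI)
    (simp_all add: vector_field_smooth subspace_add[OF subspace_tangent_space] vector_field_tangent smooth_funs_add)

lemma vector_fields_mult: "f \<in> smooth_funs \<Longrightarrow> X \<in> vector_fields \<Longrightarrow> (\<lambda>p. f p *\<^sub>R X p) \<in> vector_fields"
  by (rule vector_fieldsI)
    (simp_all add: vector_field_smooth subspace_scale[OF subspace_tangent_space] vector_field_tangent smooth_funs_mult)

lemma vector_fields_minus: "X \<in> vector_fields \<Longrightarrow> - X \<in> vector_fields"
  using vector_fields_mult[OF smooth_funs_const[of "-1"], of X] by (simp add: fun_Compl_def)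

lemma vector_fields_diff: "X \<in> vector_fields \<Longrightarrow> Y \<in> vector_fields \<Longrightarrow> X - Y \<in> vector_fields"
  using vector_fields_add[OF _ vector_fields_minus, of X Y] by simp

lemma vector_fields_sum: "(\<And>i. i \<in> I \<Longrightarrow> X i \<in> vector_fields) \<Longrightarrow> (\<Sum>i\<in>I. X i) \<in> vector_fields"
  by (induction I rule: infinite_finite_induct) (auto simp: vector_fields_zero vector_fields_add)

lemma lie_bracket_vector_field:
  assumes "X \<in> vector_fields" "Y \<in> vector_fields"
  shows "lie_bracket X Y \<in> vector_fields"
proof (rule vector_fieldsI)
  note t = vector_field_tangent[OF assms(1)] vector_field_tangent[OF assms(2)]
  note s = vector_field_smooth[OF assms(1)] vector_field_smooth[OF assms(2)] smooth_funs_intros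
  note n = vector_field_nonsmooth[OF assms(1)] vector_field_nonsmooth[OF assms(2)]
  fix p
  show "lie_bracket X Y p \<in> tangent_space p"
    unfolding tangent_space_def mem_Collect_eq
    by (intro conjI ballI allI impI) (simp_all add: lie_bracket_def tangent_add[OF t(1)] tangent_add[OF t(2)] tangent_cmult[OF t(1)] tangent_cmult[OF t(2)]
      tangent_mult[OF t(1)] tangent_mult[OF t(2)] tangent_const[OF t(1)] tangent_const[OF t(2)] s n algebra_simps)
next
  fix f assume "f \<in> smooth_funs"
  then show "(\<lambda>p. lie_bracket X Y p f) \<in> smooth_funs"
    by (simp add: lie_bracket_def smooth_funs_diff vector_field_smooth assms)
qed

lemma lie_bracket_antisym: "lie_bracket X Y = - lie_bracket Y X"
  by (auto simp: lie_bracket_def fun_eq_iff)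

lemma lie_bracket_scale_right:
  assumes "X \<in> vector_fields" "Y \<in> vector_fields" "f \<in> smooth_funs"
  shows "lie_bracket X (\<lambda>p. f p *\<^sub>R Y p) = (\<lambda>p. X p f *\<^sub>R Y p + f p *\<^sub>R lie_bracket X Y p)"
proof (rule vector_field_eqI)
  show "lie_bracket X (\<lambda>p. f p *\<^sub>R Y p) \<in> vector_fields"
    by (intro lie_bracket_vector_field vector_fields_mult assms)
  have "(\<lambda>p. X p f *\<^sub>R Y p) + (\<lambda>p. f p *\<^sub>R lie_bracket X Y p) \<in> vector_fields"
    by (intro lie_bracket_vector_field vector_fields_mult vector_fields_add assms
        vector_field_smooth[OF assms(1,3)])
  then show "(\<lambda>p. X p f *\<^sub>R Y p + f p *\<^sub>R lie_bracket X Y p) \<in> vector_fields"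
    by (simp add: plus_fun_def)
  fix p h assume "h \<in> smooth_funs"
  then show "lie_bracket X (\<lambda>p. f p *\<^sub>R Y p) p h = (X p f *\<^sub>R Y p + f p *\<^sub>R lie_bracket X Y p) h"
    by (simp add: lie_bracket_def tangent_mult[OF vector_field_tangent[OF assms(1)] assms(3)]
      vector_field_smooth assms algebra_simps)
qed

lemma lie_bracket_jacobi:
  assumes "X \<in> vector_fields" "Y \<in> vector_fields" "Z \<in> vector_fields"
  shows "lie_bracket Z (lie_bracket X Y) = lie_bracket (lie_bracket Z X) Y + lie_bracket X (lie_bracket Z Y)"
proof (rule vector_field_eqI)
  fix p h assume "h \<in> smooth_funs"
  then show "lie_bracket Z (lie_bracket X Y) p h =
      (lie_bracket (lie_bracket Z X) Y + lie_bracket X (lie_bracket Z Y)) p h"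
    by (simp add: lie_bracket_def tangent_diff[OF vector_field_tangent[OF assms(1)]]
      tangent_diff[OF vector_field_tangent[OF assms(2)]] tangent_diff[OF vector_field_tangent[OF assms(3)]]
      vector_field_smooth assms)
qed (intro lie_bracket_vector_field vector_fields_add assms)+

text \<open>The last conclusion keeps the extension in every family of subspaces that contains
  \<open>X\<close> on \<open>W\<close>. It is what makes the extension of a local horizontal field
  horizontal everywhere.\<close>

lemma vector_field_extension:
  assumes "vector_field_on W X" "open W" "p \<in> W"
  obtains Y N where "Y \<in> vector_fields" "open N" "p \<in> N" "N \<subseteq> W" "\<And>q. q \<in> N \<Longrightarrow> Y q = X q"
    "\<And>q. Y q = 0 \<or> q \<in> W \<and> (\<exists>c. Y q = c *\<^sub>R X q)"
proof -
  obtain \<eta> N where \<eta>: "\<eta> \<in> smooth_funs" "open N" "p \<in> N" "N \<subseteq> W" "\<And>q. q \<in> N \<Longrightarrow> \<eta> q = 1"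
    "\<And>q. 0 \<le> \<eta> q" "compact (closure {q. \<eta> q \<noteq> 0})" "closure {q. \<eta> q \<noteq> 0} \<subseteq> W"
    by (rule bump_function[OF assms(2,3)]) (rule that)
  have supp: "\<eta> q = 0 \<or> q \<in> W" for q
    using \<eta>(8) closure_subset[of "{q. \<eta> q \<noteq> 0}"] by blast
  have "(\<lambda>q. \<eta> q *\<^sub>R X q) \<in> vector_fields"
  proof (rule vector_fieldsI)
    fix q
    show "\<eta> q *\<^sub>R X q \<in> tangent_space q"
      using supp[of q] assms(1) subspace_0[OF subspace_tangent_space]
      by (auto simp: vector_field_on_def intro: subspace_scale[OF subspace_tangent_space])
  next
    fix f assume "f \<in> smooth_funs"
    then show "(\<lambda>q. (\<eta> q *\<^sub>R X q) f) \<in> smooth_funs"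
      using smooth_funs_bump_mult[OF \<eta>(1,8) assms(2), of "\<lambda>q. X q f"] assms(1)
      by (auto simp: vector_field_on_def)
  qed
  then show ?thesis
    by (rule that[OF _ \<eta>(2-4)]) (use supp in \<open>auto simp: \<eta>(5)\<close>)
qed

end

subsection \<open>Inner products on subspaces\<close>

definition orthonormal_family :: "'v::real_vector set \<Rightarrow> ('v \<Rightarrow> 'v \<Rightarrow> real) \<Rightarrow> nat \<Rightarrow> (nat \<Rightarrow> 'v) \<Rightarrow> bool"
  where "orthonormal_family S B k b \<longleftrightarrow> (\<forall>i<k. b i \<in> S) \<and> (\<forall>i<k. \<forall>j<k. B (b i) (b j) = of_bool (i = j))"

context
  fixes S :: "'v::real_vector set" and B :: "'v \<Rightarrow> 'v \<Rightarrow> real"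
  assumes ip: "inner_product_on S B"
begin

lemma ip_subspace: "subspace S"
  and ip_sym: "u \<in> S \<Longrightarrow> v \<in> S \<Longrightarrow> B u v = B v u"
  and ip_add_left: "u \<in> S \<Longrightarrow> v \<in> S \<Longrightarrow> w \<in> S \<Longrightarrow> B (u + v) w = B u w + B v w"
  and ip_scale_left: "u \<in> S \<Longrightarrow> v \<in> S \<Longrightarrow> B (c *\<^sub>R u) v = c * B u v"
  and ip_pos: "u \<in> S \<Longrightarrow> u \<noteq> 0 \<Longrightarrow> 0 < B u u"
  using ip by (auto simp: inner_product_on_def)

lemmas ip_mem = subspace_0[OF ip_subspace] subspace_add[OF ip_subspace] subspace_scale[OF ip_subspace]
  subspace_diff[OF ip_subspace] subspace_neg[OF ip_subspace] subspace_sum[OF ip_subspace]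

lemma ip_add_right: "u \<in> S \<Longrightarrow> v \<in> S \<Longrightarrow> w \<in> S \<Longrightarrow> B w (u + v) = B w u + B w v"
  using ip_add_left[of u v w] by (simp add: ip_sym[of w] ip_mem)

lemma ip_scale_right: "u \<in> S \<Longrightarrow> v \<in> S \<Longrightarrow> B u (c *\<^sub>R v) = c * B u v"
  using ip_scale_left[of v u c] by (simp add: ip_sym[of u] ip_mem)

lemma ip_zero_left: "v \<in> S \<Longrightarrow> B 0 v = 0"
  using ip_scale_left[of 0 v 0] by (simp add: ip_mem)

lemma ip_zero_right: "v \<in> S \<Longrightarrow> B v 0 = 0"
  using ip_scale_right[of v 0 0] by (simp add: ip_mem)

lemma ip_minus_left: "u \<in> S \<Longrightarrow> v \<in> S \<Longrightarrow> B (- u) v = - B u v"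
  using ip_scale_left[of u v "-1"] by simp

lemma ip_diff_left: "u \<in> S \<Longrightarrow> v \<in> S \<Longrightarrow> w \<in> S \<Longrightarrow> B (u - v) w = B u w - B v w"
  using ip_add_left[of u "- v" w] by (simp add: ip_minus_left ip_mem)

lemma ip_sum_left:
  assumes "\<And>i. i \<in> I \<Longrightarrow> x i \<in> S" "v \<in> S"
  shows "B (\<Sum>i\<in>I. x i) v = (\<Sum>i\<in>I. B (x i) v)"
  using assms(1)
  by (induction I rule: infinite_finite_induct)
    (auto simp: ip_zero_left[OF assms(2)] ip_add_left assms(2) ip_mem)

lemma ip_sum_right:
  assumes "\<And>i. i \<in> I \<Longrightarrow> x i \<in> S" "v \<in> S"
  shows "B v (\<Sum>i\<in>I. x i) = (\<Sum>i\<in>I. B v (x i))"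
  using assms(1)
  by (induction I rule: infinite_finite_induct)
    (auto simp: ip_zero_right[OF assms(2)] ip_add_right assms(2) ip_mem)

lemma ip_eq_0: "u \<in> S \<Longrightarrow> B u u = 0 \<Longrightarrow> u = 0"
  using ip_pos by force

lemma ip_eqI: "u \<in> S \<Longrightarrow> v \<in> S \<Longrightarrow> (\<And>w. w \<in> S \<Longrightarrow> B u w = B v w) \<Longrightarrow> u = v"
  using ip_eq_0[of "u - v"] by (simp add: ip_diff_left ip_mem)

context
  fixes b k assumes on: "orthonormal_family S B k b"
begin

lemma orthonormal_mem: "i < k \<Longrightarrow> b i \<in> S"
  and orthonormal_ip: "i < k \<Longrightarrow> j < k \<Longrightarrow> B (b i) (b j) = of_bool (i = j)"
  using on by (auto simp: orthonormal_family_def)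

lemma orthonormal_comb_mem: "(\<Sum>i<k. c i *\<^sub>R b i) \<in> S"
  by (intro ip_mem) (auto intro: orthonormal_mem)

lemma orthonormal_comb_ip_left: "j < k \<Longrightarrow> B (\<Sum>i<k. c i *\<^sub>R b i) (b j) = c j"
  by (subst ip_sum_left) (auto simp: ip_scale_left ip_mem orthonormal_mem orthonormal_ip)

lemma orthonormal_inj: "inj_on b {..<k}"
proof (rule inj_onI)
  fix i j assume "i \<in> {..<k}" "j \<in> {..<k}" "b i = b j"
  then show "i = j" using orthonormal_ip[of i j] orthonormal_ip[of j j] by (auto split: if_splits)
qed

lemma orthonormal_independent: "independent (b ` {..<k})"
proof
  assume "dependent (b ` {..<k})"
  then obtain u w where w: "w \<in> b ` {..<k}" "u w \<noteq> 0" and z: "(\<Sum>x\<in>b ` {..<k}. u x *\<^sub>R x) = 0"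
    unfolding dependent_finite[OF finite_imageI[OF finite_lessThan]] by blast
  obtain j where j: "j < k" "w = b j" using w by auto
  have "(\<Sum>i<k. u (b i) *\<^sub>R b i) = 0"
    using z orthonormal_inj by (simp add: sum.reindex)
  then show False
    using orthonormal_comb_ip_left[OF j(1), of "\<lambda>i. u (b i)"] ip_zero_left[OF orthonormal_mem[OF j(1)]] w j by simp
qed

text \<open>The family extends to a maximal independent subset of \<open>S\<close>, and its size
  \<open>dim S\<close> leaves no room for further vectors. The finite spanning set rules out an
  infinite-dimensional \<open>S\<close>, for which \<open>dim\<close> is 0 by convention.\<close>

lemma orthonormal_expansion:
  assumes F: "finite F" "S \<subseteq> span F" and k: "dim S = k" and v: "v \<in> S"
  shows "v = (\<Sum>i<k. B v (b i) *\<^sub>R b i)"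
proof -
  have "b ` {..<k} \<subseteq> S" using orthonormal_mem by auto
  then obtain C where C: "b ` {..<k} \<subseteq> C" "C \<subseteq> S" "independent C" "S \<subseteq> span C"
    using maximal_independent_subset_extend[OF _ orthonormal_independent] by metis
  have "finite C"
    using independent_span_bound[OF F(1) C(3)] C(2) F(2) by blast
  moreover have "card C = card (b ` {..<k})"
    using basis_card_eq_dim[OF C(2,4,3)] k orthonormal_inj by (simp add: card_image)
  ultimately have "C = b ` {..<k}" using C(1) by (metis card_subset_eq)
  then have "v \<in> span (b ` {..<k})" using C(4) v by auto
  then obtain u where "v = (\<Sum>x\<in>b ` {..<k}. u x *\<^sub>R x)"
    unfolding span_finite[OF finite_imageI[OF finite_lessThan]] by auto
  then have v: "v = (\<Sum>i<k. u (b i) *\<^sub>R b i)"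
    using orthonormal_inj by (simp add: sum.reindex)
  have "B v (b i) = u (b i)" if "i < k" for i
    unfolding v using orthonormal_comb_ip_left[OF that, of "\<lambda>i. u (b i)"] .
  then show ?thesis using v by simp
qed

lemma orthonormal_parseval:
  assumes F: "finite F" "S \<subseteq> span F" and k: "dim S = k" and v: "v \<in> S" and w: "w \<in> S"
  shows "B v w = (\<Sum>i<k. B v (b i) * B w (b i))"
proof -
  have "B v w = B (\<Sum>i<k. B v (b i) *\<^sub>R b i) w"
    using orthonormal_expansion[OF F k v] by simp
  also have "\<dots> = (\<Sum>i<k. B v (b i) * B w (b i))"
    by (subst ip_sum_left) (auto simp: ip_scale_left ip_mem orthonormal_mem w ip_sym[OF w])
  finally show ?thesis .
qed

text \<open>One Gram-Schmidt step at a point. The vector is left unnormalised: for frames of fields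
  the normalisation has to be carried out on a neighbourhood.\<close>

lemma orthonormal_extend:
  assumes "k < dim S"
  obtains w where "w \<in> S" "w \<noteq> 0" "\<And>i. i < k \<Longrightarrow> B w (b i) = 0"
proof -
  have "\<not> S \<subseteq> span (b ` {..<k})"
  proof
    assume "S \<subseteq> span (b ` {..<k})"
    then have "dim S \<le> card (b ` {..<k})" by (rule dim_le_card) simp
    then show False using assms card_image_le[of "{..<k}" b] by simp
  qed
  then obtain v where v: "v \<in> S" "v \<notin> span (b ` {..<k})" by auto
  let ?c = "\<Sum>i<k. B v (b i) *\<^sub>R b i"
  have c: "?c \<in> span (b ` {..<k})" by (intro span_sum span_scale span_base) simp
  show ?thesis
  proof (rule that[of "v - ?c"])
    show "v - ?c \<in> S" by (intro ip_mem(4) v orthonormal_comb_mem)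
    show "v - ?c \<noteq> 0" using c v by auto
    fix i assume i: "i < k"
    have "B (v - ?c) (b i) = B v (b i) - B ?c (b i)"
      by (rule ip_diff_left[OF v(1) orthonormal_comb_mem orthonormal_mem[OF i]])
    then show "B (v - ?c) (b i) = 0"
      using orthonormal_comb_ip_left[OF i, of "\<lambda>j. B v (b j)"] by simp
  qed
qed

end

lemma orthonormal_family_exists: "k \<le> dim S \<Longrightarrow> \<exists>b. orthonormal_family S B k b"
proof (induction k)
  case 0
  then show ?case by (simp add: orthonormal_family_def)
next
  case (Suc k)
  then obtain b where b: "orthonormal_family S B k b" by auto
  obtain w where w: "w \<in> S" "w \<noteq> 0" "\<And>i. i < k \<Longrightarrow> B w (b i) = 0"
    by (rule orthonormal_extend[OF b]) (use Suc.prems in auto)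
  define e where "e = inverse (sqrt (B w w)) *\<^sub>R w"
  have pos: "B w w > 0" using ip_pos w by auto
  have e: "e \<in> S" "B e e = 1" "\<And>i. i < k \<Longrightarrow> B e (b i) = 0"
    using w pos orthonormal_mem[OF b]
    by (auto simp: e_def ip_mem ip_scale_left ip_scale_right field_simps)
  have "B (b i) e = 0" if "i < k" for i
    using e(3)[OF that] ip_sym[OF e(1) orthonormal_mem[OF b that]] by simp
  then have "orthonormal_family S B (Suc k) (b(k := e))"
    using b e by (auto simp: orthonormal_family_def less_Suc_eq)
  then show ?case by blast
qed

end

lemma sum_lessThan_add: "(\<Sum>i<a + b. F i) = (\<Sum>i<a. F i) + (\<Sum>j<b. F (a + j :: nat))"
  for F :: "nat \<Rightarrow> 'b::comm_monoid_add"
  by (induction b) (auto simp: add.assoc)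

subsection \<open>The splitting of the tangent space\<close>

context transverse_symmetries
begin

lemma H_subspace: "subspace (H p)"
  and H_tangent: "u \<in> H p \<Longrightarrow> u \<in> tangent_space p"
  and H_dim: "dim (H p) = d"
  using distribution by (auto simp: smooth_distribution_def)

lemma H_span: obtains F where "finite F" "H p \<subseteq> span F"
proof -
  obtain W X where "p \<in> W" "\<forall>q\<in>W. H q = span ((\<lambda>i. X i q) ` {..<d})"
    using distribution unfolding smooth_distribution_def by meson
  then show ?thesis using that[of "(\<lambda>i. X i p) ` {..<d}"] by auto
qed

lemma g_ip: "inner_product_on (H p) (g p)"
  using metric by (auto simp: sub_riemannian_metric_def)

lemma V_subspace: "subspace V"
  using V_lie_subalgebra by (auto simp: lie_closed_def)

lemma V_bracket: "Z \<in> V \<Longrightarrow> Z' \<in> V \<Longrightarrow> lie_bracket Z Z' \<in> V"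
  using V_lie_subalgebra by (auto simp: lie_closed_def)

lemma V_vector_field: "Z \<in> V \<Longrightarrow> Z \<in> vector_fields"
  using V_killing by (auto simp: killing_fields_def)

lemma V_span: obtains F where "finite F" "V \<subseteq> span F"
  using V_finite_dim by blast

text \<open>Evaluation maps \<open>V\<close> onto a space of the same dimension. A nonzero
  \<open>Z\<close> in the kernel could be completed to a basis of \<open>V\<close>, and the other
  basis vectors would span the image with one vector too few.\<close>

lemma V_eval_inj:
  assumes Z: "Z \<in> V" "Z p = 0" shows "Z = 0"
proof (rule ccontr)
  assume "Z \<noteq> 0"
  then have "independent {Z}" by simp
  then obtain C where C: "{Z} \<subseteq> C" "C \<subseteq> V" "independent C" "V \<subseteq> span C"
    using maximal_independent_subset_extend[of "{Z}" V] Z by auto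
  obtain F where F: "finite F" "V \<subseteq> span F" by (rule V_span)
  have fin: "finite C" using independent_span_bound[OF F(1) C(3)] C(2) F(2) by blast
  have card: "card C = dim V" using basis_card_eq_dim[OF C(2,4,3)] .
  have lin: "linear (\<lambda>Y :: 'a vfield. Y p)" by (rule linearI) auto
  have "(\<lambda>Z. Z p) ` V \<subseteq> span ((\<lambda>Z. Z p) ` (C - {Z}))"
  proof -
    have "(\<lambda>Z. Z p) ` V \<subseteq> (\<lambda>Z. Z p) ` span C" using C(4) by auto
    also have "\<dots> = span ((\<lambda>Z. Z p) ` C)" using linear_span_image[OF lin, of C] by simp
    also have "\<dots> \<subseteq> span ((\<lambda>Z. Z p) ` (C - {Z}))"
    proof (rule span_minimal[OF _ subspace_span], rule image_subsetI)
      fix Y assume "Y \<in> C"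
      then show "Y p \<in> span ((\<lambda>Z. Z p) ` (C - {Z}))"
        by (cases "Y = Z") (auto simp: Z(2) span_zero intro: span_base)
    qed
    finally show ?thesis .
  qed
  then have "dim ((\<lambda>Z. Z p) ` V) \<le> card ((\<lambda>Z. Z p) ` (C - {Z}))"
    by (rule dim_le_card) (use fin in simp)
  also have "\<dots> \<le> card (C - {Z})" by (rule card_image_le) (use fin in simp)
  also have "\<dots> < card C" using C(1) fin by (intro psubset_card_mono) auto
  finally show False using V_dim[of p] card by simp
qed

lemma V_eval_eq: "Z \<in> V \<Longrightarrow> Z' \<in> V \<Longrightarrow> Z p = Z' p \<Longrightarrow> Z = Z'"
  using V_eval_inj[of "Z - Z'" p] subspace_diff[OF V_subspace] by simp

lemma vert_space_mem: "Z \<in> V \<Longrightarrow> Z p \<in> vert_space p"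
  by (auto simp: vert_space_def)

lemma vert_subspace: "subspace (vert_space p)"
proof -
  have "linear (\<lambda>Y :: 'a vfield. Y p)" by (rule linearI) auto
  then show ?thesis unfolding vert_space_def
    by (rule linear_subspace_image[OF _ V_subspace])
qed

lemma vert_tangent: "u \<in> vert_space p \<Longrightarrow> u \<in> tangent_space p"
  using V_vector_field vector_field_tangent by (auto simp: vert_space_def)

lemma H_vert_zero: "u \<in> H p \<Longrightarrow> u \<in> vert_space p \<Longrightarrow> u = 0"
  using transversal[of p] by (auto simp: vert_space_def)

lemma hproj_eqI:
  assumes "h \<in> H p" "u - h \<in> vert_space p"
  shows "hproj p u = h"
  unfolding hproj_def
proof (rule the_equality)
  fix h' assume h': "h' \<in> H p \<and> u - h' \<in> vert_space p"
  then have "h' - h \<in> H p" using assms by (auto intro: subspace_diff[OF H_subspace])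
  moreover have "(u - h) - (u - h') \<in> vert_space p"
    using h' assms by (simp only: subspace_diff[OF vert_subspace])
  ultimately have "h' - h = 0" by (intro H_vert_zero) auto
  then show "h' = h" by simp
qed (use assms in auto)

lemma tangent_splitE:
  assumes "u \<in> tangent_space p"
  obtains h Z where "h \<in> H p" "Z \<in> V" "u = h + Z p"
  using assms splitting[of p] by auto

lemma hproj_sum: "h \<in> H p \<Longrightarrow> Z \<in> V \<Longrightarrow> hproj p (h + Z p) = h"
  and vproj_sum: "h \<in> H p \<Longrightarrow> Z \<in> V \<Longrightarrow> vproj p (h + Z p) = Z p"
  by (simp_all add: vproj_def hproj_eqI vert_space_mem)

lemma hproj_mem: "u \<in> tangent_space p \<Longrightarrow> hproj p u \<in> H p"
  by (erule tangent_splitE) (simp add: hproj_sum)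

lemma vproj_mem: "u \<in> tangent_space p \<Longrightarrow> vproj p u \<in> vert_space p"
  by (erule tangent_splitE) (simp add: vproj_sum vert_space_mem)

lemma eval_inv_eq: "Z \<in> V \<Longrightarrow> eval_inv p (Z p) = Z"
  unfolding eval_inv_def by (rule the_equality) (auto intro: V_eval_eq)

lemma gR_sum:
  "h \<in> H p \<Longrightarrow> Z \<in> V \<Longrightarrow> h' \<in> H p \<Longrightarrow> Z' \<in> V \<Longrightarrow> gR p (h + Z p) (h' + Z' p) = g p h h' + vip Z Z'"
  by (simp add: gR_def hproj_sum vproj_sum eval_inv_eq)

lemmas H_mem_intros = subspace_0[OF H_subspace] subspace_add[OF H_subspace] subspace_scale[OF H_subspace]
  subspace_diff[OF H_subspace] subspace_neg[OF H_subspace] subspace_sum[OF H_subspace]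
lemmas V_mem_intros = subspace_0[OF V_subspace] subspace_add[OF V_subspace] subspace_scale[OF V_subspace]
  subspace_diff[OF V_subspace] subspace_neg[OF V_subspace] subspace_sum[OF V_subspace]

lemma gR_HH: "u \<in> H p \<Longrightarrow> v \<in> H p \<Longrightarrow> gR p u v = g p u v"
  using gR_sum[of u p 0 v 0] ip_zero_left[OF V_inner_product] by (simp add: V_mem_intros)

lemma gR_VV: "Z \<in> V \<Longrightarrow> Z' \<in> V \<Longrightarrow> gR p (Z p) (Z' p) = vip Z Z'"
  using gR_sum[of 0 p Z 0 Z'] ip_zero_left[OF g_ip] by (simp add: H_mem_intros)

lemma gR_HV: "u \<in> H p \<Longrightarrow> w \<in> vert_space p \<Longrightarrow> gR p u w = 0"
  using gR_sum[of u p 0 0] ip_zero_right[OF g_ip] ip_zero_left[OF V_inner_product]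
  by (auto simp: H_mem_intros V_mem_intros vert_space_def)

lemma gR_ip: "inner_product_on (tangent_space p) (gR p)"
  unfolding inner_product_on_def
proof (intro conjI ballI allI impI subspace_tangent_space)
  fix u v assume "u \<in> tangent_space p" "v \<in> tangent_space p"
  note uv = this
  obtain h Z where u: "h \<in> H p" "Z \<in> V" "u = h + Z p" by (rule tangent_splitE[OF uv(1)])
  obtain h' Z' where v: "h' \<in> H p" "Z' \<in> V" "v = h' + Z' p" by (rule tangent_splitE[OF uv(2)])
  show "gR p u v = gR p v u"
    unfolding u v by (simp add: gR_sum u v ip_sym[OF g_ip u(1) v(1)] ip_sym[OF V_inner_product u(2) v(2)])
  show "gR p (c *\<^sub>R u) v = c * gR p u v" for c
    using gR_sum[of "c *\<^sub>R h" p "c *\<^sub>R Z" h' Z'] unfolding u v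
    by (simp add: gR_sum u v H_mem_intros V_mem_intros ip_scale_left[OF g_ip] ip_scale_left[OF V_inner_product] algebra_simps)
  fix w assume w': "w \<in> tangent_space p"
  obtain h'' Z'' where w: "h'' \<in> H p" "Z'' \<in> V" "w = h'' + Z'' p" by (rule tangent_splitE[OF w'])
  have "(h + Z p) + (h' + Z' p) = (h + h') + (Z + Z') p" by simp
  then have "gR p (u + v) w = gR p ((h + h') + (Z + Z') p) (h'' + Z'' p)" unfolding u v w by metis
  also have "\<dots> = g p (h + h') h'' + vip (Z + Z') Z''"
    by (rule gR_sum) (simp_all only: H_mem_intros V_mem_intros u v w)
  also have "\<dots> = gR p u w + gR p v w"
    unfolding u v w by (simp add: gR_sum u v w ip_add_left[OF g_ip] ip_add_left[OF V_inner_product])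
  finally show "gR p (u + v) w = gR p u w + gR p v w" .
next
  fix u assume uT: "u \<in> tangent_space p" and nz: "u \<noteq> 0"
  obtain h Z where u: "h \<in> H p" "Z \<in> V" "u = h + Z p" by (rule tangent_splitE[OF uT])
  have eq: "gR p u u = g p h h + vip Z Z" unfolding u by (rule gR_sum) (use u in auto)
  have h: "h = 0 \<or> 0 < g p h h" and Z: "Z = 0 \<or> 0 < vip Z Z"
    using ip_pos[OF g_ip u(1)] ip_pos[OF V_inner_product u(2)] by auto
  have "g p 0 0 = 0" "vip 0 0 = 0"
    using ip_zero_left[OF g_ip] ip_zero_left[OF V_inner_product] by (auto simp: H_mem_intros V_mem_intros)
  moreover have "h \<noteq> 0 \<or> Z \<noteq> 0" using nz u(3) by auto
  ultimately show "0 < gR p u u" using h Z unfolding eq by auto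
qed

lemma gR_VH: "w \<in> vert_space p \<Longrightarrow> u \<in> H p \<Longrightarrow> gR p w u = 0"
  using gR_HV[of u p w] ip_sym[OF gR_ip, of w p u] H_tangent vert_tangent by auto

text \<open>One orthonormal basis of the Lie algebra serves at every point, since evaluation is
  isometric. The vertical part of a frame is thus global and consists of Killing fields; only the
  horizontal part is local.\<close>

definition vframe :: "nat \<Rightarrow> 'a vfield"
  where "vframe = (SOME b. orthonormal_family V vip (dim V) b)"

lemma vframe_orthonormal: "orthonormal_family V vip (dim V) vframe"
  unfolding vframe_def
  by (rule someI_ex[OF orthonormal_family_exists[OF V_inner_product order_refl]])

lemma vframe_V: "m < dim V \<Longrightarrow> vframe m \<in> V"
  by (rule orthonormal_mem[OF V_inner_product vframe_orthonormal])

lemma vframe_vector_field: "m < dim V \<Longrightarrow> vframe m \<in> vector_fields"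
  by (intro V_vector_field vframe_V)

lemma vframe_ip: "m < dim V \<Longrightarrow> l < dim V \<Longrightarrow> gR p (vframe m p) (vframe l p) = of_bool (m = l)"
  by (simp add: gR_VV vframe_V orthonormal_ip[OF V_inner_product vframe_orthonormal])

lemma V_expansion: "Z \<in> V \<Longrightarrow> Z = (\<Sum>m<dim V. vip Z (vframe m) *\<^sub>R vframe m)"
proof -
  assume Z: "Z \<in> V"
  obtain F where F: "finite F" "V \<subseteq> span F" by (rule V_span)
  show ?thesis by (rule orthonormal_expansion[OF V_inner_product vframe_orthonormal F refl Z])
qed

lemma vert_expansion:
  assumes "w \<in> vert_space p"
  shows "w = (\<Sum>m<dim V. gR p w (vframe m p) *\<^sub>R vframe m p)"
proof -
  obtain Z where Z: "Z \<in> V" "w = Z p" using assms by (auto simp: vert_space_def)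
  have "(\<Sum>m<dim V. gR p w (vframe m p) *\<^sub>R vframe m p) = (\<Sum>m<dim V. vip Z (vframe m) *\<^sub>R vframe m p)"
    by (rule sum.cong) (simp_all add: Z gR_VV vframe_V)
  also have "\<dots> = w"
    using fun_cong[OF V_expansion[OF Z(1)], of p] Z(2) by (simp only: sum_fun_app scaleR_fun_app)
  finally show ?thesis by simp
qed

lemma H_expansion:
  assumes "orthonormal_family (H p) (g p) d e" "u \<in> H p"
  shows "u = (\<Sum>i<d. g p u (e i) *\<^sub>R e i)"
proof -
  obtain F where F: "finite F" "H p \<subseteq> span F" by (rule H_span)
  show ?thesis by (rule orthonormal_expansion[OF g_ip assms(1) F H_dim assms(2)])
qed

definition frame_join :: "(nat \<Rightarrow> 'b) \<Rightarrow> (nat \<Rightarrow> 'b) \<Rightarrow> nat \<Rightarrow> 'b"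
  where "frame_join e z i = (if i < d then e i else z (i - d))"

lemma frame_join_orthonormal:
  assumes e: "orthonormal_family (H p) (g p) d e"
  shows "orthonormal_family (tangent_space p) (gR p) (d + dim V) (frame_join e (\<lambda>m. vframe m p))"
proof -
  have "frame_join e (\<lambda>m. vframe m p) i \<in> tangent_space p" if "i < d + dim V" for i
    using that orthonormal_mem[OF g_ip e, of i] vframe_V[of "i - d"]
    by (auto simp: frame_join_def H_tangent vert_tangent vert_space_mem)
  moreover have "gR p (frame_join e (\<lambda>m. vframe m p) i) (frame_join e (\<lambda>m. vframe m p) j) = of_bool (i = j)"
    if "i < d + dim V" "j < d + dim V" for i j
    using that orthonormal_mem[OF g_ip e, of i] orthonormal_mem[OF g_ip e, of j] orthonormal_ip[OF g_ip e, of i j]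
      vframe_V[of "i - d"] vframe_V[of "j - d"] vframe_ip[of "i - d" "j - d" p]
    by (auto simp: frame_join_def gR_HH gR_HV gR_VH vert_space_mem)
  ultimately show ?thesis by (auto simp: orthonormal_family_def)
qed

lemma H_orthonormal_exists: obtains e where "orthonormal_family (H p) (g p) d e"
  using orthonormal_family_exists[OF g_ip[of p], of d] H_dim[of p] by auto

lemma dim_sum: "d + dim V = CARD('n)"
proof -
  obtain p :: 'a where True by simp
  obtain e where e: "orthonormal_family (H p) (g p) d e" by (rule H_orthonormal_exists)
  define E where "E = frame_join e (\<lambda>m. vframe m p)"
  have on: "orthonormal_family (tangent_space p) (gR p) (d + dim V) E"
    using frame_join_orthonormal[OF e] by (simp add: E_def)
  have E: "i < d \<Longrightarrow> e i = E i" "vframe m p = E (d + m)" for i m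
    by (simp_all add: E_def frame_join_def)
  have "dim (tangent_space p) = d + dim V"
  proof (rule dim_unique)
    show "E ` {..<d + dim V} \<subseteq> tangent_space p"
      using orthonormal_mem[OF gR_ip on] by auto
    show "independent (E ` {..<d + dim V})" by (rule orthonormal_independent[OF gR_ip on])
    show "card (E ` {..<d + dim V}) = d + dim V"
      using orthonormal_inj[OF gR_ip on] by (simp add: card_image)
    show "tangent_space p \<subseteq> span (E ` {..<d + dim V})"
    proof
      fix u assume "u \<in> tangent_space p"
      then obtain h Z where u: "h \<in> H p" "Z \<in> V" "u = h + Z p" by (rule tangent_splitE)
      have "e i \<in> span (E ` {..<d + dim V})" if "i < d" for i
        unfolding E(1)[OF that] by (intro span_base imageI) (use that in simp)
      moreover have "vframe m p \<in> span (E ` {..<d + dim V})" if "m < dim V" for m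
        unfolding E(2) by (intro span_base imageI) (use that in simp)
      ultimately have "(\<Sum>i<d. g p h (e i) *\<^sub>R e i) + (\<Sum>m<dim V. gR p (Z p) (vframe m p) *\<^sub>R vframe m p)
          \<in> span (E ` {..<d + dim V})"
        by (intro span_add span_sum span_scale) auto
      then show "u \<in> span (E ` {..<d + dim V})"
        unfolding u(3) by (simp only: H_expansion[OF e u(1), symmetric]
            vert_expansion[OF vert_space_mem[OF u(2)], symmetric])
    qed
  qed
  then show ?thesis using dim_tangent_space[of p] by simp
qed

lemma tangent_finite_span: obtains F where "finite F" "tangent_space p \<subseteq> span F"
proof -
  obtain e where e: "orthonormal_family (H p) (g p) d e" by (rule H_orthonormal_exists)
  obtain C where C: "C \<subseteq> tangent_space p" "independent C" "tangent_space p \<subseteq> span C" "card C = dim (tangent_space p)"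
    by (rule basis_exists[of "tangent_space p"])
  have "finite C" by (rule card_ge_0_finite) (use C(4) dim_tangent_space[of p] in simp)
  then show ?thesis using that C(3) by blast
qed

lemma tangent_expansion:
  assumes "orthonormal_family (tangent_space p) (gR p) CARD('n) e" "u \<in> tangent_space p"
  shows "u = (\<Sum>i<CARD('n). gR p u (e i) *\<^sub>R e i)"
proof -
  obtain F where F: "finite F" "tangent_space p \<subseteq> span F" by (rule tangent_finite_span)
  show ?thesis by (rule orthonormal_expansion[OF gR_ip assms(1) F dim_tangent_space assms(2)])
qed

section \<open>Gradients and the two carre du champ forms\<close>

text \<open>Riesz representation in an orthonormal basis: the vector with coefficients
  \<open>E i f\<close> meets the description under \<open>THE\<close>, and definiteness of
  \<open>gR\<close> makes it the only one.\<close>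

lemma grad_properties:
  "grad f p \<in> tangent_space p" "u \<in> tangent_space p \<Longrightarrow> gR p (grad f p) u = u f"
proof -
  obtain e where e: "orthonormal_family (H p) (g p) d e" by (rule H_orthonormal_exists)
  define E where "E = frame_join e (\<lambda>m. vframe m p)"
  have on: "orthonormal_family (tangent_space p) (gR p) CARD('n) E"
    using frame_join_orthonormal[OF e] by (simp add: E_def dim_sum)
  let ?v = "\<Sum>i<CARD('n). E i f *\<^sub>R E i"
  have v: "?v \<in> tangent_space p" by (rule orthonormal_comb_mem[OF gR_ip on])
  have vu: "gR p ?v u = u f" if u: "u \<in> tangent_space p" for u
  proof -
    have "gR p ?v u = (\<Sum>i<CARD('n). gR p (E i f *\<^sub>R E i) u)"
      by (rule ip_sum_left[OF gR_ip _ u]) (auto intro!: subspace_scale[OF subspace_tangent_space] orthonormal_mem[OF gR_ip on])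
    also have "\<dots> = (\<Sum>i<CARD('n). (gR p u (E i) *\<^sub>R E i) f)"
      by (intro sum.cong refl) (simp add: ip_scale_left[OF gR_ip _ u] orthonormal_mem[OF gR_ip on] ip_sym[OF gR_ip _ u])
    also have "\<dots> = u f"
      using fun_cong[OF tangent_expansion[OF on u], of f] by (simp add: sum_fun_app)
    finally show ?thesis .
  qed
  have "grad f p = ?v"
    unfolding grad_def
  proof (rule the_equality)
    show "?v \<in> tangent_space p \<and> (\<forall>u\<in>tangent_space p. gR p ?v u = u f)" using v vu by blast
    fix w assume "w \<in> tangent_space p \<and> (\<forall>u\<in>tangent_space p. gR p w u = u f)"
    then have w: "w \<in> tangent_space p" "\<And>u. u \<in> tangent_space p \<Longrightarrow> gR p w u = u f" by blast+
    show "w = ?v" by (rule ip_eqI[OF gR_ip w(1) v]) (simp only: w(2) vu)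
  qed
  then show "grad f p \<in> tangent_space p" "u \<in> tangent_space p \<Longrightarrow> gR p (grad f p) u = u f"
    using v vu by auto
qed

lemma grad_split: "grad f p = gradH f p + gradV f p"
  by (simp add: gradH_def gradV_def vproj_def)

lemma gradH_mem: "gradH f p \<in> H p"
  and gradV_mem: "gradV f p \<in> vert_space p"
  by (simp_all add: gradH_def gradV_def hproj_mem vproj_mem grad_properties)

lemma gradH_ip: "u \<in> H p \<Longrightarrow> g p (gradH f p) u = u f"
  using grad_properties(2)[of u p f] ip_add_left[OF gR_ip, of "gradH f p" p "gradV f p" u]
    gradH_mem[of f p] gradV_mem[of f p]
  by (simp add: grad_split H_tangent vert_tangent gR_HH gR_VH)

lemma gradV_ip: "w \<in> vert_space p \<Longrightarrow> gR p (gradV f p) w = w f"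
  using grad_properties(2)[of w p f] ip_add_left[OF gR_ip, of "gradH f p" p "gradV f p" w]
    gradH_mem[of f p] gradV_mem[of f p]
  by (simp add: grad_split H_tangent vert_tangent gR_HV)

lemma gradH_eq_sum: "orthonormal_family (H p) (g p) d e \<Longrightarrow> gradH f p = (\<Sum>i<d. e i f *\<^sub>R e i)"
  using H_expansion[OF _ gradH_mem[of f p], of e] orthonormal_mem[OF g_ip] by (simp add: gradH_ip)

lemma Gam_eq: "Gam f1 f2 p = gradH f1 p f2"
  unfolding Gam_def gR_HH[OF gradH_mem gradH_mem] ip_sym[OF g_ip gradH_mem[of f1 p] gradH_mem[of f2 p]]
  by (rule gradH_ip[OF gradH_mem])

lemma Gam_eq_g: "Gam f1 f2 p = g p (gradH f1 p) (gradH f2 p)"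
  by (simp add: Gam_def gR_HH gradH_mem)

lemma gradV_eq_sum: "gradV f p = (\<Sum>m<dim V. vframe m p f *\<^sub>R vframe m p)"
  using vert_expansion[OF gradV_mem[of f p]] by (simp add: gradV_ip vert_space_mem vframe_V)

lemma GamZ_eq: "GamZ f1 f2 p = (\<Sum>m<dim V. vframe m p f1 * vframe m p f2)"
proof -
  have "GamZ f1 f2 p = gradV f2 p f1"
    unfolding GamZ_def by (rule gradV_ip[OF gradV_mem])
  also have "\<dots> = (\<Sum>m<dim V. vframe m p f1 * vframe m p f2)"
    unfolding gradV_eq_sum by (simp add: sum_fun_app mult.commute)
  finally show ?thesis .
qed

end

section \<open>Horizontal fields and local orthonormal frames\<close>

context transverse_symmetries
begin

lemma horizontal_fieldsI: "X \<in> vector_fields \<Longrightarrow> (\<And>p. X p \<in> H p) \<Longrightarrow> X \<in> horizontal_fields H"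
  and horizontal_vector_field: "X \<in> horizontal_fields H \<Longrightarrow> X \<in> vector_fields"
  and horizontal_mem: "X \<in> horizontal_fields H \<Longrightarrow> X p \<in> H p"
  by (simp_all add: horizontal_fields_def)

lemma horizontal_zero: "0 \<in> horizontal_fields H"
  by (rule horizontal_fieldsI) (simp_all add: vector_fields_zero H_mem_intros)

lemma horizontal_add: "X \<in> horizontal_fields H \<Longrightarrow> Y \<in> horizontal_fields H \<Longrightarrow> X + Y \<in> horizontal_fields H"
  by (rule horizontal_fieldsI) (simp_all add: vector_fields_add H_mem_intros horizontal_vector_field horizontal_mem)

lemma horizontal_diff: "X \<in> horizontal_fields H \<Longrightarrow> Y \<in> horizontal_fields H \<Longrightarrow> X - Y \<in> horizontal_fields H"
  by (rule horizontal_fieldsI) (simp_all add: vector_fields_diff H_mem_intros horizontal_vector_field horizontal_mem)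

lemma horizontal_mult: "f \<in> smooth_funs \<Longrightarrow> X \<in> horizontal_fields H \<Longrightarrow> (\<lambda>p. f p *\<^sub>R X p) \<in> horizontal_fields H"
  by (rule horizontal_fieldsI) (simp_all add: vector_fields_mult H_mem_intros horizontal_vector_field horizontal_mem)

lemma horizontal_sum: "(\<And>i. i \<in> I \<Longrightarrow> X i \<in> horizontal_fields H) \<Longrightarrow> (\<Sum>i\<in>I. X i) \<in> horizontal_fields H"
  by (induction I rule: infinite_finite_induct) (auto simp: horizontal_zero horizontal_add)

lemma g_smooth: "X \<in> horizontal_fields H \<Longrightarrow> Y \<in> horizontal_fields H \<Longrightarrow> (\<lambda>p. g p (X p) (Y p)) \<in> smooth_funs"
  using metric by (auto simp: sub_riemannian_metric_def)

text \<open>The values at \<open>p\<close> of global horizontal fields form a subspace. It contains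
  the local generators of \<open>H p\<close>, because cutting these off keeps them
  horizontal.\<close>

lemma horizontal_field_through:
  assumes "v \<in> H p" obtains X where "X \<in> horizontal_fields H" "X p = v"
proof -
  have "\<exists>W X. open W \<and> p \<in> W \<and> (\<forall>i<d. vector_field_on W (X i))
      \<and> (\<forall>q\<in>W. H q = span ((\<lambda>i. X i q) ` {..<d}))"
    using distribution unfolding smooth_distribution_def by (elim conjE allE[of _ p])
  then obtain W X where W: "open W" "p \<in> W" "\<forall>i<d. vector_field_on W (X i)"
    and HW: "\<forall>q\<in>W. H q = span ((\<lambda>i. X i q) ` {..<d})"
    by (elim exE conjE)
  define S where "S = {v. \<exists>Y\<in>horizontal_fields H. Y p = v}"
  have SI: "Y p \<in> S" if "Y \<in> horizontal_fields H" for Y using that by (auto simp: S_def)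
  have "0 \<in> S" using SI[OF horizontal_zero] by simp
  moreover have "x + y \<in> S" if xy: "x \<in> S" "y \<in> S" for x y
  proof -
    obtain X Y where "X \<in> horizontal_fields H" "Y \<in> horizontal_fields H" "X p = x" "Y p = y"
      using xy by (auto simp: S_def)
    then show ?thesis using SI[OF horizontal_add, of X Y] by simp
  qed
  moreover have "c *\<^sub>R x \<in> S" if x: "x \<in> S" for c x
  proof -
    obtain X where "X \<in> horizontal_fields H" "X p = x" using x by (auto simp: S_def)
    then show ?thesis using SI[OF horizontal_mult[OF smooth_funs_const[of c]], of X] by simp
  qed
  ultimately have "subspace S" by (simp only: subspace_def) blast
  moreover have "(\<lambda>i. X i p) ` {..<d} \<subseteq> S"
  proof (rule image_subsetI)
    fix i assume "i \<in> {..<d}"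
    then have i: "i < d" by simp
    obtain Y N where Y: "Y \<in> vector_fields" "open N" "p \<in> N" "N \<subseteq> W" "\<And>q. q \<in> N \<Longrightarrow> Y q = X i q"
      "\<And>q. Y q = 0 \<or> q \<in> W \<and> (\<exists>c. Y q = c *\<^sub>R X i q)"
      by (rule vector_field_extension[OF _ W(1,2), of "X i"]) (use W i in auto)
    have "Y q \<in> H q" for q
      using Y(6)[of q]
    proof
      assume "q \<in> W \<and> (\<exists>c. Y q = c *\<^sub>R X i q)"
      then obtain c where "q \<in> W" "Y q = c *\<^sub>R X i q" by auto
      moreover have "X i q \<in> span ((\<lambda>i. X i q) ` {..<d})" using i by (intro span_base) auto
      ultimately show "Y q \<in> H q" using HW by (auto intro: span_scale)
    qed (simp add: H_mem_intros)
    then have "Y \<in> horizontal_fields H" by (intro horizontal_fieldsI Y)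
    from SI[OF this] show "X i p \<in> S" using Y(3,5) by simp
  qed
  ultimately have "span ((\<lambda>i. X i p) ` {..<d}) \<subseteq> S" by (rule span_minimal[rotated])
  then have "v \<in> S" using assms HW W(2) by blast
  then show ?thesis using that by (auto simp: S_def)
qed

text \<open>Gram-Schmidt for fields. The fields are global, but orthonormality is claimed only near
  \<open>p\<close>, as a global frame need not exist.\<close>

lemma horizontal_frame_partial:
  "k \<le> d \<Longrightarrow> \<exists>X. (\<forall>i<k. X i \<in> horizontal_fields H) \<and>
    (\<exists>N. open N \<and> p \<in> N \<and> (\<forall>q\<in>N. \<forall>i<k. \<forall>j<k. g q (X i q) (X j q) = of_bool (i = j)))"
proof (induction k)
  case 0
  show ?case by (auto intro: exI[of _ UNIV])
next
  case (Suc k)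
  then obtain X N where XN: "\<forall>i<k. X i \<in> horizontal_fields H" "open N" "p \<in> N"
    "\<forall>q\<in>N. \<forall>i<k. \<forall>j<k. g q (X i q) (X j q) = of_bool (i = j)"
    by auto
  have X: "X i \<in> horizontal_fields H" if "i < k" for i using XN(1) that by blast
  have N3: "g q (X i q) (X j q) = of_bool (i = j)" if "q \<in> N" "i < k" "j < k" for q i j
    using XN(4) that by blast
  note N = XN(2,3) N3
  have on: "orthonormal_family (H q) (g q) k (\<lambda>i. X i q)" if "q \<in> N" for q
    using X N(3)[OF that] horizontal_mem by (auto simp: orthonormal_family_def)
  obtain w where w: "w \<in> H p" "w \<noteq> 0" "\<And>i. i < k \<Longrightarrow> g p w (X i p) = 0"
    by (rule orthonormal_extend[OF g_ip on[OF N(2)]]) (use Suc.prems H_dim in auto)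
  obtain Y where Y: "Y \<in> horizontal_fields H" "Y p = w" by (rule horizontal_field_through[OF w(1)])
  \<comment> \<open>The projections are subtracted at all points at once. At \<open>p\<close> they
    are zero by the choice of \<open>w\<close>, so \<open>Y'\<close> keeps the nonzero value
    \<open>w\<close> there and has positive length nearby.\<close>
  define Y' where "Y' = Y - (\<Sum>i<k. (\<lambda>q. g q (Y q) (X i q) *\<^sub>R X i q))"
  have Y': "Y' \<in> horizontal_fields H"
    unfolding Y'_def by (intro horizontal_diff horizontal_sum horizontal_mult g_smooth Y X) auto
  have Y'_app: "Y' q = Y q - (\<Sum>i<k. g q (Y q) (X i q) *\<^sub>R X i q)" for q
    by (simp add: Y'_def sum_fun_app)
  have "Y' p = w" by (simp add: Y'_app Y w)
  have perp: "g q (Y' q) (X i q) = 0" if q: "q \<in> N" and i: "i < k" for q i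
  proof -
    have "g q (Y' q) (X i q) = g q (Y q) (X i q) - g q (\<Sum>i<k. g q (Y q) (X i q) *\<^sub>R X i q) (X i q)"
      unfolding Y'_app
      by (rule ip_diff_left[OF g_ip horizontal_mem[OF Y(1)] orthonormal_comb_mem[OF g_ip on[OF q]] horizontal_mem[OF X[OF i]]])
    then show ?thesis
      using orthonormal_comb_ip_left[OF g_ip on[OF q] i, of "\<lambda>i. g q (Y q) (X i q)"] by simp
  qed
  define n where "n q = g q (Y' q) (Y' q)" for q
  have n: "n \<in> smooth_funs" unfolding n_def[abs_def] by (rule g_smooth[OF Y' Y'])
  have np: "n p > 0" unfolding n_def \<open>Y' p = w\<close> by (rule ip_pos[OF g_ip w(1,2)])
  define M where "M = {q. n q > 0} \<inter> N"
  have M: "open M" "p \<in> M"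
    using open_Collect_less[OF continuous_on_const smooth_funs_continuous[OF n]] np N by (auto simp: M_def)
  \<comment> \<open>The normalising factor is smooth only where \<open>n\<close> is positive;
    \<open>s\<close> is a global smooth function that agrees with it near \<open>p\<close>.\<close>
  have "smooth_fun_on M (\<lambda>q. inverse (sqrt (n q)))"
    by (intro smooth_fun_on_inverse smooth_fun_on_sqrt smooth_funs_imp_smooth_fun_on n M) (auto simp: M_def)
  then obtain s M' where s: "s \<in> smooth_funs" "open M'" "p \<in> M'" "M' \<subseteq> M"
    "\<And>q. q \<in> M' \<Longrightarrow> s q = inverse (sqrt (n q))"
    by (rule smooth_fun_extension[OF _ M]) (rule that)
  define E where "E = (\<lambda>q. s q *\<^sub>R Y' q)"
  have E: "E \<in> horizontal_fields H" unfolding E_def by (intro horizontal_mult s Y')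
  have 1: "g q (E q) (E q) = 1" if q: "q \<in> M'" for q
  proof -
    have "n q > 0" using q s(4) by (auto simp: M_def)
    then have "s q * (s q * n q) = 1" by (simp add: s(5)[OF q] field_simps)
    then show ?thesis
      using horizontal_mem[OF Y', of q]
      by (simp add: E_def ip_scale_left[OF g_ip] ip_scale_right[OF g_ip] H_mem_intros n_def)
  qed
  have 2: "g q (E q) (X i q) = 0" "g q (X i q) (E q) = 0" if q: "q \<in> M'" and i: "i < k" for q i
  proof -
    have "q \<in> N" using q s(4) by (auto simp: M_def)
    then show "g q (E q) (X i q) = 0"
      using perp[OF _ i] horizontal_mem[OF Y', of q] horizontal_mem[OF X[OF i], of q]
      by (simp add: E_def ip_scale_left[OF g_ip])
    then show "g q (X i q) (E q) = 0"
      using ip_sym[OF g_ip horizontal_mem[OF E] horizontal_mem[OF X[OF i]], of q] by simp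
  qed
  have "\<forall>i<Suc k. (X(k := E)) i \<in> horizontal_fields H" using X E by (auto simp: less_Suc_eq)
  moreover have "\<forall>q\<in>M'. \<forall>i<Suc k. \<forall>j<Suc k. g q ((X(k := E)) i q) ((X(k := E)) j q) = of_bool (i = j)"
  proof (intro ballI allI impI)
    fix q i j assume q: "q \<in> M'" and ij: "i < Suc k" "j < Suc k"
    have "q \<in> N" using q s(4) by (auto simp: M_def)
    with ij show "g q ((X(k := E)) i q) ((X(k := E)) j q) = of_bool (i = j)"
      using 1[OF q] 2[OF q, of i] 2[OF q, of j] N(3)[of q i j] by (auto simp: less_Suc_eq)
  qed
  ultimately show ?case using s(2,3) by blast
qed

lemma horizontal_frame_exists: "\<exists>X. horizontal_frame p X"
  using horizontal_frame_partial[of d p] by (auto simp: horizontal_frame_def)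

lemma horizontal_frame_field: "horizontal_frame p X \<Longrightarrow> i < d \<Longrightarrow> X i \<in> horizontal_fields H"
  by (simp add: horizontal_frame_def)

lemma horizontal_frame_orthonormal:
  assumes "horizontal_frame p X"
  obtains N where "open N" "p \<in> N" "\<And>q. q \<in> N \<Longrightarrow> orthonormal_family (H q) (g q) d (\<lambda>i. X i q)"
  proof -
  obtain N where N: "open N" "p \<in> N" "\<forall>q\<in>N. \<forall>i<d. \<forall>j<d. g q (X i q) (X j q) = of_bool (i = j)"
    using assms unfolding horizontal_frame_def by (elim exE conjE)
  show ?thesis
  proof (rule that[OF N(1,2)])
    fix q assume "q \<in> N"
    then show "orthonormal_family (H q) (g q) d (\<lambda>i. X i q)"
      using N(3) assms horizontal_mem by (simp add: horizontal_frame_def orthonormal_family_def)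
  qed
qed

lemma horizontal_frame_nearby:
  assumes "horizontal_frame p X"
  shows "eventually (\<lambda>q. horizontal_frame q X) (nhds p)"
proof -
  obtain N where "open N" "p \<in> N" "\<forall>q\<in>N. \<forall>i<d. \<forall>j<d. g q (X i q) (X j q) = of_bool (i = j)"
    using assms unfolding horizontal_frame_def by (elim exE conjE)
  then show ?thesis
    using assms by (intro eventually_openI[of N]) (auto simp: horizontal_frame_def)
qed

lemma horizontal_frame_at: "horizontal_frame p X \<Longrightarrow> orthonormal_family (H p) (g p) d (\<lambda>i. X i p)"
  by (rule horizontal_frame_orthonormal) auto

text \<open>Indexed by \<open>'n\<close>, like the coordinates, so that the change of basis to
  coordinate vectors is a square matrix with a determinant. Any enumeration \<open>r\<close> of the
  indices will do.\<close>

definition full_frame :: "(nat \<Rightarrow> 'a vfield) \<Rightarrow> ('n \<Rightarrow> nat) \<Rightarrow> 'n \<Rightarrow> 'a vfield"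
  where "full_frame X r a = frame_join X vframe (r a)"

context
  fixes p X and r :: "'n \<Rightarrow> nat"
  assumes X: "horizontal_frame p X" and r: "bij_betw r UNIV {..<CARD('n)}"
begin

lemma full_frame_sum: "(\<Sum>a\<in>UNIV. F (full_frame X r a)) = (\<Sum>i<d. F (X i)) + (\<Sum>m<dim V. F (vframe m))"
  for F :: "'a vfield \<Rightarrow> 'b::comm_monoid_add"
proof -
  have "(\<Sum>a\<in>UNIV. F (full_frame X r a)) = (\<Sum>i<CARD('n). F (frame_join X vframe i))"
    unfolding full_frame_def by (rule sum.reindex_bij_betw[OF r])
  also have "\<dots> = (\<Sum>i<d + dim V. F (frame_join X vframe i))" by (simp add: dim_sum)
  finally show ?thesis by (simp add: sum_lessThan_add frame_join_def)
qed

lemma index_less: "r a < CARD('n)" and index_eq: "r a = r b \<longleftrightarrow> a = b"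
  using r by (auto simp: bij_betw_def inj_on_def)

lemma full_frame_vector_field: "full_frame X r a \<in> vector_fields"
  using index_less[of a] horizontal_vector_field[OF horizontal_frame_field[OF X, of "r a"]] vframe_vector_field[of "r a - d"]
  by (auto simp: full_frame_def frame_join_def dim_sum[symmetric])

context
  fixes q assumes q: "orthonormal_family (H q) (g q) d (\<lambda>i. X i q)"
begin

lemma full_frame_expansion:
  assumes "u \<in> tangent_space q"
  shows "u = (\<Sum>a\<in>UNIV. gR q u (full_frame X r a q) *\<^sub>R full_frame X r a q)"
proof -
  have "frame_join (\<lambda>i. X i q) (\<lambda>m. vframe m q) i = frame_join X vframe i q" for i
    by (simp add: frame_join_def)
  then have "u = (\<Sum>i<CARD('n). gR q u (frame_join X vframe i q) *\<^sub>R frame_join X vframe i q)"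
    using tangent_expansion[OF frame_join_orthonormal[OF q, unfolded dim_sum] assms] by simp
  then show ?thesis
    unfolding full_frame_def using sum.reindex_bij_betw[OF r, of "\<lambda>i. gR q u (frame_join X vframe i q) *\<^sub>R frame_join X vframe i q"]
    by simp
qed

end
end

lemma index_bijection: obtains r :: "'n \<Rightarrow> nat" where "bij_betw r UNIV {..<CARD('n)}"
  using ex_bij_betw_finite_nat[of "UNIV :: 'n set"] by (auto simp: atLeast0LessThan)

section \<open>Change of basis between a frame and coordinates\<close>

text \<open>Row \<open>a\<close> holds the components of frame field \<open>a\<close>. They are
  formed with the global functions \<open>\<xi> j\<close>, so that entries and determinant are
  smooth on the whole manifold. On the adapted chart domain the reciprocal of the determinant is, up
  to sign, the Riemannian density.\<close>

definition frame_coords :: "(nat \<Rightarrow> 'a vfield) \<Rightarrow> ('n \<Rightarrow> nat) \<Rightarrow> ('n \<Rightarrow> 'a \<Rightarrow> real) \<Rightarrow> 'a \<Rightarrow> real ^ 'n ^ 'n"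
  where "frame_coords X r \<xi> q = (\<chi> a j. full_frame X r a q (\<xi> j))"

definition coord_frame :: "(nat \<Rightarrow> 'a vfield) \<Rightarrow> ('n \<Rightarrow> nat) \<Rightarrow> 'a set \<Rightarrow> ('a \<Rightarrow> real ^ 'n) \<Rightarrow> 'a \<Rightarrow> real ^ 'n ^ 'n"
  where "coord_frame X r U \<phi> q = (\<chi> i a. gR q (coord_vector U \<phi> i q) (full_frame X r a q))"

lemma adapted_coordinates:
  assumes X: "horizontal_frame p X"
  obtains U \<phi> \<xi> W where "(U, \<phi>) \<in> atlas" "open W" "p \<in> W" "W \<subseteq> U"
    "\<And>j. \<xi> j \<in> smooth_funs" "\<And>q j. q \<in> W \<Longrightarrow> \<phi> q $ j = \<xi> j q"
    "\<And>q. q \<in> W \<Longrightarrow> orthonormal_family (H q) (g q) d (\<lambda>i. X i q)"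
proof -
  obtain U \<phi> \<xi> W where c: "(U, \<phi>) \<in> atlas" and W: "open W" "p \<in> W" "W \<subseteq> U"
    and \<xi>: "\<And>j. \<xi> j \<in> smooth_funs" "\<And>q j. q \<in> W \<Longrightarrow> \<phi> q $ j = \<xi> j q"
    by (rule local_coordinates) (rule that)
  obtain N where N: "open N" "p \<in> N" "\<And>q. q \<in> N \<Longrightarrow> orthonormal_family (H q) (g q) d (\<lambda>i. X i q)"
    by (rule horizontal_frame_orthonormal[OF X]) (rule that)
  show ?thesis
    by (rule that[OF c, of "W \<inter> N" \<xi>]) (use W N \<xi> in auto)
qed

context
  fixes p X and r :: "'n \<Rightarrow> nat" and U \<phi> \<xi> W
  assumes X: "horizontal_frame p X" and r: "bij_betw r UNIV {..<CARD('n)}"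
    and c: "(U, \<phi>) \<in> atlas" and W: "open W" "W \<subseteq> U"
    and \<xi>: "\<And>j. \<xi> j \<in> smooth_funs" "\<And>q j. q \<in> W \<Longrightarrow> \<phi> q $ j = \<xi> j q"
    and on: "\<And>q. q \<in> W \<Longrightarrow> orthonormal_family (H q) (g q) d (\<lambda>i. X i q)"
begin

lemma coord_frame_mult:
  assumes q: "q \<in> W" shows "coord_frame X r U \<phi> q ** frame_coords X r \<xi> q = mat 1"
proof -
  have "(\<Sum>a\<in>UNIV. gR q (coord_vector U \<phi> i q) (full_frame X r a q) * full_frame X r a q (\<xi> j)) = of_bool (i = j)" for i j
  proof -
    have "q \<in> U" using q W by auto
    then have "coord_vector U \<phi> i q \<in> tangent_space q" by (rule coord_vector_tangent[OF c])
    from fun_cong[OF full_frame_expansion[OF X r on[OF q] this], of "\<xi> j"]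
    have "coord_vector U \<phi> i q (\<xi> j) =
        (\<Sum>a\<in>UNIV. gR q (coord_vector U \<phi> i q) (full_frame X r a q) * full_frame X r a q (\<xi> j))"
      by (simp only: sum_fun_app scaleR_fun_app real_scaleR_def)
    then show ?thesis using coord_vector_coordinate[OF c W(1) q W(2) \<xi>] by simp
  qed
  then show ?thesis
    by (simp add: matrix_matrix_mult_def coord_frame_def frame_coords_def mat_def vec_eq_iff)
qed

lemma det_frame_coords:
  assumes q: "q \<in> W"
  shows "det (coord_frame X r U \<phi> q) * det (frame_coords X r \<xi> q) = 1" "det (frame_coords X r \<xi> q) \<noteq> 0"
proof -
  show "det (coord_frame X r U \<phi> q) * det (frame_coords X r \<xi> q) = 1"
    using coord_frame_mult[OF q] by (metis det_I det_mul)
  then show "det (frame_coords X r \<xi> q) \<noteq> 0" by auto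
qed

text \<open>\<open>gR\<close> is assembled from pointwise choices, so its smoothness is not visible
  in the definition. Cramer's rule supplies it: the frame coefficients of \<open>B\<close> solve a
  linear system with smooth data whose determinant does not vanish on \<open>W\<close>.\<close>

lemma full_frame_ip_smooth:
  assumes B: "B \<in> vector_fields"
  shows "smooth_fun_on W (\<lambda>q. gR q (B q) (full_frame X r a q))"
proof -
  let ?A = "\<lambda>q. transpose (frame_coords X r \<xi> q)"
  let ?c = "\<lambda>q. \<chi> a. gR q (B q) (full_frame X r a q)"
  let ?\<beta> = "\<lambda>q. \<chi> j. B q (\<xi> j)"
  let ?M = "\<lambda>q. \<chi> i j. if j = a then ?\<beta> q $ i else ?A q $ i $ j"
  have eq: "gR q (B q) (full_frame X r a q) = det (?M q) * inverse (det (?A q))" if q: "q \<in> W" for q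
  proof -
    have "B q (\<xi> j) = (\<Sum>a\<in>UNIV. full_frame X r a q (\<xi> j) * gR q (B q) (full_frame X r a q))" for j
      using fun_cong[OF full_frame_expansion[OF X r on[OF q] vector_field_tangent[OF B]], of "\<xi> j"]
      by (simp only: sum_fun_app scaleR_fun_app real_scaleR_def mult.commute)
    then have "?A q *v ?c q = ?\<beta> q"
      by (simp add: matrix_vector_mult_def transpose_def frame_coords_def vec_eq_iff)
    moreover have "det (?A q) \<noteq> 0" using det_frame_coords(2)[OF q] by simp
    ultimately have "?c q = (\<chi> k. det (\<chi> i j. if j = k then ?\<beta> q $ i else ?A q $ i $ j) / det (?A q))"
      using cramer by blast
    then have "?c q $ a = (\<chi> k. det (\<chi> i j. if j = k then ?\<beta> q $ i else ?A q $ i $ j) / det (?A q)) $ a"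
      by simp
    then show ?thesis by (simp add: divide_inverse)
  qed
  have sm: "smooth_fun_on W (\<lambda>q. full_frame X r a q (\<xi> j))" for a j
    by (intro smooth_funs_imp_smooth_fun_on vector_field_smooth[OF full_frame_vector_field[OF X r] \<xi>(1)])
  have "smooth_fun_on W (\<lambda>q. det (?M q))"
  proof (rule smooth_fun_on_det[OF W(1)])
    fix i j
    show "smooth_fun_on W (\<lambda>q. ?M q $ i $ j)"
      using sm smooth_funs_imp_smooth_fun_on[OF vector_field_smooth[OF B \<xi>(1)]]
      by (cases "j = a") (simp_all add: transpose_def frame_coords_def)
  qed
  moreover have "smooth_fun_on W (\<lambda>q. inverse (det (?A q)))"
    unfolding det_transpose
  proof (rule smooth_fun_on_inverse[OF W(1)])
    show "smooth_fun_on W (\<lambda>q. det (frame_coords X r \<xi> q))"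
      by (rule smooth_fun_on_det[OF W(1)]) (simp add: frame_coords_def sm)
    show "det (frame_coords X r \<xi> q) \<noteq> 0" if "q \<in> W" for q
      by (rule det_frame_coords(2)[OF that])
  qed
  ultimately have prod: "smooth_fun_on W (\<lambda>q. det (?M q) * inverse (det (?A q)))"
    by (rule smooth_fun_on_mult[OF W(1)])
  show ?thesis by (rule smooth_fun_on_cong[OF W(1) _ prod]) (rule eq[symmetric])
qed

end

lemma gR_smooth:
  assumes "A \<in> vector_fields" "B \<in> vector_fields"
  shows "(\<lambda>q. gR q (A q) (B q)) \<in> smooth_funs"
proof (rule smooth_funs_local)
  fix p
  obtain X where X: "horizontal_frame p X" using horizontal_frame_exists by blast
  obtain r :: "'n \<Rightarrow> nat" where r: "bij_betw r UNIV {..<CARD('n)}" by (rule index_bijection)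
  obtain U \<phi> \<xi> W where c: "(U, \<phi>) \<in> atlas" and W: "open W" "p \<in> W" "W \<subseteq> U"
    and \<xi>: "\<And>j. \<xi> j \<in> smooth_funs" "\<And>q j. q \<in> W \<Longrightarrow> \<phi> q $ j = \<xi> j q"
    and on: "\<And>q. q \<in> W \<Longrightarrow> orthonormal_family (H q) (g q) d (\<lambda>i. X i q)"
    by (rule adapted_coordinates[OF X]) (rule that)
  note sm = full_frame_ip_smooth[OF X r c W(1,3) \<xi> on]
  have "smooth_fun_on W (\<lambda>q. \<Sum>a\<in>UNIV. gR q (A q) (full_frame X r a q) * gR q (B q) (full_frame X r a q))"
    by (intro smooth_fun_on_sum smooth_fun_on_mult W sm assms)
  moreover have "(\<Sum>a\<in>UNIV. gR q (A q) (full_frame X r a q) * gR q (B q) (full_frame X r a q)) = gR q (A q) (B q)"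
    if q: "q \<in> W" for q
  proof -
    note T = vector_field_tangent
    have "gR q (A q) (B q) = gR q (\<Sum>a\<in>UNIV. gR q (A q) (full_frame X r a q) *\<^sub>R full_frame X r a q) (B q)"
      using full_frame_expansion[OF X r on[OF q] T[OF assms(1)]] by simp
    also have "\<dots> = (\<Sum>a\<in>UNIV. gR q (A q) (full_frame X r a q) * gR q (B q) (full_frame X r a q))"
      by (subst ip_sum_left[OF gR_ip])
        (auto simp: ip_scale_left[OF gR_ip] T assms full_frame_vector_field[OF X r] ip_sym[OF gR_ip T[OF assms(2)]]
          subspace_scale[OF subspace_tangent_space])
    finally show ?thesis by simp
  qed
  ultimately have "smooth_fun_on W (\<lambda>q. gR q (A q) (B q))"
    by (intro smooth_fun_on_cong[OF W(1), where h = "\<lambda>q. gR q (A q) (B q)"])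
  then show "\<exists>N. open N \<and> p \<in> N \<and> smooth_fun_on N (\<lambda>q. gR q (A q) (B q))" using W by blast
qed

lemma horizontal_expansion:
  assumes "horizontal_frame p X" "u \<in> H p"
  shows "u = (\<Sum>i<d. g p u (X i p) *\<^sub>R X i p)"
  by (rule H_expansion[OF horizontal_frame_at[OF assms(1)] assms(2)])

lemma gradH_frame: "horizontal_frame p X \<Longrightarrow> gradH f p = (\<Sum>i<d. X i p f *\<^sub>R X i p)"
  by (rule gradH_eq_sum[OF horizontal_frame_at])

lemma gradH_horizontal:
  assumes f: "f \<in> smooth_funs"
  shows "gradH f \<in> horizontal_fields H"
proof (rule horizontal_fieldsI[OF vector_fieldsI gradH_mem])
  show "gradH f p \<in> tangent_space p" for p by (rule H_tangent[OF gradH_mem])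
  fix h assume h: "h \<in> smooth_funs"
  show "(\<lambda>p. gradH f p h) \<in> smooth_funs"
  proof (rule smooth_funs_local)
    fix p
    obtain X where X: "horizontal_frame p X" using horizontal_frame_exists by blast
    obtain N where N: "open N" "p \<in> N" "\<And>q. q \<in> N \<Longrightarrow> orthonormal_family (H q) (g q) d (\<lambda>i. X i q)"
      by (rule horizontal_frame_orthonormal[OF X]) (rule that)
    have "(\<lambda>q. \<Sum>i<d. X i q f * X i q h) \<in> smooth_funs"
      by (intro smooth_funs_sum smooth_funs_mult)
        (auto intro!: vector_field_smooth[OF horizontal_vector_field[OF horizontal_frame_field[OF X]]] f h)
    then have "smooth_fun_on N (\<lambda>q. \<Sum>i<d. X i q f * X i q h)" by (rule smooth_funs_imp_smooth_fun_on)
    moreover have "(\<Sum>i<d. X i q f * X i q h) = gradH f q h" if "q \<in> N" for q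
      by (simp add: gradH_eq_sum[OF N(3)[OF that]] sum_fun_app)
    ultimately have "smooth_fun_on N (\<lambda>q. gradH f q h)"
      by (intro smooth_fun_on_cong[OF N(1), where h = "\<lambda>q. gradH f q h"])
    then show "\<exists>N. open N \<and> p \<in> N \<and> smooth_fun_on N (\<lambda>p. gradH f p h)" using N by blast
  qed
qed

end

subsection \<open>Integration by parts and the sub-Laplacian\<close>

lemma integral_lborel_translate:
  fixes f :: "'e::euclidean_space \<Rightarrow> real"
  assumes "f \<in> borel_measurable borel"
  shows "(\<integral>x. f (c + x) \<partial>lborel) = (\<integral>x. f x \<partial>lborel)"
proof -
  have "(\<integral>x. f x \<partial>lborel) = (\<integral>x. f x \<partial>distr lborel borel ((+) c))"
    by (simp add: lborel_distr_plus)
  also have "\<dots> = (\<integral>x. f (c + x) \<partial>lborel)"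
    by (rule integral_distr) (use assms in simp_all)
  finally show ?thesis by simp
qed

lemma integrable_continuous_bounded_support:
  fixes f :: "'e::euclidean_space \<Rightarrow> real"
  assumes "continuous_on UNIV f" "\<And>x. x \<notin> cball 0 R \<Longrightarrow> f x = 0"
  shows "integrable lborel f"
proof -
  have "integrable lborel (\<lambda>x. indicator (cball 0 R) x *\<^sub>R f x)"
    by (rule borel_integrable_compact) (use assms(1) continuous_on_subset in auto)
  moreover have "(\<lambda>x. indicator (cball 0 R) x *\<^sub>R f x) = f"
    using assms(2) by (force simp: indicator_def)
  ultimately show ?thesis by simp
qed

text \<open>By translation invariance the difference quotients of \<open>f\<close> have integral zero.\<close>

lemma integral_directional_derivative:
  fixes f :: "'e::euclidean_space \<Rightarrow> real"
  assumes f: "Cinf_on UNIV f" and supp: "\<And>x. x \<notin> cball 0 R \<Longrightarrow> f x = 0"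
  shows "(\<integral>x. frechet_derivative f (at x) v \<partial>lborel) = 0"
proof -
  let ?D = "\<lambda>x. frechet_derivative f (at x) v"
  have cf: "continuous_on UNIV f" by (rule Cinf_on_continuous[OF open_UNIV f])
  have cD: "continuous_on UNIV ?D"
    by (rule Cinf_on_continuous[OF open_UNIV Cinf_on_frechet_derivative[OF f]])
  have D0: "?D x = 0" if x: "x \<notin> cball 0 R" for x
  proof -
    have "frechet_derivative f (at x) = frechet_derivative (\<lambda>x. 0) (at x)"
    proof (rule frechet_derivative_transform_within_open)
      show "f differentiable at x"
        using Cinf_on_has_derivative[OF f open_UNIV, of x] by (auto simp: differentiable_def)
      show "open (- cball (0::'e) R)" by (rule open_Compl[OF closed_cball])
    qed (use x supp in auto)
    then show ?thesis by (simp add: frechet_derivative_const)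
  qed
  have "bounded (?D ` cball 0 R)"
    by (intro compact_imp_bounded compact_continuous_image compact_cball continuous_on_subset[OF cD]) simp
  then obtain M where M: "M > 0" "\<forall>x\<in>cball 0 R. \<bar>?D x\<bar> \<le> M"
    unfolding bounded_pos by (auto simp del: mem_cball)
  have DM: "\<bar>?D x\<bar> \<le> M" for x using M D0[of x] by (cases "x \<in> cball 0 R") (auto simp del: mem_cball)
  have deriv: "((\<lambda>s. f (x + s *\<^sub>R v)) has_real_derivative ?D (x + s *\<^sub>R v)) (at s)" for x s
  proof -
    have "((\<lambda>s. x + s *\<^sub>R v) has_derivative (\<lambda>t. t *\<^sub>R v)) (at s)"
      by (auto intro!: derivative_eq_intros)
    from diff_chain_at[OF this Cinf_on_has_derivative[OF f open_UNIV UNIV_I]]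
    have "((\<lambda>s. f (x + s *\<^sub>R v)) has_derivative (\<lambda>t. frechet_derivative f (at (x + s *\<^sub>R v)) (t *\<^sub>R v))) (at s)"
      by (simp add: o_def)
    moreover have "frechet_derivative f (at (x + s *\<^sub>R v)) (t *\<^sub>R v) = ?D (x + s *\<^sub>R v) * t" for t
      using linear_cmul[OF has_derivative_linear[OF Cinf_on_has_derivative[OF f open_UNIV UNIV_I]]]
      by (simp add: mult.commute)
    ultimately show ?thesis by (simp add: has_field_derivative_def)
  qed
  define h where "h n = inverse (real (Suc n))" for n
  have h: "h n > 0" "h n \<le> 1" for n by (auto simp: h_def field_simps)
  have h0: "h \<longlonglongrightarrow> 0" unfolding h_def by (rule LIMSEQ_inverse_real_of_nat)
  define q where "q n x = (f (x + h n *\<^sub>R v) - f x) / h n" for n x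
  have cq: "continuous_on UNIV (q n)" for n
    unfolding q_def
    by (intro continuous_intros continuous_on_compose2[OF cf]) (use h(1)[of n] in auto)
  have int_shift: "integrable lborel (\<lambda>x. f (c + x))" for c
    by (rule integrable_continuous_bounded_support[where R = "R + norm c"])
      (use norm_triangle_ineq4[of "c + _" c] in \<open>auto intro!: continuous_intros continuous_on_compose2[OF cf] supp,
        smt (verit) add_diff_cancel_left' norm_triangle_ineq4\<close>)
  have q_int: "(\<integral>x. q n x \<partial>lborel) = 0" for n
  proof -
    have "f \<in> borel_measurable borel" using cf by (simp add: borel_measurable_continuous_onI)
    from integral_lborel_translate[OF this, of "h n *\<^sub>R v"]
    have "(\<integral>x. f (h n *\<^sub>R v + x) - f (0 + x) \<partial>lborel) = 0"
      by (subst Bochner_Integration.integral_diff[OF int_shift int_shift]) simp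
    then show ?thesis unfolding q_def by (simp add: add.commute)
  qed
  have qM: "\<bar>q n x\<bar> \<le> M" for n x
  proof -
    obtain z where "f (x + h n *\<^sub>R v) - f (x + 0 *\<^sub>R v) = (h n - 0) * ?D (x + z *\<^sub>R v)"
      using MVT2[OF h(1)[of n], of "\<lambda>s. f (x + s *\<^sub>R v)" "\<lambda>s. ?D (x + s *\<^sub>R v)"] deriv by blast
    then have "q n x = ?D (x + z *\<^sub>R v)" using h(1)[of n] by (simp add: q_def field_simps)
    then show ?thesis using DM by simp
  qed
  \<comment> \<open>The step sizes are at most 1, so all difference quotients are supported in one
    ball, and \<open>M\<close> times its indicator is an integrable bound.\<close>
  have q0: "q n x = 0" if x: "x \<notin> cball 0 (R + norm v)" for n x
  proof -
    have "norm (h n *\<^sub>R v) \<le> norm v" using h[of n] by (simp add: mult_left_le_one_le)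
    moreover have "norm x \<le> norm (x + h n *\<^sub>R v) + norm (h n *\<^sub>R v)"
      using norm_triangle_ineq4[of "x + h n *\<^sub>R v" "h n *\<^sub>R v"] by simp
    ultimately have "x + h n *\<^sub>R v \<notin> cball 0 R" "x \<notin> cball 0 R"
      using x norm_ge_zero[of v] unfolding mem_cball_0 by linarith+
    then show ?thesis by (simp add: q_def supp)
  qed
  have "(\<lambda>n. \<integral>x. q n x \<partial>lborel) \<longlonglongrightarrow> (\<integral>x. ?D x \<partial>lborel)"
  proof (rule integral_dominated_convergence)
    show "integrable lborel (\<lambda>x. indicator (cball 0 (R + norm v)) x *\<^sub>R M)"
      by (rule borel_integrable_compact) auto
    show "AE x in lborel. (\<lambda>n. q n x) \<longlonglongrightarrow> ?D x"
    proof (rule AE_I2)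
      fix x
      have "((\<lambda>t. (f (x + (0 + t) *\<^sub>R v) - f (x + 0 *\<^sub>R v)) / t) \<longlongrightarrow> ?D (x + 0 *\<^sub>R v)) (at 0)"
        using DERIV_D[OF deriv[of x 0]] by simp
      then have "((\<lambda>t. (f (x + t *\<^sub>R v) - f x) / t) \<longlongrightarrow> ?D x) (at 0)" by simp
      moreover have "filterlim h (at 0) sequentially"
        using h0 h(1) by (auto simp: filterlim_at less_imp_neq[symmetric])
      ultimately show "(\<lambda>n. q n x) \<longlonglongrightarrow> ?D x"
        unfolding q_def by (rule filterlim_compose)
    qed
    show "AE x in lborel. norm (q n x) \<le> indicator (cball 0 (R + norm v)) x *\<^sub>R M" for n
    proof (rule AE_I2)
      fix x show "norm (q n x) \<le> indicator (cball 0 (R + norm v)) x *\<^sub>R M"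
        using qM[of n x] q0[of x n] by (cases "x \<in> cball 0 (R + norm v)") auto
    qed
    show "?D \<in> borel_measurable lborel" using cD by (simp add: borel_measurable_continuous_onI)
    show "q n \<in> borel_measurable lborel" for n using cq[of n] by (simp add: borel_measurable_continuous_onI)
  qed
  then have "(\<lambda>n. 0) \<longlonglongrightarrow> (\<integral>x. ?D x \<partial>lborel)" by (simp add: q_int)
  then show ?thesis using LIMSEQ_unique tendsto_const by blast
qed

text \<open>The zero set is closed and has full Lebesgue measure, hence it is the whole space. Used
  to pass from a vanishing integral to a pointwise identity.\<close>

lemma continuous_integral_zero_imp_zero:
  fixes f :: "'e::euclidean_space \<Rightarrow> real"
  assumes "continuous_on UNIV f" "integrable lborel f" "\<And>x. f x \<ge> 0" "(\<integral>x. f x \<partial>lborel) = 0"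
  shows "f x = 0"
proof -
  have "AE x in lborel. f x = 0"
    using integral_nonneg_eq_0_iff_AE[OF assms(2)] assms(3,4) by simp
  then have "AE x in lebesgue. x \<in> {x. f x = 0}"
    by (simp add: AE_completion)
  moreover have "closed {x. f x = 0}"
    using closed_Collect_eq[OF assms(1) continuous_on_const] by simp
  ultimately show ?thesis using mem_closed_if_AE_lebesgue by blast
qed

lemma Cinf_on_extend_zero:
  fixes F :: "'e::euclidean_space \<Rightarrow> real"
  assumes "open O'" "Cinf_on O' F" "compact K" "K \<subseteq> O'" "\<And>x. x \<in> O' \<Longrightarrow> x \<notin> K \<Longrightarrow> F x = 0"
  shows "Cinf_on UNIV (\<lambda>x. if x \<in> O' then F x else 0)"
proof (rule Cinf_on_local)
  fix x :: 'e
  show "\<exists>T. open T \<and> x \<in> T \<and> Cinf_on T (\<lambda>x. if x \<in> O' then F x else 0)"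
  proof (cases "x \<in> O'")
    case True
    have "Cinf_on O' (\<lambda>x. if x \<in> O' then F x else 0)"
      using assms(2) by (subst Cinf_on_cong[OF assms(1), where g = F]) auto
    with True assms(1) show ?thesis by blast
  next
    case False
    have K: "open (- K)" by (rule open_Compl[OF compact_imp_closed[OF assms(3)]])
    have "Cinf_on (- K) (\<lambda>x. if x \<in> O' then F x else 0)"
      using assms(5) by (subst Cinf_on_cong[OF K, where g = "\<lambda>x. 0"]) (auto simp: Cinf_on_const)
    with False K assms(4) show ?thesis by blast
  qed
qed

section \<open>Jacobi's formula and transplantation to a chart\<close>

context smooth_manifold
begin

lemma smooth_funs_prod: "(\<And>i. i \<in> I \<Longrightarrow> F i \<in> smooth_funs) \<Longrightarrow> (\<lambda>q. \<Prod>i\<in>I. F i q) \<in> smooth_funs"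
  by (simp add: smooth_funs_def smooth_fun_on_prod)

lemma smooth_funs_det:
  fixes M :: "'a \<Rightarrow> real ^ 'm::finite ^ 'm"
  shows "(\<And>i j. (\<lambda>q. M q $ i $ j) \<in> smooth_funs) \<Longrightarrow> (\<lambda>q. det (M q)) \<in> smooth_funs"
  by (simp add: smooth_funs_def smooth_fun_on_det)

lemma tangent_prod:
  assumes v: "v \<in> tangent_space p" and I: "finite I" and F: "\<And>i. i \<in> I \<Longrightarrow> F i \<in> smooth_funs"
  shows "v (\<lambda>q. \<Prod>i\<in>I. F i q) = (\<Sum>i\<in>I. v (F i) * (\<Prod>k\<in>I - {i}. F k p))"
  using I F
proof (induction I rule: finite_induct)
  case empty
  then show ?case by (simp add: tangent_const[OF v])
next
  case (insert j I)
  have Fj: "F j \<in> smooth_funs" and P: "(\<lambda>q. \<Prod>i\<in>I. F i q) \<in> smooth_funs"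
    using insert.prems by (auto intro: smooth_funs_prod)
  have "v (\<lambda>q. \<Prod>i\<in>insert j I. F i q) = v (\<lambda>q. F j q * (\<Prod>i\<in>I. F i q))"
    using insert.hyps by simp
  also have "\<dots> = F j p * (\<Sum>i\<in>I. v (F i) * (\<Prod>k\<in>I - {i}. F k p)) + (\<Prod>i\<in>I. F i p) * v (F j)"
    using tangent_mult[OF v Fj P] insert.IH insert.prems by simp
  also have "F j p * (\<Sum>i\<in>I. v (F i) * (\<Prod>k\<in>I - {i}. F k p)) =
      (\<Sum>i\<in>I. v (F i) * (\<Prod>k\<in>insert j I - {i}. F k p))"
    unfolding sum_distrib_left
  proof (rule sum.cong[OF refl])
    fix i assume i: "i \<in> I"
    then have "insert j I - {i} = insert j (I - {i})" using insert.hyps by auto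
    then show "F j p * (v (F i) * (\<Prod>k\<in>I - {i}. F k p)) = v (F i) * (\<Prod>k\<in>insert j I - {i}. F k p)"
      using insert.hyps by simp
  qed
  also have "(\<Prod>i\<in>I. F i p) = (\<Prod>k\<in>insert j I - {j}. F k p)" using insert.hyps by simp
  finally show ?case using insert.hyps by (simp add: add.commute mult.commute)
qed

text \<open>A permutation other than the identity moves at least two indices. The product rule
  differentiates a single factor, so at the identity matrix an off-diagonal zero is left among the
  others and the term vanishes.\<close>

lemma tangent_det_identity:
  fixes M :: "'a \<Rightarrow> real ^ 'm::finite ^ 'm"
  assumes v: "v \<in> tangent_space p" and M: "\<And>i j. (\<lambda>q. M q $ i $ j) \<in> smooth_funs" and M1: "M p = mat 1"
  shows "v (\<lambda>q. det (M q)) = (\<Sum>i\<in>UNIV. v (\<lambda>q. M q $ i $ i))"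
proof -
  let ?P = "{\<sigma>. \<sigma> permutes (UNIV :: 'm set)}"
  have "v (\<lambda>q. det (M q)) = (\<Sum>\<sigma>\<in>?P. of_int (sign \<sigma>) * v (\<lambda>q. \<Prod>i\<in>UNIV. M q $ i $ \<sigma> i))"
    unfolding det_def
    by (subst tangent_sum[OF v]) (simp_all add: smooth_funs_intros smooth_funs_prod M tangent_cmult[OF v])
  also have "\<dots> = (\<Sum>\<sigma>\<in>{id}. of_int (sign \<sigma>) * v (\<lambda>q. \<Prod>i\<in>UNIV. M q $ i $ \<sigma> i))"
  proof (rule sum.mono_neutral_right)
    show "\<forall>\<sigma>\<in>?P - {id}. of_int (sign \<sigma>) * v (\<lambda>q. \<Prod>i\<in>UNIV. M q $ i $ \<sigma> i) = 0"
    proof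
      fix \<sigma> assume \<sigma>: "\<sigma> \<in> ?P - {id}"
      then obtain j where j: "\<sigma> j \<noteq> j" by (auto simp: fun_eq_iff)
      have inj: "\<sigma> a = \<sigma> b \<longleftrightarrow> a = b" for a b
        using \<sigma> permutes_inj[of \<sigma> UNIV] by (auto simp: inj_def)
      have prod0: "(\<Prod>k\<in>UNIV - {i}. M p $ k $ \<sigma> k) = 0" for i
      proof -
        have "\<exists>k. k \<noteq> i \<and> \<sigma> k \<noteq> k" using j inj by metis
        then obtain k where k: "k \<noteq> i" "\<sigma> k \<noteq> k" by blast
        then have "M p $ k $ \<sigma> k = 0" by (simp add: M1 mat_def)
        with k show ?thesis by (intro prod_zero) auto
      qed
      show "of_int (sign \<sigma>) * v (\<lambda>q. \<Prod>i\<in>UNIV. M q $ i $ \<sigma> i) = 0"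
        by (simp only: tangent_prod[OF v finite M] prod0 mult_zero_right sum.neutral_const)
    qed
  qed (auto simp: permutes_id)
  also have "\<dots> = (\<Sum>i\<in>UNIV. v (\<lambda>q. M q $ i $ i))"
    by (simp add: tangent_prod[OF v _ M] M1 mat_def sign_id)
  finally show ?thesis .
qed

text \<open>Jacobi's formula. Multiplication by the constant matrix \<open>B\<close> moves
  \<open>A p\<close> to the identity, where the previous lemma applies, and \<open>det B\<close> is
  the reciprocal of \<open>det (A p)\<close>.\<close>

lemma tangent_det:
  fixes A :: "'a \<Rightarrow> real ^ 'm::finite ^ 'm"
  assumes v: "v \<in> tangent_space p" and A: "\<And>i j. (\<lambda>q. A q $ i $ j) \<in> smooth_funs" and B: "A p ** B = mat 1"
  shows "v (\<lambda>q. det (A q)) = det (A p) * (\<Sum>i\<in>UNIV. \<Sum>j\<in>UNIV. v (\<lambda>q. A q $ i $ j) * B $ j $ i)"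
proof -
  have M: "(\<lambda>q. (A q ** B) $ i $ j) \<in> smooth_funs" for i j
    unfolding matrix_matrix_mult_def by (simp add: smooth_funs_intros A)
  have dA: "(\<lambda>q. det (A q)) \<in> smooth_funs" by (rule smooth_funs_det[OF A])
  have d1: "det (A p) * det B = 1" using B by (metis det_I det_mul)
  have "v (\<lambda>q. (A q ** B) $ i $ i) = (\<Sum>j\<in>UNIV. v (\<lambda>q. A q $ i $ j) * B $ j $ i)" for i
  proof -
    have "v (\<lambda>q. \<Sum>j\<in>UNIV. B $ j $ i * A q $ i $ j) = (\<Sum>j\<in>UNIV. v (\<lambda>q. A q $ i $ j) * B $ j $ i)"
      by (simp add: tangent_sum[OF v] smooth_funs_intros A tangent_cmult[OF v] mult.commute)
    then show ?thesis by (simp add: matrix_matrix_mult_def mult.commute)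
  qed
  then have "(\<Sum>i\<in>UNIV. \<Sum>j\<in>UNIV. v (\<lambda>q. A q $ i $ j) * B $ j $ i) = v (\<lambda>q. det (A q ** B))"
    using tangent_det_identity[OF v M B] by simp
  also have "\<dots> = v (\<lambda>q. det B * det (A q))" by (simp add: det_mul mult.commute)
  also have "\<dots> = det B * v (\<lambda>q. det (A q))" by (rule tangent_cmult[OF v dA])
  finally show ?thesis using d1 by (simp flip: mult.assoc)
qed

text \<open>Extended by zero beyond the chart image, so that integrals can run over the whole
  Euclidean space. For a smooth \<open>F\<close> with compact support in \<open>W\<close> the result
  is smooth.\<close>

definition chart_extension :: "('a \<Rightarrow> real ^ 'n) \<Rightarrow> 'a set \<Rightarrow> 'a set \<Rightarrow> ('a \<Rightarrow> real) \<Rightarrow> real ^ 'n \<Rightarrow> real"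
  where "chart_extension \<phi> U W F x = (if x \<in> \<phi> ` W then F (inv_into U \<phi> x) else 0)"

context
  fixes U \<phi> W
  assumes c: "(U, \<phi>) \<in> atlas" and W: "open W" "W \<subseteq> U"
begin

lemma chart_extension_eq: "q \<in> W \<Longrightarrow> chart_extension \<phi> U W F (\<phi> q) = F q"
  using c W by (auto simp: chart_extension_def)

context
  fixes F assumes F: "F \<in> smooth_funs" "compact (closure {q. F q \<noteq> 0})" "closure {q. F q \<noteq> 0} \<subseteq> W"
begin

lemma chart_support_compact: "compact (\<phi> ` closure {q. F q \<noteq> 0})" "\<phi> ` closure {q. F q \<noteq> 0} \<subseteq> \<phi> ` W"
  using F W by (auto intro!: compact_continuous_image continuous_on_subset[OF chart_continuous_on[OF c]])

lemma chart_extension_eq_0: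
  assumes "x \<notin> \<phi> ` closure {q. F q \<noteq> 0}" shows "chart_extension \<phi> U W F x = 0"
proof (cases "x \<in> \<phi> ` W")
  case True
  then obtain q where q: "q \<in> W" "x = \<phi> q" by auto
  then have "q \<notin> {q. F q \<noteq> 0}" using assms closure_subset[of "{q. F q \<noteq> 0}"] by blast
  then show ?thesis using chart_extension_eq[OF q(1), of F] q(2) by simp
qed (simp add: chart_extension_def)

lemma chart_extension_Cinf: "Cinf_on UNIV (chart_extension \<phi> U W F)"
proof -
  have "Cinf_on UNIV (\<lambda>x. if x \<in> \<phi> ` W then (F \<circ> inv_into U \<phi>) x else 0)"
  proof (rule Cinf_on_extend_zero[OF chart_image_open_subset[OF c W] _ chart_support_compact])
    show "Cinf_on (\<phi> ` W) (F \<circ> inv_into U \<phi>)"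
      by (rule smooth_fun_onD_subset[OF smooth_funs_imp_smooth_fun_on[OF F(1)] c W(2)])
    fix x assume "x \<in> \<phi> ` W" "x \<notin> \<phi> ` closure {q. F q \<noteq> 0}"
    then show "(F \<circ> inv_into U \<phi>) x = 0"
      using chart_extension_eq_0[of x] by (simp add: chart_extension_def)
  qed
  then show ?thesis unfolding chart_extension_def[abs_def] o_def .
qed

lemma chart_extension_bounded_support: obtains R where "\<And>x. x \<notin> cball 0 R \<Longrightarrow> chart_extension \<phi> U W F x = 0"
proof -
  obtain R where "\<forall>x\<in>\<phi> ` closure {q. F q \<noteq> 0}. norm x \<le> R"
    using compact_imp_bounded[OF chart_support_compact(1)] unfolding bounded_iff by blast
  then have "x \<notin> cball 0 R \<Longrightarrow> x \<notin> \<phi> ` closure {q. F q \<noteq> 0}" for x by (auto simp: mem_cball_0)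
  then show ?thesis using that chart_extension_eq_0 by blast
qed

lemma chart_extension_integrable: "integrable lborel (chart_extension \<phi> U W F)"
proof -
  obtain R where "\<And>x. x \<notin> cball 0 R \<Longrightarrow> chart_extension \<phi> U W F x = 0"
    by (rule chart_extension_bounded_support) (rule that)
  then show ?thesis
    using integrable_continuous_bounded_support[OF Cinf_on_continuous[OF open_UNIV chart_extension_Cinf]] by blast
qed

lemma chart_extension_derivative:
  "frechet_derivative (chart_extension \<phi> U W F) (at x) (axis i 1) =
    chart_extension \<phi> U W (\<lambda>q. coord_vector U \<phi> i q F) x"
proof -
  have d: "chart_extension \<phi> U W F differentiable at x"
    using Cinf_on_has_derivative[OF chart_extension_Cinf open_UNIV, of x] by (auto simp: differentiable_def)
  show ?thesis
  proof (cases "x \<in> \<phi> ` W")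
    case True
    then obtain q where q: "q \<in> W" "x = \<phi> q" by auto
    have "frechet_derivative (chart_extension \<phi> U W F) (at x) = frechet_derivative (F \<circ> inv_into U \<phi>) (at x)"
      by (rule frechet_derivative_transform_within_open[OF d chart_image_open_subset[OF c W] True])
        (simp add: chart_extension_def)
    then show ?thesis
      using q chart_extension_eq[OF q(1), of "\<lambda>q. coord_vector U \<phi> i q F"] F(1) by (simp add: coord_vector_def)
  next
    case False
    let ?K = "\<phi> ` closure {q. F q \<noteq> 0}"
    have "open (- ?K)" by (rule open_Compl[OF compact_imp_closed[OF chart_support_compact(1)]])
    moreover have "x \<in> - ?K" using False chart_support_compact(2) by blast
    ultimately have "frechet_derivative (chart_extension \<phi> U W F) (at x) = frechet_derivative (\<lambda>x. 0) (at x)"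
      by (rule frechet_derivative_transform_within_open[OF d]) (simp add: chart_extension_eq_0)
    then show ?thesis using False by (simp add: frechet_derivative_const chart_extension_def)
  qed
qed

lemma chart_extension_derivative_integral:
  "integrable lborel (chart_extension \<phi> U W (\<lambda>q. coord_vector U \<phi> i q F))"
  "(\<integral>x. chart_extension \<phi> U W (\<lambda>q. coord_vector U \<phi> i q F) x \<partial>lborel) = 0"
proof -
  obtain R where R: "\<And>x. x \<notin> cball 0 R \<Longrightarrow> chart_extension \<phi> U W F x = 0"
    by (rule chart_extension_bounded_support) (rule that)
  show "(\<integral>x. chart_extension \<phi> U W (\<lambda>q. coord_vector U \<phi> i q F) x \<partial>lborel) = 0"
    using integral_directional_derivative[OF chart_extension_Cinf R, where v = "axis i 1"]
    by (simp add: chart_extension_derivative)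
  have "\<exists>S. \<forall>x. x \<notin> cball 0 S \<longrightarrow> frechet_derivative (chart_extension \<phi> U W F) (at x) (axis i 1) = 0"
  proof (intro exI allI impI)
    fix x :: "real ^ 'n" assume x: "x \<notin> cball 0 R"
    have "frechet_derivative (chart_extension \<phi> U W F) (at x) = frechet_derivative (\<lambda>x. 0) (at x)"
    proof (rule frechet_derivative_transform_within_open)
      show "chart_extension \<phi> U W F differentiable at x"
        using Cinf_on_has_derivative[OF chart_extension_Cinf open_UNIV, of x] by (auto simp: differentiable_def)
      show "open (- cball (0 :: real ^ 'n) R)" by (rule open_Compl[OF closed_cball])
    qed (use x R in auto)
    then show "frechet_derivative (chart_extension \<phi> U W F) (at x) (axis i 1) = 0"
      by (simp add: frechet_derivative_const)
  qed
  then obtain S where S: "\<forall>x. x \<notin> cball 0 S \<longrightarrow> frechet_derivative (chart_extension \<phi> U W F) (at x) (axis i 1) = 0"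
    by blast
  have "integrable lborel (\<lambda>x. frechet_derivative (chart_extension \<phi> U W F) (at x) (axis i 1))"
    by (rule integrable_continuous_bounded_support
        [OF Cinf_on_continuous[OF open_UNIV Cinf_on_frechet_derivative[OF chart_extension_Cinf]]])
      (use S in blast)
  then show "integrable lborel (chart_extension \<phi> U W (\<lambda>q. coord_vector U \<phi> i q F))"
    by (simp add: chart_extension_derivative)
qed

end
end

end

section \<open>The divergence theorem in an adapted chart\<close>

context transverse_symmetries
begin

lemma killing_bracket: "Z \<in> V \<Longrightarrow> X \<in> horizontal_fields H \<Longrightarrow> lie_bracket Z X \<in> horizontal_fields H"
  using V_killing by (auto simp: killing_fields_def)

lemma horizontal_killing_bracket:
  "X \<in> horizontal_fields H \<Longrightarrow> Z \<in> V \<Longrightarrow> lie_bracket X Z \<in> horizontal_fields H"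
  using killing_bracket[of Z X] horizontal_diff[OF horizontal_zero, of "lie_bracket Z X"]
    lie_bracket_antisym[of X Z] by simp

context
  fixes p X and r :: "'n \<Rightarrow> nat" and U \<phi> \<xi> W
  assumes X: "horizontal_frame p X" and r: "bij_betw r UNIV {..<CARD('n)}"
    and c: "(U, \<phi>) \<in> atlas" and W: "open W" "W \<subseteq> U"
    and \<xi>: "\<And>j. \<xi> j \<in> smooth_funs" "\<And>q j. q \<in> W \<Longrightarrow> \<phi> q $ j = \<xi> j q"
    and on: "\<And>q. q \<in> W \<Longrightarrow> orthonormal_family (H q) (g q) d (\<lambda>i. X i q)"
begin

private abbreviation "E \<equiv> full_frame X r"
private abbreviation "A \<equiv> frame_coords X r \<xi>"
private abbreviation "B \<equiv> coord_frame X r U \<phi>"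
private abbreviation "Df q \<equiv> det (A q)"
private abbreviation "cv j q \<equiv> coord_vector U \<phi> j q"

lemma adapted_frame_vector_field: "E a \<in> vector_fields" by (rule full_frame_vector_field[OF X r])

lemma frame_coords_smooth: "(\<lambda>q. A q $ a $ j) \<in> smooth_funs"
  by (simp add: frame_coords_def vector_field_smooth[OF adapted_frame_vector_field \<xi>(1)])

lemma det_frame_coords_smooth: "(\<lambda>q. Df q) \<in> smooth_funs" by (rule smooth_funs_det[OF frame_coords_smooth])

lemma coord_vector_tangent_at: "q \<in> W \<Longrightarrow> cv j q \<in> tangent_space q"
  by (rule coord_vector_tangent[OF c]) (use W in auto)

text \<open>The divergence in coordinates against the divergence in an orthonormal frame, up to the
  derivative of the density.\<close>

lemma divergence_coords:
  assumes q: "q \<in> W" and Y: "Y \<in> vector_fields"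
  shows "(\<Sum>a\<in>UNIV. \<Sum>j\<in>UNIV. Y q (\<lambda>q. A q $ a $ j) * B q $ j $ a) =
    (\<Sum>j\<in>UNIV. cv j q (\<lambda>q. Y q (\<xi> j))) + (\<Sum>a\<in>UNIV. gR q (lie_bracket Y (E a) q) (E a q))"
proof -
  have br: "lie_bracket Y (E a) q (\<xi> j) = Y q (\<lambda>q. A q $ a $ j) - E a q (\<lambda>q. Y q (\<xi> j))" for a j
    by (simp add: lie_bracket_def frame_coords_def)
  have "gR q (lie_bracket Y (E a) q) (E a q) = (\<Sum>j\<in>UNIV. lie_bracket Y (E a) q (\<xi> j) * B q $ j $ a)" for a
  proof -
    let ?b = "lie_bracket Y (E a) q"
    have bT: "?b \<in> tangent_space q"
      by (rule vector_field_tangent[OF lie_bracket_vector_field[OF Y adapted_frame_vector_field]])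
    have "gR q ?b (E a q) = gR q (\<Sum>j\<in>UNIV. ?b (\<xi> j) *\<^sub>R cv j q) (E a q)"
      using tangent_coord_expansion[OF c W(1) q W(2) \<xi> bT] by simp
    also have "\<dots> = (\<Sum>j\<in>UNIV. gR q (?b (\<xi> j) *\<^sub>R cv j q) (E a q))"
      by (rule ip_sum_left[OF gR_ip])
        (simp_all add: subspace_scale[OF subspace_tangent_space] coord_vector_tangent_at[OF q] vector_field_tangent[OF adapted_frame_vector_field])
    also have "\<dots> = (\<Sum>j\<in>UNIV. ?b (\<xi> j) * B q $ j $ a)"
      by (simp add: ip_scale_left[OF gR_ip] coord_vector_tangent_at[OF q] vector_field_tangent[OF adapted_frame_vector_field] coord_frame_def)
    finally show ?thesis .
  qed
  moreover have "cv j q (\<lambda>q. Y q (\<xi> j)) = (\<Sum>a\<in>UNIV. B q $ j $ a * E a q (\<lambda>q. Y q (\<xi> j)))" for j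
    using fun_cong[OF full_frame_expansion[OF X r on[OF q] coord_vector_tangent_at[OF q, of j]], of "\<lambda>q. Y q (\<xi> j)"]
    by (simp only: sum_fun_app scaleR_fun_app real_scaleR_def) (simp add: coord_frame_def)
  moreover have "(\<Sum>j\<in>UNIV. \<Sum>a\<in>UNIV. B q $ j $ a * E a q (\<lambda>q. Y q (\<xi> j))) =
      (\<Sum>a\<in>UNIV. \<Sum>j\<in>UNIV. B q $ j $ a * E a q (\<lambda>q. Y q (\<xi> j)))"
    by (rule sum.swap)
  ultimately show ?thesis
    by (simp add: br left_diff_distrib sum_subtractf) (simp add: mult.commute)
qed

text \<open>Jacobi's formula combined with \<open>divergence_coords\<close>. Since
  \<open>inverse (Df q)\<close> is the density up to sign, it follows that the weighted divergence
  of \<open>Y\<close> is minus the sum of \<open>gR q (lie_bracket Y (E a) q) (E a q)\<close>, an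
  expression without coordinates.\<close>

lemma density_derivative:
  assumes q: "q \<in> W" and Y: "Y \<in> vector_fields"
  shows "Y q (\<lambda>q. Df q) = Df q * ((\<Sum>j\<in>UNIV. cv j q (\<lambda>q. Y q (\<xi> j))) +
    (\<Sum>a\<in>UNIV. gR q (lie_bracket Y (E a) q) (E a q)))"
proof -
  have "A q ** B q = mat 1"
    using coord_frame_mult[OF X r c W \<xi> on q] matrix_left_right_inverse by blast
  from tangent_det[OF vector_field_tangent[OF Y] frame_coords_smooth this]
  show ?thesis by (simp add: divergence_coords[OF q Y])
qed

lemma det_frame_coords_nonzero: "q \<in> W \<Longrightarrow> Df q \<noteq> 0"
  by (rule det_frame_coords(2)[OF X r c W \<xi> on])

context
  fixes \<eta> assumes \<eta>: "\<eta> \<in> smooth_funs" "compact (closure {q. \<eta> q \<noteq> 0})" "closure {q. \<eta> q \<noteq> 0} \<subseteq> W"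
begin

lemma support_zero: "q \<notin> W \<Longrightarrow> \<eta> q = 0"
  using \<eta>(3) closure_subset[of "{q. \<eta> q \<noteq> 0}"] by blast

lemma weight_smooth: "(\<lambda>q. \<eta> q * inverse (Df q)) \<in> smooth_funs"
  by (rule smooth_funs_bump_mult[OF \<eta>(1,3) W(1) smooth_fun_on_inverse[OF W(1)]])
    (simp_all add: smooth_funs_imp_smooth_fun_on[OF det_frame_coords_smooth] det_frame_coords_nonzero)

lemma weight_support:
  assumes h: "h \<in> smooth_funs"
  shows "(\<lambda>q. (\<eta> q * inverse (Df q)) * h q) \<in> smooth_funs"
    "compact (closure {q. (\<eta> q * inverse (Df q)) * h q \<noteq> 0})"
    "closure {q. (\<eta> q * inverse (Df q)) * h q \<noteq> 0} \<subseteq> W"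
proof -
  show "(\<lambda>q. (\<eta> q * inverse (Df q)) * h q) \<in> smooth_funs"
    by (rule smooth_funs_mult[OF weight_smooth h])
  have cl: "closure {q. (\<eta> q * inverse (Df q)) * h q \<noteq> 0} \<subseteq> closure {q. \<eta> q \<noteq> 0}"
    by (rule closure_mono) auto
  then show "closure {q. (\<eta> q * inverse (Df q)) * h q \<noteq> 0} \<subseteq> W" using \<eta>(3) by blast
  show "compact (closure {q. (\<eta> q * inverse (Df q)) * h q \<noteq> 0})"
    using compact_Int_closed[OF \<eta>(2) closed_closure, of "{q. (\<eta> q * inverse (Df q)) * h q \<noteq> 0}"] cl
    by (simp add: Int_absorb1)
qed

text \<open>The field \<open>Y\<close> weighted by \<open>\<eta> q * inverse (Df q)\<close> has
  compact support in the chart, so its coordinate divergence integrates to zero, and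
  \<open>density_derivative\<close> rewrites that divergence. The determinant keeps its sign here;
  passing to the density is postponed to a neighbourhood on which the sign is constant.\<close>

lemma divergence_theorem_signed:
  assumes Y: "Y \<in> vector_fields"
  shows "(\<integral>x. chart_extension \<phi> U W (\<lambda>q. inverse (Df q) *
    (Y q \<eta> - \<eta> q * (\<Sum>a\<in>UNIV. gR q (lie_bracket Y (E a) q) (E a q)))) x \<partial>lborel) = 0"
proof -
  let ?\<omega> = "\<lambda>q. \<eta> q * inverse (Df q)"
  let ?S = "\<lambda>q. \<Sum>a\<in>UNIV. gR q (lie_bracket Y (E a) q) (E a q)"
  have Ys: "(\<lambda>q. Y q (\<xi> i)) \<in> smooth_funs" for i by (rule vector_field_smooth[OF Y \<xi>(1)])
  note I = chart_extension_derivative_integral[OF c W weight_support[OF Ys]]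
  have solve: "a \<noteq> 0 \<Longrightarrow> a * y = t - w * (a * s) \<Longrightarrow> y = inverse a * t - w * s" for a y t w s :: real
    by (auto simp: field_simps)
  have pt: "(\<Sum>i\<in>UNIV. cv i q (\<lambda>q. ?\<omega> q * Y q (\<xi> i))) = inverse (Df q) * (Y q \<eta> - \<eta> q * ?S q)" if q: "q \<in> W" for q
  proof -
    have 1: "cv i q (\<lambda>q. ?\<omega> q * Y q (\<xi> i)) = ?\<omega> q * cv i q (\<lambda>q. Y q (\<xi> i)) + Y q (\<xi> i) * cv i q ?\<omega>" for i
      by (rule tangent_mult[OF coord_vector_tangent_at[OF q] weight_smooth Ys])
    have 2: "(\<Sum>i\<in>UNIV. Y q (\<xi> i) * cv i q ?\<omega>) = Y q ?\<omega>"
      using fun_cong[OF tangent_coord_expansion[OF c W(1) q W(2) \<xi> vector_field_tangent[OF Y]], of ?\<omega>]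
      by (simp only: sum_fun_app scaleR_fun_app real_scaleR_def)
    \<comment> \<open>The reciprocal of \<open>Df\<close> is under control on \<open>W\<close> only.
      The derivative of the weight is therefore read off from this product of globally smooth
      functions rather than from a quotient.\<close>
    have "\<eta> = (\<lambda>q. ?\<omega> q * Df q)"
    proof
      fix q show "\<eta> q = ?\<omega> q * Df q"
        using support_zero[of q] det_frame_coords_nonzero[of q] by (cases "q \<in> W") auto
    qed
    then have "Y q \<eta> = Y q (\<lambda>q. ?\<omega> q * Df q)" by (rule arg_cong)
    also have "\<dots> = ?\<omega> q * Y q (\<lambda>q. Df q) + Df q * Y q ?\<omega>"
      by (rule tangent_mult[OF vector_field_tangent[OF Y] weight_smooth det_frame_coords_smooth])
    finally have "Df q * Y q ?\<omega> = Y q \<eta> - ?\<omega> q * (Df q * ((\<Sum>j\<in>UNIV. cv j q (\<lambda>q. Y q (\<xi> j))) + ?S q))"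
      by (simp add: density_derivative[OF q Y])
    then have "Y q ?\<omega> = inverse (Df q) * Y q \<eta> - ?\<omega> q * ((\<Sum>j\<in>UNIV. cv j q (\<lambda>q. Y q (\<xi> j))) + ?S q)"
      by (rule solve[OF det_frame_coords_nonzero[OF q]])
    then show ?thesis
      by (simp add: 1 2 sum.distrib flip: sum_distrib_left) (simp add: algebra_simps)
  qed
  have "chart_extension \<phi> U W (\<lambda>q. inverse (Df q) * (Y q \<eta> - \<eta> q * ?S q)) x =
      (\<Sum>i\<in>UNIV. chart_extension \<phi> U W (\<lambda>q. cv i q (\<lambda>q. ?\<omega> q * Y q (\<xi> i))) x)" for x
  proof (cases "x \<in> \<phi> ` W")
    case True
    then obtain q where q: "q \<in> W" "x = \<phi> q" by auto
    show ?thesis unfolding q(2) chart_extension_eq[OF c W q(1)] by (rule pt[OF q(1), symmetric])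
  qed (simp add: chart_extension_def)
  then show ?thesis by (simp only: Bochner_Integration.integral_sum[OF I(1)] I(2) sum.neutral_const)
qed

end

text \<open>The Gram matrix of the coordinate vectors is \<open>B q ** transpose (B q)\<close>, and
  \<open>B q\<close> is inverse to \<open>A q\<close>.\<close>

lemma gram_density:
  assumes q: "q \<in> W"
  shows "sqrt (det (\<chi> i j. gR q (cv i q) (cv j q))) = \<bar>inverse (Df q)\<bar>"
proof -
  have "gR q (cv i q) (cv j q) = (\<Sum>a\<in>UNIV. B q $ i $ a * B q $ j $ a)" for i j
  proof -
    have "gR q (cv i q) (cv j q) = gR q (\<Sum>a\<in>UNIV. gR q (cv i q) (E a q) *\<^sub>R E a q) (cv j q)"
      using full_frame_expansion[OF X r on[OF q] coord_vector_tangent_at[OF q, of i]] by simp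
    also have "\<dots> = (\<Sum>a\<in>UNIV. gR q (gR q (cv i q) (E a q) *\<^sub>R E a q) (cv j q))"
      by (rule ip_sum_left[OF gR_ip])
        (simp_all add: subspace_scale[OF subspace_tangent_space] coord_vector_tangent_at[OF q] vector_field_tangent[OF adapted_frame_vector_field])
    also have "\<dots> = (\<Sum>a\<in>UNIV. B q $ i $ a * B q $ j $ a)"
      by (simp add: ip_scale_left[OF gR_ip] coord_vector_tangent_at[OF q] vector_field_tangent[OF adapted_frame_vector_field] coord_frame_def
          ip_sym[OF gR_ip vector_field_tangent[OF adapted_frame_vector_field] coord_vector_tangent_at[OF q]])
    finally show ?thesis .
  qed
  then have "(\<chi> i j. gR q (cv i q) (cv j q)) = B q ** transpose (B q)"
    by (simp add: matrix_matrix_mult_def transpose_def vec_eq_iff)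
  then have "det (\<chi> i j. gR q (cv i q) (cv j q)) = (det (B q))\<^sup>2"
    by (simp add: det_mul det_transpose power2_eq_square)
  moreover have "det (B q) = inverse (Df q)"
    using det_frame_coords(1)[OF X r c W \<xi> on q] by (metis inverse_unique mult.commute)
  ultimately show ?thesis by simp
qed

text \<open>On \<open>W\<close> the measure is the image of a Lebesgue density under the inverse
  chart. This equality of measures is checked on Borel sets, which is where the definition speaks,
  and integrals are then transported.\<close>

lemma riemannian_measure_integral:
  assumes \<mu>: "riemannian_measure \<mu>" and f: "f \<in> borel_measurable borel" "\<And>q. q \<notin> W \<Longrightarrow> f q = 0"
  shows "(\<integral>q. f q \<partial>\<mu>) = (\<integral>x. chart_extension \<phi> U W (\<lambda>q. \<bar>inverse (Df q)\<bar> * f q) x \<partial>lborel)"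
proof -
  let ?O = "\<phi> ` W"
  define k where "k = chart_extension \<phi> U W (\<lambda>q. \<bar>inverse (Df q)\<bar>)"
  \<comment> \<open>The value \<open>p\<close> outside the chart image is a dummy: the density
    \<open>k\<close> is zero there.\<close>
  define \<psi> where "\<psi> x = (if x \<in> ?O then inv_into U \<phi> x else p)" for x
  have O': "open ?O" "?O \<in> sets borel" using chart_image_open_subset[OF c W] by auto
  have sets\<mu>: "sets \<mu> = sets borel" using \<mu> by (simp add: riemannian_measure_def)
  have m\<mu>: "borel_measurable \<mu> = borel_measurable borel"
    by (rule measurable_cong_sets[OF sets\<mu> refl])
  have cinv: "continuous_on ?O (inv_into U \<phi>)"
    using chart_inv_continuous_on[OF c] W(2) continuous_on_subset by blast
  have \<psi>m: "\<psi> \<in> measurable borel borel"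
    unfolding \<psi>_def by (rule borel_measurable_continuous_on_if[OF O'(2) cinv continuous_on_const])
  have kcont: "continuous_on ?O (\<lambda>x. \<bar>inverse (Df (inv_into U \<phi> x))\<bar>)"
  proof (intro continuous_on_rabs continuous_on_compose2[OF _ cinv])
    show "continuous_on W (\<lambda>q. inverse (Df q))"
      by (rule smooth_fun_on_continuous_on[OF W(1) smooth_fun_on_inverse[OF W(1)]])
        (simp_all add: smooth_funs_imp_smooth_fun_on[OF det_frame_coords_smooth] det_frame_coords_nonzero)
    show "inv_into U \<phi> ` ?O \<subseteq> W" using c W by auto
  qed
  have km: "k \<in> borel_measurable borel"
    unfolding k_def chart_extension_def[abs_def]
    by (rule borel_measurable_continuous_on_if[OF O'(2) kcont continuous_on_const])
  have k0: "0 \<le> k x" for x by (simp add: k_def chart_extension_def)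
  have eq: "distr (density lborel (\<lambda>x. ennreal (k x))) \<mu> \<psi> = density \<mu> (indicator W)"
  proof (rule measure_eqI)
    fix S assume "S \<in> sets (distr (density lborel (\<lambda>x. ennreal (k x))) \<mu> \<psi>)"
    then have S: "S \<in> sets borel" "S \<in> sets \<mu>" by (simp_all add: sets\<mu>)
    have Wm: "W \<in> sets \<mu>" using W by (simp add: sets\<mu>)
    have \<psi>m': "\<psi> \<in> measurable (density lborel (\<lambda>x. ennreal (k x))) \<mu>"
      using \<psi>m measurable_cong_sets[OF _ sets\<mu>, of "density lborel (\<lambda>x. ennreal (k x))" borel] by simp
    have pre: "\<psi> -` S \<in> sets borel" using measurable_sets[OF \<psi>m S(1)] by simp
    have "emeasure (distr (density lborel (\<lambda>x. ennreal (k x))) \<mu> \<psi>) S =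
        emeasure (density lborel (\<lambda>x. ennreal (k x))) (\<psi> -` S)"
      using emeasure_distr[OF \<psi>m' S(2)] by simp
    also have "\<dots> = (\<integral>\<^sup>+x. ennreal (k x) * indicator (\<psi> -` S) x \<partial>lborel)"
      by (rule emeasure_density) (use km pre in simp_all)
    also have "\<dots> = (\<integral>\<^sup>+x\<in>\<phi> ` (S \<inter> W). ennreal (sqrt (det (\<chi> i j.
             gR (inv_into U \<phi> x) (coord_vector U \<phi> i (inv_into U \<phi> x))
                                 (coord_vector U \<phi> j (inv_into U \<phi> x))))) \<partial>lborel)"
    proof (rule nn_integral_cong)
      fix x
      show "ennreal (k x) * indicator (\<psi> -` S) x = ennreal (sqrt (det (\<chi> i j.
             gR (inv_into U \<phi> x) (coord_vector U \<phi> i (inv_into U \<phi> x))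
                                 (coord_vector U \<phi> j (inv_into U \<phi> x))))) * indicator (\<phi> ` (S \<inter> W)) x"
      proof (cases "x \<in> ?O")
        case True
        then obtain q where q: "q \<in> W" "x = \<phi> q" by auto
        have qU: "q \<in> U" using q W by auto
        have iq: "inv_into U \<phi> x = q" using q qU c by simp
        have "x \<in> \<phi> ` (S \<inter> W) \<longleftrightarrow> q \<in> S"
          using q W inj_on_image_mem_iff[OF chart_inj[OF c] qU, of "S \<inter> W"] by auto
        moreover have "\<psi> x = q" using True iq by (simp add: \<psi>_def)
        moreover have "k x = \<bar>inverse (Df q)\<bar>" using True iq by (simp add: k_def chart_extension_def)
        ultimately show ?thesis unfolding iq gram_density[OF q(1)] by (simp add: indicator_def)
      next
        case False
        then have "x \<notin> \<phi> ` (S \<inter> W)" by auto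
        with False show ?thesis by (simp add: k_def chart_extension_def)
      qed
    qed
    also have "\<dots> = emeasure \<mu> (S \<inter> W)"
    proof -
      have "S \<inter> W \<in> sets borel" "S \<inter> W \<subseteq> U" using S W by auto
      then show ?thesis using \<mu> c unfolding riemannian_measure_def by fastforce
    qed
    also have "\<dots> = emeasure (density \<mu> (indicator W)) S"
      using S Wm by (simp add: emeasure_density indicator_inter_arith[symmetric] Int_commute)
    finally show "emeasure (distr (density lborel (\<lambda>x. ennreal (k x))) \<mu> \<psi>) S = emeasure (density \<mu> (indicator W)) S" .
  qed simp
  have f\<mu>: "f \<in> borel_measurable \<mu>" using f(1) by (simp add: m\<mu>)
  have "(\<integral>q. f q \<partial>\<mu>) = (\<integral>q. indicator W q *\<^sub>R f q \<partial>\<mu>)"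
    using f(2) by (intro Bochner_Integration.integral_cong) (auto simp: indicator_def)
  also have "\<dots> = (\<integral>q. f q \<partial>density \<mu> (\<lambda>q. ennreal (indicator W q)))"
    by (rule integral_density[symmetric]) (use f\<mu> W(1) in \<open>simp_all add: borel_measurable_indicator sets\<mu>\<close>)
  also have "\<dots> = (\<integral>q. f q \<partial>distr (density lborel (\<lambda>x. ennreal (k x))) \<mu> \<psi>)"
    by (simp add: eq ennreal_indicator)
  also have "\<dots> = (\<integral>x. f (\<psi> x) \<partial>density lborel (\<lambda>x. ennreal (k x)))"
    by (rule integral_distr)
      (use \<psi>m f\<mu> measurable_cong_sets[OF _ sets\<mu>, of "density lborel (\<lambda>x. ennreal (k x))" borel] in simp_all)
  also have "\<dots> = (\<integral>x. k x *\<^sub>R f (\<psi> x) \<partial>lborel)"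
    by (rule integral_density) (use km k0 measurable_compose[OF \<psi>m f(1)] in simp_all)
  also have "\<dots> = (\<integral>x. chart_extension \<phi> U W (\<lambda>q. \<bar>inverse (Df q)\<bar> * f q) x \<partial>lborel)"
    by (rule Bochner_Integration.integral_cong) (auto simp: k_def \<psi>_def chart_extension_def)
  finally show ?thesis .
qed

end

end

section \<open>The sub-Laplacian as a divergence\<close>

context transverse_symmetries
begin

lemma sub_laplacian_smooth: "sub_laplacian \<mu> L \<Longrightarrow> f \<in> smooth_funs \<Longrightarrow> L f \<in> smooth_funs"
  by (simp add: sub_laplacian_def)

lemma sub_laplacian_mult:
  "sub_laplacian \<mu> L \<Longrightarrow> f1 \<in> smooth_funs \<Longrightarrow> f2 \<in> smooth_funs \<Longrightarrow>
    L (\<lambda>q. f1 q * f2 q) p = f1 p * L f2 p + f2 p * L f1 p + 2 * Gam f1 f2 p"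
proof -
  assume a: "sub_laplacian \<mu> L" "f1 \<in> smooth_funs" "f2 \<in> smooth_funs"
  then have "(L (\<lambda>q. f1 q * f2 q) p - f1 p * L f2 p - f2 p * L f1 p) / 2 = Gam f1 f2 p"
    by (simp add: sub_laplacian_def)
  then show ?thesis by (simp add: field_simps)
qed

lemma sub_laplacian_symmetric:
  "sub_laplacian \<mu> L \<Longrightarrow> f1 \<in> smooth_funs \<Longrightarrow> f2 \<in> smooth_funs \<Longrightarrow> compact_support f1 \<Longrightarrow> compact_support f2
    \<Longrightarrow> (\<integral>p. f1 p * L f2 p \<partial>\<mu>) = (\<integral>p. f2 p * L f1 p \<partial>\<mu>)"
  unfolding sub_laplacian_def by blast

lemma compact_closure_subset:
  assumes "compact (closure S)" "T \<subseteq> S" shows "compact (closure (T :: 'a set))"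
  using compact_Int_closed[OF assms(1) closed_closure[of T]] closure_mono[OF assms(2)]
  by (simp add: Int_absorb1)

text \<open>Testing the symmetry of \<open>L\<close> with \<open>w\<close> and \<open>w v\<close>, for a bump function \<open>w\<close>, gives
  \<open>\<integral> w\<^sup>2 L v + \<Gamma>(w\<^sup>2, v) = 0\<close>, and the divergence theorem gives the same identity for the
  right-hand side below.\<close>

theorem sub_laplacian_eq_divergence:
  assumes \<mu>: "riemannian_measure \<mu>" and L: "sub_laplacian \<mu> L" and v: "v \<in> smooth_funs"
    and X: "horizontal_frame p X"
  shows "L v p = - (\<Sum>i<d. gR p (lie_bracket (gradH v) (X i) p) (X i p))"
proof -
  obtain r :: "'n \<Rightarrow> nat" where r: "bij_betw r UNIV {..<CARD('n)}" by (rule index_bijection)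
  obtain U \<phi> \<xi> W0 where c: "(U, \<phi>) \<in> atlas" and W0: "open W0" "p \<in> W0" "W0 \<subseteq> U"
    and \<xi>: "\<And>j. \<xi> j \<in> smooth_funs" and \<xi>0: "\<And>q j. q \<in> W0 \<Longrightarrow> \<phi> q $ j = \<xi> j q"
    and on0: "\<And>q. q \<in> W0 \<Longrightarrow> orthonormal_family (H q) (g q) d (\<lambda>i. X i q)"
    by (rule adapted_coordinates[OF X]) (rule that)
  define E where "E = full_frame X r"
  define Df where "Df q = det (frame_coords X r \<xi> q)" for q
  define s where "s = sgn (Df p)"
  have D0: "Df p \<noteq> 0" unfolding Df_def by (rule det_frame_coords_nonzero[OF X r c W0(1,3) \<xi> \<xi>0 on0 W0(2)])
  have Ds: "Df \<in> smooth_funs" unfolding Df_def[abs_def] by (rule det_frame_coords_smooth[OF X r c W0(1,3) \<xi> \<xi>0 on0])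
  \<comment> \<open>\<open>Df\<close> has constant sign on this smaller set, so integrals against
    the measure and signed chart integrals differ only by the constant factor
    \<open>s\<close>.\<close>
  define W where "W = W0 \<inter> {q. 0 < s * Df q}"
  have "open {q. 0 < s * Df q}"
    by (intro open_Collect_less continuous_intros smooth_funs_continuous[OF Ds])
  then have W: "open W" "W \<subseteq> U" "p \<in> W"
    using W0 D0 by (auto simp: W_def s_def sgn_if)
  have \<xi>W: "\<phi> q $ j = \<xi> j q" if "q \<in> W" for q j using that \<xi>0 by (simp add: W_def)
  have on: "orthonormal_family (H q) (g q) d (\<lambda>i. X i q)" if "q \<in> W" for q using that on0 by (simp add: W_def)
  note ctx = X r c W(1,2) \<xi> \<xi>W on
  have absD: "\<bar>inverse (Df q)\<bar> = s * inverse (Df q)" if "q \<in> W" for q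
    using that D0 by (auto simp: W_def s_def sgn_if abs_if split: if_splits)
  define Y where "Y = gradH v"
  have YH: "Y \<in> horizontal_fields H" unfolding Y_def by (rule gradH_horizontal[OF v])
  have Y: "Y \<in> vector_fields" by (rule horizontal_vector_field[OF YH])
  have Evf: "E a \<in> vector_fields" for a unfolding E_def by (rule full_frame_vector_field[OF X r])
  define S where "S q = (\<Sum>a\<in>UNIV. gR q (lie_bracket Y (E a) q) (E a q))" for q
  have Ssm: "S \<in> smooth_funs"
    unfolding S_def[abs_def] by (intro smooth_funs_sum gR_smooth lie_bracket_vector_field Y Evf)
  \<comment> \<open>The defect of the claimed formula, still with the sum over the full frame; the
    vertical summands are removed at the end.\<close>
  define G where "G q = L v q + S q" for q
  have Gsm: "G \<in> smooth_funs" unfolding G_def[abs_def] by (intro smooth_funs_add sub_laplacian_smooth[OF L v] Ssm)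
  have "G p = 0"
  proof (rule ccontr)
    assume G0: "G p \<noteq> 0"
    define t where "t = sgn (G p)"
    \<comment> \<open>On \<open>W'\<close> the defect has the sign \<open>t\<close>. A test function
      supported there makes the integrand one-signed, so a zero integral forces it to vanish at
      \<open>p\<close>.\<close>
    define W' where "W' = W \<inter> {q. 0 < t * G q}"
    have "open {q. 0 < t * G q}"
      by (intro open_Collect_less continuous_intros smooth_funs_continuous[OF Gsm])
    then have W': "open W'" "p \<in> W'" using W G0 by (auto simp: W'_def t_def sgn_if)
    obtain w N where w: "w \<in> smooth_funs" "open N" "p \<in> N" "N \<subseteq> W'" "\<And>q. q \<in> N \<Longrightarrow> w q = 1"
      "\<And>q. 0 \<le> w q" "compact (closure {q. w q \<noteq> 0})" "closure {q. w q \<noteq> 0} \<subseteq> W'"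
      by (rule bump_function[OF W']) (rule that)
    have wW: "closure {q. w q \<noteq> 0} \<subseteq> W" using w(8) by (auto simp: W'_def)
    have w0: "w q = 0" if "q \<notin> W'" for q using that w(8) closure_subset[of "{q. w q \<noteq> 0}"] by blast
    have w0W: "w q = 0" if "q \<notin> W" for q using that w0[of q] by (simp add: W'_def)
    let ?ext = "chart_extension \<phi> U W"
    let ?J = "\<lambda>h. \<integral>x. ?ext (\<lambda>q. (w q * inverse (Df q)) * h q) x \<partial>lborel"
    have ws1: "(\<lambda>q. (w q * inverse (Df q)) * h q) \<in> smooth_funs" if "h \<in> smooth_funs" for h
      unfolding Df_def by (rule weight_support(1)[OF ctx w(1,7) wW that])
    have ws2: "compact (closure {q. (w q * inverse (Df q)) * h q \<noteq> 0})" if "h \<in> smooth_funs" for h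
      unfolding Df_def by (rule weight_support(2)[OF ctx w(1,7) wW that])
    have ws3: "closure {q. (w q * inverse (Df q)) * h q \<noteq> 0} \<subseteq> W" if "h \<in> smooth_funs" for h
      unfolding Df_def by (rule weight_support(3)[OF ctx w(1,7) wW that])
    have int: "integrable lborel (?ext (\<lambda>q. (w q * inverse (Df q)) * h q))" if "h \<in> smooth_funs" for h
      by (rule chart_extension_integrable[OF c W(1,2) ws1[OF that] ws2[OF that] ws3[OF that]])
    have rep: "(\<integral>q. w q * h q \<partial>\<mu>) = s * ?J h" if h: "h \<in> smooth_funs" for h
    proof -
      have "(\<lambda>q. w q * h q) \<in> borel_measurable borel"
        by (intro borel_measurable_continuous_onI smooth_funs_continuous smooth_funs_mult w(1) h)
      then have "(\<integral>q. w q * h q \<partial>\<mu>) = (\<integral>x. ?ext (\<lambda>q. \<bar>inverse (Df q)\<bar> * (w q * h q)) x \<partial>lborel)"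
        unfolding Df_def by (intro riemannian_measure_integral[OF ctx \<mu>]) (simp_all add: w0W)
      also have "\<dots> = (\<integral>x. s * ?ext (\<lambda>q. (w q * inverse (Df q)) * h q) x \<partial>lborel)"
      proof (rule Bochner_Integration.integral_cong[OF refl])
        fix x show "?ext (\<lambda>q. \<bar>inverse (Df q)\<bar> * (w q * h q)) x = s * ?ext (\<lambda>q. (w q * inverse (Df q)) * h q) x"
        proof (cases "x \<in> \<phi> ` W")
          case True
          then obtain q where q: "q \<in> W" "x = \<phi> q" by auto
          show ?thesis unfolding q(2) chart_extension_eq[OF c W(1,2) q(1)] absD[OF q(1)] by simp
        qed (simp add: chart_extension_def)
      qed
      finally show ?thesis by simp
    qed
    have wv: "(\<lambda>q. w q * v q) \<in> smooth_funs" by (rule smooth_funs_mult[OF w(1) v])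
    have "compact_support w" using w(7) by (simp add: compact_support_def)
    moreover have "compact_support (\<lambda>q. w q * v q)"
      unfolding compact_support_def by (rule compact_closure_subset[OF w(7)]) auto
    ultimately have "(\<integral>q. w q * L (\<lambda>q. w q * v q) q \<partial>\<mu>) = (\<integral>q. w q * (v q * L w q) \<partial>\<mu>)"
      using sub_laplacian_symmetric[OF L w(1) wv] by (simp add: mult.assoc)
    moreover have Lwv: "L (\<lambda>q. w q * v q) \<in> smooth_funs" "(\<lambda>q. v q * L w q) \<in> smooth_funs"
      by (intro smooth_funs_mult sub_laplacian_smooth[OF L] wv v w(1))+
    ultimately have "s * ?J (L (\<lambda>q. w q * v q)) = s * ?J (\<lambda>q. v q * L w q)"
      by (simp only: rep)
    then have J1: "?J (L (\<lambda>q. w q * v q)) - ?J (\<lambda>q. v q * L w q) = 0"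
      using D0 by (simp add: s_def sgn_if split: if_splits)
    have ww: "(\<lambda>q. w q * w q) \<in> smooth_funs" by (rule smooth_funs_mult[OF w(1) w(1)])
    have ww_supp: "{q. w q * w q \<noteq> 0} = {q. w q \<noteq> 0}" by auto
    have J2: "(\<integral>x. ?ext (\<lambda>q. inverse (Df q) * (Y q (\<lambda>q. w q * w q) - w q * w q * S q)) x \<partial>lborel) = 0"
      unfolding Df_def S_def E_def
      by (rule divergence_theorem_signed[OF ctx ww _ _ Y]) (simp_all add: ww_supp w(7) wW)
    let ?h1 = "L (\<lambda>q. w q * v q)" and ?h2 = "\<lambda>q. v q * L w q" and ?h3 = "\<lambda>q. 2 * Y q w - w q * S q"
    have h3: "?h3 \<in> smooth_funs"
      by (intro smooth_funs_diff smooth_funs_mult smooth_funs_const vector_field_smooth[OF Y w(1)] w(1) Ssm)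
    have eqh: "inverse (Df q) * (Y q (\<lambda>q. w q * w q) - w q * w q * S q) = (w q * inverse (Df q)) * ?h3 q" for q
      by (simp add: tangent_mult[OF vector_field_tangent[OF Y] w(1) w(1)] algebra_simps)
    from J2 have J3: "?J ?h3 = 0" by (simp only: eqh)
    \<comment> \<open>The term \<open>2 * Gam w v q\<close> from the product rule for
      \<open>L\<close> and the term \<open>2 * Y q w\<close> from the divergence theorem cancel,
      which leaves \<open>w\<close> times the defect.\<close>
    have Geq: "?h1 q - ?h2 q - ?h3 q = w q * G q" for q
    proof -
      have "Gam w v q = Y q w"
        unfolding Y_def Gam_eq[of v w q, symmetric] Gam_eq_g by (rule ip_sym[OF g_ip gradH_mem gradH_mem])
      then show ?thesis
        unfolding sub_laplacian_mult[OF L w(1) v] G_def by (simp add: algebra_simps)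
    qed
    let ?F = "\<lambda>q. (w q * inverse (Df q)) * (w q * G q)"
    have wG: "(\<lambda>q. w q * G q) \<in> smooth_funs" by (rule smooth_funs_mult[OF w(1) Gsm])
    have "?ext ?F x = ?ext (\<lambda>q. (w q * inverse (Df q)) * ?h1 q) x
        - ?ext (\<lambda>q. (w q * inverse (Df q)) * ?h2 q) x - ?ext (\<lambda>q. (w q * inverse (Df q)) * ?h3 q) x" for x
      unfolding chart_extension_def Geq[symmetric] by (simp add: algebra_simps)
    then have F0: "(\<integral>x. ?ext ?F x \<partial>lborel) = 0"
      using J1 J3 by (simp add: int[OF Lwv(1)] int[OF Lwv(2)] int[OF h3])
    have pos: "0 \<le> (t * s) * ?ext ?F x" for x
    proof (cases "x \<in> \<phi> ` W")
      case True
      then obtain q where q: "q \<in> W" "x = \<phi> q" by auto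
      have "0 \<le> (w q * w q) * (\<bar>inverse (Df q)\<bar> * (t * G q))"
        using w0[of q] by (cases "q \<in> W'") (auto simp: W'_def)
      also have "\<dots> = (t * s) * ?ext ?F x"
        unfolding q(2) chart_extension_eq[OF c W(1,2) q(1)] absD[OF q(1)] by simp
      finally show ?thesis .
    qed (simp add: chart_extension_def)
    have "(t * s) * ?ext ?F (\<phi> p) = 0"
    proof (rule continuous_integral_zero_imp_zero[where f = "\<lambda>x. (t * s) * ?ext ?F x"])
      show "continuous_on UNIV (\<lambda>x. (t * s) * ?ext ?F x)"
        by (intro continuous_on_mult_left Cinf_on_continuous[OF open_UNIV] chart_extension_Cinf[OF c W(1,2) ws1[OF wG] ws2[OF wG] ws3[OF wG]])
      show "integrable lborel (\<lambda>x. (t * s) * ?ext ?F x)" using int[OF wG] by simp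
      show "(\<integral>x. (t * s) * ?ext ?F x \<partial>lborel) = 0" using F0 by simp
    qed (rule pos)
    moreover have "?ext ?F (\<phi> p) = inverse (Df p) * G p"
      unfolding chart_extension_eq[OF c W(1,2) W(3)] using w(3,5) by simp
    ultimately show False using G0 D0 by (simp add: t_def s_def sgn_if split: if_splits)
  qed
  moreover have "S p = (\<Sum>i<d. gR p (lie_bracket Y (X i) p) (X i p))"
  proof -
    \<comment> \<open>A Killing field brackets a horizontal field to a horizontal one, which is
      orthogonal to every vertical vector.\<close>
    have "gR p (lie_bracket Y (vframe m) p) (vframe m p) = 0" if "m < dim V" for m
      using that by (intro gR_HV horizontal_mem[OF horizontal_killing_bracket[OF YH]] vert_space_mem vframe_V)
    then show ?thesis
      unfolding S_def E_def full_frame_sum[OF X r, of "\<lambda>Z. gR p (lie_bracket Y Z p) (Z p)"] by simp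
  qed
  ultimately show ?thesis by (simp add: G_def Y_def)
qed

end

subsection \<open>The canonical connection\<close>

context smooth_manifold
begin

lemma lie_bracket_add_right:
  assumes "X \<in> vector_fields" "Y \<in> vector_fields" "W \<in> vector_fields"
  shows "lie_bracket X (Y + W) = lie_bracket X Y + lie_bracket X W"
proof (rule vector_field_eqI)
  show "lie_bracket X (Y + W) \<in> vector_fields" "lie_bracket X Y + lie_bracket X W \<in> vector_fields"
    by (intro lie_bracket_vector_field vector_fields_add assms)+
  fix p f assume f: "f \<in> smooth_funs"
  show "lie_bracket X (Y + W) p f = (lie_bracket X Y + lie_bracket X W) p f"
    using tangent_add[OF vector_field_tangent[OF assms(1)] vector_field_smooth[OF assms(2) f] vector_field_smooth[OF assms(3) f], of p]
    by (simp add: lie_bracket_def)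
qed

lemma lie_bracket_add_left:
  assumes "X \<in> vector_fields" "Y \<in> vector_fields" "W \<in> vector_fields"
  shows "lie_bracket (X + Y) W = lie_bracket X W + lie_bracket Y W"
  using lie_bracket_add_right[OF assms(3,1,2)]
  by (simp add: lie_bracket_antisym[of _ W])

lemma lie_bracket_scale_left:
  assumes "X \<in> vector_fields" "Y \<in> vector_fields" "f \<in> smooth_funs"
  shows "lie_bracket (\<lambda>p. f p *\<^sub>R X p) Y = (\<lambda>p. f p *\<^sub>R lie_bracket X Y p - Y p f *\<^sub>R X p)"
  using lie_bracket_scale_right[OF assms(2,1,3)]
  by (simp add: lie_bracket_antisym[of _ Y] fun_eq_iff)

lemma lie_bracket_zero_right: "X \<in> vector_fields \<Longrightarrow> lie_bracket X 0 = 0"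
  by (auto simp: lie_bracket_def fun_eq_iff tangent_const[OF vector_field_tangent])

end

section \<open>Tensoriality: dependence on the value at one point\<close>

context transverse_symmetries
begin

text \<open>A field that vanishes at \<open>p\<close> splits into frame components, whose
  coefficients vanish at \<open>p\<close>, and a remainder \<open>C\<close> that vanishes near
  \<open>p\<close>. Function-linearity kills the first part, and also the second, since
  \<open>C\<close> equals \<open>(1 - \<eta>)\<close> times \<open>C\<close> for a suitable bump
  function \<open>\<eta>\<close>.\<close>

lemma tensorial_zero:
  fixes \<Phi> :: "'a vfield \<Rightarrow> real"
  assumes add: "\<And>A B. A \<in> vector_fields \<Longrightarrow> B \<in> vector_fields \<Longrightarrow> \<Phi> (A + B) = \<Phi> A + \<Phi> B"
    and scale: "\<And>f A. f \<in> smooth_funs \<Longrightarrow> A \<in> vector_fields \<Longrightarrow> \<Phi> (\<lambda>q. f q *\<^sub>R A q) = f p * \<Phi> A"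
    and A: "A \<in> vector_fields" "A p = 0"
  shows "\<Phi> A = 0"
proof -
  have zero: "\<Phi> 0 = 0" using scale[OF smooth_funs_const[of 0] vector_fields_zero] by (simp add: zero_fun_def)
  have sum: "\<Phi> (\<Sum>i\<in>I. B i) = (\<Sum>i\<in>I. \<Phi> (B i))" if "\<And>i. i \<in> I \<Longrightarrow> B i \<in> vector_fields"
    for I :: "'n set" and B
    using that by (induction I rule: infinite_finite_induct) (simp_all add: zero add vector_fields_sum)
  obtain X where X: "horizontal_frame p X" using horizontal_frame_exists by blast
  obtain r :: "'n \<Rightarrow> nat" where r: "bij_betw r UNIV {..<CARD('n)}" by (rule index_bijection)
  obtain N where N: "open N" "p \<in> N" "\<And>q. q \<in> N \<Longrightarrow> orthonormal_family (H q) (g q) d (\<lambda>i. X i q)"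
    by (rule horizontal_frame_orthonormal[OF X]) (rule that)
  define E where "E = full_frame X r"
  have E: "E a \<in> vector_fields" for a unfolding E_def by (rule full_frame_vector_field[OF X r])
  define B where "B a = (\<lambda>q. gR q (A q) (E a q) *\<^sub>R E a q)" for a
  have B: "B a \<in> vector_fields" for a unfolding B_def by (intro vector_fields_mult gR_smooth A E)
  have "\<Phi> (B a) = 0" for a
    using scale[OF gR_smooth[OF A(1) E[of a]] E[of a]] A(2) ip_zero_left[OF gR_ip vector_field_tangent[OF E]]
    by (simp add: B_def)
  then have \<Phi>B: "\<Phi> (\<Sum>a\<in>UNIV. B a) = 0" by (simp add: sum B)
  define C where "C = A - (\<Sum>a\<in>UNIV. B a)"
  have C: "C \<in> vector_fields" unfolding C_def by (intro vector_fields_diff vector_fields_sum A B)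
  have C0: "C q = 0" if "q \<in> N" for q
    using full_frame_expansion[OF X r N(3)[OF that] vector_field_tangent[OF A(1)]]
    by (simp add: C_def B_def E_def sum_fun_app)
  obtain \<eta> M where \<eta>: "\<eta> \<in> smooth_funs" "open M" "p \<in> M" "M \<subseteq> N" "\<And>q. q \<in> M \<Longrightarrow> \<eta> q = 1"
    "\<And>q. 0 \<le> \<eta> q" "compact (closure {q. \<eta> q \<noteq> 0})" "closure {q. \<eta> q \<noteq> 0} \<subseteq> N"
    by (rule bump_function[OF N(1,2)]) (rule that)
  have "C = (\<lambda>q. (1 - \<eta> q) *\<^sub>R C q)"
  proof
    fix q show "C q = (1 - \<eta> q) *\<^sub>R C q"
      using C0[of q] \<eta>(8) closure_subset[of "{q. \<eta> q \<noteq> 0}"] by (cases "\<eta> q = 0") auto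
  qed
  then have "\<Phi> C = \<Phi> (\<lambda>q. (1 - \<eta> q) *\<^sub>R C q)" by (rule arg_cong)
  also have "\<dots> = 0"
    using scale[OF smooth_funs_diff[OF smooth_funs_const[of 1] \<eta>(1)] C] \<eta>(3,5) by simp
  finally have "\<Phi> C = 0" .
  moreover have "A = C + (\<Sum>a\<in>UNIV. B a)" by (simp add: C_def)
  moreover have "\<Phi> (C + (\<Sum>a\<in>UNIV. B a)) = \<Phi> C + \<Phi> (\<Sum>a\<in>UNIV. B a)"
    by (rule add[OF C vector_fields_sum]) (rule B)
  ultimately show ?thesis using \<Phi>B by (simp only: add_0)
qed

text \<open>The difference from a combination with constant coefficients vanishes at
  \<open>p\<close>. In this way curvature, covariant torsion and \<open>D\<close> are expanded from
  an equation between vectors at a single point.\<close>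

lemma tensorial_sum:
  fixes \<Phi> :: "'a vfield \<Rightarrow> real"
  assumes add: "\<And>A B. A \<in> vector_fields \<Longrightarrow> B \<in> vector_fields \<Longrightarrow> \<Phi> (A + B) = \<Phi> A + \<Phi> B"
    and scale: "\<And>f A. f \<in> smooth_funs \<Longrightarrow> A \<in> vector_fields \<Longrightarrow> \<Phi> (\<lambda>q. f q *\<^sub>R A q) = f p * \<Phi> A"
    and A: "A \<in> vector_fields" and B: "\<And>i. i \<in> I \<Longrightarrow> B i \<in> vector_fields"
    and eq: "A p = (\<Sum>i\<in>I. c i *\<^sub>R B i p)"
  shows "\<Phi> A = (\<Sum>i\<in>I. c i * \<Phi> (B i))"
proof -
  have cB: "(\<lambda>q. c i *\<^sub>R B i q) \<in> vector_fields" if "i \<in> I" for i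
    by (intro vector_fields_mult smooth_funs_const B that)
  have zero: "\<Phi> 0 = 0" using scale[OF smooth_funs_const[of 0] vector_fields_zero] by (simp add: zero_fun_def)
  have "\<Phi> (\<Sum>i\<in>J. (\<lambda>q. c i *\<^sub>R B i q)) = (\<Sum>i\<in>J. c i * \<Phi> (B i))" if "J \<subseteq> I" for J
    using that
    by (induction J rule: infinite_finite_induct)
      (simp_all add: zero add vector_fields_sum cB subset_iff scale[OF smooth_funs_const] B)
  then have S: "\<Phi> (\<Sum>i\<in>I. (\<lambda>q. c i *\<^sub>R B i q)) = (\<Sum>i\<in>I. c i * \<Phi> (B i))" by simp
  define C where "C = A - (\<Sum>i\<in>I. (\<lambda>q. c i *\<^sub>R B i q))"
  have C: "C \<in> vector_fields" unfolding C_def by (intro vector_fields_diff vector_fields_sum A cB)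
  have C0: "C p = 0" by (simp add: C_def eq sum_fun_app)
  have "\<Phi> C = 0" by (rule tensorial_zero[where \<Phi> = \<Phi>, OF add scale C C0])
  moreover have "A = C + (\<Sum>i\<in>I. (\<lambda>q. c i *\<^sub>R B i q))" by (simp add: C_def)
  moreover have "\<Phi> (C + (\<Sum>i\<in>I. (\<lambda>q. c i *\<^sub>R B i q))) = \<Phi> C + \<Phi> (\<Sum>i\<in>I. (\<lambda>q. c i *\<^sub>R B i q))"
    by (rule add[OF C vector_fields_sum]) (rule cB)
  ultimately show ?thesis using S by (simp only: add_0)
qed

end

section \<open>Calculus of the canonical connection\<close>

locale canonical_geometry = transverse_symmetries atlas d H g V vip
  for atlas :: "('a::{t2_space, second_countable_topology} set \<times> ('a \<Rightarrow> real ^ 'n::finite)) set"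
    and d H g V vip +
  fixes D :: "'a vfield \<Rightarrow> 'a vfield \<Rightarrow> 'a vfield"
  assumes canonical: "canonical_connection D"
begin

lemma D_affine: "affine_connection D" using canonical by (simp add: canonical_connection_def)

lemma D_vector_field: "X \<in> vector_fields \<Longrightarrow> Y \<in> vector_fields \<Longrightarrow> D X Y \<in> vector_fields"
  and D_add_left: "X \<in> vector_fields \<Longrightarrow> Y \<in> vector_fields \<Longrightarrow> W \<in> vector_fields \<Longrightarrow> D (X + Y) W = D X W + D Y W"
  and D_add_right: "X \<in> vector_fields \<Longrightarrow> Y \<in> vector_fields \<Longrightarrow> W \<in> vector_fields \<Longrightarrow> D X (Y + W) = D X Y + D X W"
  and D_scale_left: "f \<in> smooth_funs \<Longrightarrow> X \<in> vector_fields \<Longrightarrow> Y \<in> vector_fields \<Longrightarrow>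
    D (\<lambda>p. f p *\<^sub>R X p) Y = (\<lambda>p. f p *\<^sub>R D X Y p)"
  and D_scale_right: "f \<in> smooth_funs \<Longrightarrow> X \<in> vector_fields \<Longrightarrow> Y \<in> vector_fields \<Longrightarrow>
    D X (\<lambda>p. f p *\<^sub>R Y p) = (\<lambda>p. X p f *\<^sub>R Y p + f p *\<^sub>R D X Y p)"
  using D_affine unfolding affine_connection_def by blast+

lemma D_metric: "X \<in> vector_fields \<Longrightarrow> Y \<in> horizontal_fields H \<Longrightarrow> W \<in> horizontal_fields H \<Longrightarrow>
    X p (\<lambda>q. g q (Y q) (W q)) = g p (D X Y p) (W p) + g p (Y p) (D X W p)"
  and D_horizontal_horizontal: "X \<in> horizontal_fields H \<Longrightarrow> Y \<in> horizontal_fields H \<Longrightarrow> D X Y \<in> horizontal_fields H"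
  and D_vertical: "X \<in> vector_fields \<Longrightarrow> Z \<in> V \<Longrightarrow> D X Z = 0"
  and torsion_vert: "X \<in> horizontal_fields H \<Longrightarrow> Y \<in> horizontal_fields H \<Longrightarrow> torsion D X Y p \<in> vert_space p"
  and torsion_HV: "X \<in> horizontal_fields H \<Longrightarrow> Z \<in> V \<Longrightarrow> torsion D X Z = 0"
  using canonical unfolding canonical_connection_def by blast+

lemma D_zero_left: "Y \<in> vector_fields \<Longrightarrow> D 0 Y = 0"
  using D_add_left[OF vector_fields_zero vector_fields_zero, of Y] by simp

lemma D_minus_left: "X \<in> vector_fields \<Longrightarrow> Y \<in> vector_fields \<Longrightarrow> D (- X) Y = - D X Y"
  using D_add_left[OF _ vector_fields_minus, of X X Y] D_zero_left[of Y]
  by (simp add: eq_neg_iff_add_eq_0 add.commute)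

lemma D_diff_left: "X \<in> vector_fields \<Longrightarrow> Y \<in> vector_fields \<Longrightarrow> W \<in> vector_fields \<Longrightarrow> D (X - Y) W = D X W - D Y W"
  using D_add_left[OF _ vector_fields_minus, of X Y W] D_minus_left[of Y W] by simp

lemma D_zero_right: "X \<in> vector_fields \<Longrightarrow> D X 0 = 0"
  using D_add_right[OF _ vector_fields_zero vector_fields_zero, of X] by simp

text \<open>In the vanishing mixed torsion the term \<open>D X Z\<close> drops out because
  \<open>Z\<close> is parallel, so a Killing field differentiates horizontal fields by the Lie
  bracket.\<close>

lemma D_killing: "Z \<in> V \<Longrightarrow> X \<in> horizontal_fields H \<Longrightarrow> D Z X = lie_bracket Z X"
proof -
  assume a: "Z \<in> V" "X \<in> horizontal_fields H"
  have "0 - D Z X - lie_bracket X Z = 0"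
    using torsion_HV[OF a(2,1)] D_vertical[OF horizontal_vector_field[OF a(2)] a(1)] by (simp only: torsion_def)
  then have "- D Z X = lie_bracket X Z" by simp
  from arg_cong[OF this, of uminus] have "D Z X = - lie_bracket X Z" by simp
  then show ?thesis by (simp only: lie_bracket_antisym[of Z X])
qed

lemma D_tensorial_sum:
  assumes "Y \<in> vector_fields" "A \<in> vector_fields" "\<And>i. i \<in> I \<Longrightarrow> B i \<in> vector_fields"
    "A p = (\<Sum>i\<in>I. c i *\<^sub>R B i p)"
  shows "D A Y p = (\<Sum>i\<in>I. c i *\<^sub>R D (B i) Y p)"
proof
  fix k
  have "D A Y p k = (\<Sum>i\<in>I. c i * D (B i) Y p k)"
    by (rule tensorial_sum[where \<Phi> = "\<lambda>A. D A Y p k", OF _ _ assms(2-4)])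
      (simp_all add: D_add_left D_scale_left assms(1))
  then show "D A Y p k = (\<Sum>i\<in>I. c i *\<^sub>R D (B i) Y p) k" by (simp add: sum_fun_app)
qed

text \<open>\<open>D X Y p\<close> depends on \<open>X\<close> only through \<open>X p\<close>,
  which is split into a horizontal and a Killing part. The first preserves horizontality by
  assumption, the second acts as a Lie bracket.\<close>

lemma D_horizontal:
  assumes X: "X \<in> vector_fields" and Y: "Y \<in> horizontal_fields H"
  shows "D X Y \<in> horizontal_fields H"
proof (rule horizontal_fieldsI[OF D_vector_field[OF X horizontal_vector_field[OF Y]]])
  fix p
  obtain h Z where hZ: "h \<in> H p" "Z \<in> V" "X p = h + Z p" by (rule tangent_splitE[OF vector_field_tangent[OF X]])
  obtain W where W: "W \<in> horizontal_fields H" "W p = h" by (rule horizontal_field_through[OF hZ(1)])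
  \<comment> \<open>The sum over a singleton says that \<open>X\<close> may be replaced by another
    field with the same value at \<open>p\<close>.\<close>
  have "D X Y p = (\<Sum>i\<in>{0::nat}. 1 *\<^sub>R D (W + Z) Y p)"
    by (rule D_tensorial_sum[OF horizontal_vector_field[OF Y] X])
      (use W hZ V_vector_field horizontal_vector_field in \<open>auto intro: vector_fields_add\<close>)
  also have "\<dots> = D W Y p + lie_bracket Z Y p"
    using D_add_left[OF horizontal_vector_field[OF W(1)] V_vector_field[OF hZ(2)] horizontal_vector_field[OF Y]]
      D_killing[OF hZ(2) Y] by simp
  finally show "D X Y p \<in> H p"
    using horizontal_mem[OF D_horizontal_horizontal[OF W(1) Y], of p] horizontal_mem[OF killing_bracket[OF hZ(2) Y], of p]
    by (simp add: H_mem_intros)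
qed

lemma torsion_vector_field: "X \<in> vector_fields \<Longrightarrow> Y \<in> vector_fields \<Longrightarrow> torsion D X Y \<in> vector_fields"
  unfolding torsion_def by (intro vector_fields_diff D_vector_field lie_bracket_vector_field)

lemma torsion_antisym: "torsion D X Y = - torsion D Y X"
  using lie_bracket_antisym[of X Y] by (simp add: torsion_def)

lemma torsion_add_right:
  assumes "X \<in> vector_fields" "Y \<in> vector_fields" "W \<in> vector_fields"
  shows "torsion D X (Y + W) = torsion D X Y + torsion D X W"
  by (simp add: torsion_def D_add_left D_add_right lie_bracket_add_right assms)

lemma torsion_scale_right:
  assumes "X \<in> vector_fields" "Y \<in> vector_fields" "f \<in> smooth_funs"
  shows "torsion D X (\<lambda>p. f p *\<^sub>R Y p) = (\<lambda>p. f p *\<^sub>R torsion D X Y p)"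
  by (simp add: torsion_def D_scale_left D_scale_right lie_bracket_scale_right assms fun_eq_iff algebra_simps)

lemma cov_torsion_add_right:
  assumes "W \<in> vector_fields" "X \<in> vector_fields" "Y \<in> vector_fields" "Y' \<in> vector_fields"
  shows "cov_torsion D W X (Y + Y') = cov_torsion D W X Y + cov_torsion D W X Y'"
  by (simp add: cov_torsion_def D_add_right torsion_add_right torsion_vector_field D_vector_field assms)

lemma cov_torsion_scale_right:
  assumes "W \<in> vector_fields" "X \<in> vector_fields" "Y \<in> vector_fields" "f \<in> smooth_funs"
  shows "cov_torsion D W X (\<lambda>p. f p *\<^sub>R Y p) p = f p *\<^sub>R cov_torsion D W X Y p"
proof -
  have Wf: "(\<lambda>p. W p f) \<in> smooth_funs" by (rule vector_field_smooth[OF assms(1,4)])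
  have "D W (\<lambda>p. f p *\<^sub>R Y p) = (\<lambda>p. W p f *\<^sub>R Y p) + (\<lambda>p. f p *\<^sub>R D W Y p)"
    by (simp add: D_scale_right assms plus_fun_def)
  then have "torsion D X (D W (\<lambda>p. f p *\<^sub>R Y p)) p = W p f *\<^sub>R torsion D X Y p + f p *\<^sub>R torsion D X (D W Y) p"
    by (simp add: torsion_add_right torsion_scale_right vector_fields_mult D_vector_field assms Wf)
  then show ?thesis
    by (simp add: cov_torsion_def torsion_scale_right D_scale_right torsion_vector_field D_vector_field assms algebra_simps)
qed

lemma curvature_add_left:
  assumes "X \<in> vector_fields" "X' \<in> vector_fields" "Y \<in> vector_fields" "W \<in> vector_fields"
  shows "curvature D (X + X') Y W = curvature D X Y W + curvature D X' Y W"
  by (simp add: curvature_def D_add_left D_add_right lie_bracket_add_left lie_bracket_vector_field D_vector_field assms)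

lemma curvature_scale_left:
  assumes "X \<in> vector_fields" "Y \<in> vector_fields" "W \<in> vector_fields" "f \<in> smooth_funs"
  shows "curvature D (\<lambda>p. f p *\<^sub>R X p) Y W p = f p *\<^sub>R curvature D X Y W p"
proof -
  have Yf: "(\<lambda>p. Y p f) \<in> smooth_funs" by (rule vector_field_smooth[OF assms(2,4)])
  have "lie_bracket (\<lambda>p. f p *\<^sub>R X p) Y = (\<lambda>p. f p *\<^sub>R lie_bracket X Y p) - (\<lambda>p. Y p f *\<^sub>R X p)"
    by (simp add: lie_bracket_scale_left assms fun_eq_iff)
  then have "D (lie_bracket (\<lambda>p. f p *\<^sub>R X p) Y) W p = f p *\<^sub>R D (lie_bracket X Y) W p - Y p f *\<^sub>R D X W p"
    by (simp add: D_diff_left D_scale_left lie_bracket_vector_field vector_fields_mult assms Yf)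
  then show ?thesis
    by (simp add: curvature_def D_scale_left D_scale_right D_vector_field assms algebra_simps)
qed

lemma curvature_horizontal:
  "X \<in> vector_fields \<Longrightarrow> Y \<in> vector_fields \<Longrightarrow> W \<in> horizontal_fields H \<Longrightarrow> curvature D X Y W \<in> horizontal_fields H"
  unfolding curvature_def by (intro horizontal_diff D_horizontal lie_bracket_vector_field)

lemma curvature_antisym:
  "X \<in> vector_fields \<Longrightarrow> Y \<in> vector_fields \<Longrightarrow> W \<in> vector_fields \<Longrightarrow> curvature D X Y W = - curvature D Y X W"
  using D_minus_left[OF lie_bracket_vector_field, of Y X W] lie_bracket_antisym[of X Y]
  by (simp add: curvature_def)

text \<open>\<open>ricci\<close> takes its trace in an unspecified basis of the full tangent space.
  Expanding both slots in the adapted basis shows that the trace does not depend on the choice, and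
  the vertical terms vanish because the curvature takes values in \<open>H p\<close>.\<close>

lemma ricci_eq:
  assumes X: "horizontal_frame p X" and Y: "Y \<in> vector_fields" and W: "W \<in> horizontal_fields H"
  shows "ricci D Y W p = (\<Sum>i<d. g p (curvature D (X i) Y W p) (X i p))"
proof -
  define e where "e = frame_join X vframe"
  have e: "e a \<in> vector_fields" if "a < CARD('n)" for a
    using that horizontal_vector_field[OF horizontal_frame_field[OF X, of a]] vframe_vector_field[of "a - d"]
    by (auto simp: e_def frame_join_def dim_sum[symmetric])
  have ep: "(\<lambda>a. e a p) = frame_join (\<lambda>i. X i p) (\<lambda>m. vframe m p)"
    by (auto simp: e_def frame_join_def)
  have one: "orthonormal_family (tangent_space p) (gR p) CARD('n) (\<lambda>a. e a p)"
    unfolding ep using frame_join_orthonormal[OF horizontal_frame_at[OF X]] by (simp add: dim_sum)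
  have "orthonormal_at p e"
    using e orthonormal_ip[OF gR_ip one] by (simp add: orthonormal_at_def)
  then have E: "orthonormal_at p (SOME E. orthonormal_at p E)" by (rule someI[where P = "orthonormal_at p"])
  define E where "E = (SOME E. orthonormal_at p E)"
  have E': "orthonormal_at p E" unfolding E_def by (rule E)
  have Evf: "E i \<in> vector_fields" if "i < CARD('n)" for i
    using E' that by (simp add: orthonormal_at_def)
  have onE: "orthonormal_family (tangent_space p) (gR p) CARD('n) (\<lambda>i. E i p)"
    using E' vector_field_tangent[OF Evf] by (simp add: orthonormal_at_def orthonormal_family_def)
  let ?R = "\<lambda>A. curvature D A Y W p"
  let ?n = "CARD('n)"
  obtain F where F: "finite F" "tangent_space p \<subseteq> span F" by (rule tangent_finite_span)
  have RT: "?R A \<in> tangent_space p" if "A \<in> vector_fields" for A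
    using H_tangent[OF horizontal_mem[OF curvature_horizontal[OF that Y W]]] .
  have Wv: "W \<in> vector_fields" by (rule horizontal_vector_field[OF W])
  have step: "gR p (?R (E i)) (E i p) =
      (\<Sum>a<?n. \<Sum>b<?n. (gR p (e a p) (E i p) * gR p (e b p) (E i p)) * gR p (?R (e a)) (e b p))" if i: "i < ?n" for i
  proof -
    have ex: "E i p = (\<Sum>a<?n. gR p (E i p) (e a p) *\<^sub>R e a p)"
      by (rule tangent_expansion[OF one vector_field_tangent[OF Evf[OF i]]])
    have "gR p (?R (E i)) (E i p) = (\<Sum>a<?n. gR p (E i p) (e a p) * gR p (?R (e a)) (E i p))"
    proof (rule tensorial_sum[where \<Phi> = "\<lambda>A. gR p (?R A) (E i p)" and p = p and A = "E i" and B = e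
          and I = "{..<?n}" and c = "\<lambda>a. gR p (E i p) (e a p)", OF _ _ Evf[OF i] _ ex])
      show "gR p (?R (A + B)) (E i p) = gR p (?R A) (E i p) + gR p (?R B) (E i p)"
        if "A \<in> vector_fields" "B \<in> vector_fields" for A B
        using ip_add_left[OF gR_ip RT[OF that(1)] RT[OF that(2)] vector_field_tangent[OF Evf[OF i]]]
        by (simp add: curvature_add_left that Y Wv)
      show "gR p (?R (\<lambda>q. f q *\<^sub>R A q)) (E i p) = f p * gR p (?R A) (E i p)"
        if "f \<in> smooth_funs" "A \<in> vector_fields" for f A
        using ip_scale_left[OF gR_ip RT[OF that(2)] vector_field_tangent[OF Evf[OF i]]]
        by (simp add: curvature_scale_left that Y Wv)
    qed (use e in auto)
    also have "\<dots> = (\<Sum>a<?n. gR p (E i p) (e a p) * (\<Sum>b<?n. gR p (?R (e a)) (e b p) * gR p (E i p) (e b p)))"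
      by (intro sum.cong refl) (simp add: orthonormal_parseval[OF gR_ip one F dim_tangent_space RT[OF e] vector_field_tangent[OF Evf[OF i]]])
    also have "\<dots> = (\<Sum>a<?n. \<Sum>b<?n. (gR p (e a p) (E i p) * gR p (e b p) (E i p)) * gR p (?R (e a)) (e b p))"
      unfolding sum_distrib_left
      by (intro sum.cong refl) (simp add: ip_sym[OF gR_ip vector_field_tangent[OF Evf[OF i]] vector_field_tangent[OF e]])
    finally show ?thesis .
  qed
  have "ricci D Y W p = (\<Sum>i<?n. gR p (?R (E i)) (E i p))"
    by (simp add: ricci_def E_def[symmetric] Let_def)
  also have "\<dots> = (\<Sum>i<?n. \<Sum>a<?n. \<Sum>b<?n. (gR p (e a p) (E i p) * gR p (e b p) (E i p)) * gR p (?R (e a)) (e b p))"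
    by (intro sum.cong refl step) simp
  \<comment> \<open>Summed over \<open>i\<close> first, the coefficients give
    \<open>gR p (e a p) (e b p)\<close> by Parseval for the unspecified basis.\<close>
  also have "\<dots> = (\<Sum>a<?n. \<Sum>b<?n. \<Sum>i<?n. (gR p (e a p) (E i p) * gR p (e b p) (E i p)) * gR p (?R (e a)) (e b p))"
    by (rule trans[OF sum.swap], rule sum.cong[OF refl], rule sum.swap)
  also have "\<dots> = (\<Sum>a<?n. \<Sum>b<?n. gR p (e a p) (e b p) * gR p (?R (e a)) (e b p))"
    by (intro sum.cong refl)
      (simp add: sum_distrib_right[symmetric] orthonormal_parseval[OF gR_ip onE F dim_tangent_space vector_field_tangent[OF e] vector_field_tangent[OF e], symmetric])
  also have "\<dots> = (\<Sum>a<?n. gR p (?R (e a)) (e a p))"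
    by (intro sum.cong refl) (simp add: orthonormal_ip[OF gR_ip one])
  also have "\<dots> = (\<Sum>i<d. gR p (?R (X i)) (X i p)) + (\<Sum>m<dim V. gR p (?R (vframe m)) (vframe m p))"
    unfolding dim_sum[symmetric] by (simp add: sum_lessThan_add e_def frame_join_def)
  also have "(\<Sum>m<dim V. gR p (?R (vframe m)) (vframe m p)) = 0"
    by (intro sum.neutral ballI gR_HV horizontal_mem[OF curvature_horizontal[OF vframe_vector_field Y W]] vert_space_mem vframe_V) auto
  also have "(\<Sum>i<d. gR p (?R (X i)) (X i p)) = (\<Sum>i<d. g p (?R (X i)) (X i p))"
    by (intro sum.cong refl gR_HH horizontal_mem[OF curvature_horizontal[OF _ Y W]] horizontal_mem)
      (auto intro: horizontal_vector_field horizontal_frame_field[OF X])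
  finally show ?thesis by simp
qed

end

section \<open>Torsion components and symmetries of the curvature\<close>

context canonical_geometry
begin

text \<open>The components refer to parallel fields, so differentiating the vector field
  \<open>torsion D A B\<close> covariantly only differentiates these functions.\<close>

definition tor_coeff :: "nat \<Rightarrow> 'a vfield \<Rightarrow> 'a vfield \<Rightarrow> 'a \<Rightarrow> real"
  where "tor_coeff m A B q = gR q (torsion D A B q) (vframe m q)"

lemma tor_coeff_smooth:
  "A \<in> vector_fields \<Longrightarrow> B \<in> vector_fields \<Longrightarrow> m < dim V \<Longrightarrow> tor_coeff m A B \<in> smooth_funs"
  unfolding tor_coeff_def[abs_def] by (intro gR_smooth torsion_vector_field vframe_vector_field)

lemma torsion_expansion_at:
  assumes "A \<in> horizontal_fields H" "B \<in> horizontal_fields H"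
  shows "torsion D A B q = (\<Sum>m<dim V. tor_coeff m A B q *\<^sub>R vframe m q)"
  unfolding tor_coeff_def by (rule vert_expansion[OF torsion_vert[OF assms]])

lemma torsion_expansion:
  assumes "A \<in> horizontal_fields H" "B \<in> horizontal_fields H"
  shows "torsion D A B = (\<Sum>m<dim V. (\<lambda>q. tor_coeff m A B q *\<^sub>R vframe m q))"
  by (rule ext) (simp add: torsion_expansion_at[OF assms] sum_fun_app)

lemma tor_coeff_antisym:
  assumes "A \<in> vector_fields" "B \<in> vector_fields" "m < dim V"
  shows "tor_coeff m A B q = - tor_coeff m B A q"
  using ip_minus_left[OF gR_ip vector_field_tangent[OF torsion_vector_field[OF assms(2,1)]] vector_field_tangent[OF vframe_vector_field[OF assms(3)]], of q]
  by (simp add: tor_coeff_def torsion_antisym[of A B])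

lemma D_vert_comb:
  assumes C: "C \<in> vector_fields" and c: "\<And>m. m \<in> I \<Longrightarrow> c m \<in> smooth_funs" and Z: "\<And>m. m \<in> I \<Longrightarrow> Z m \<in> V"
  shows "D C (\<Sum>m\<in>I. (\<lambda>q. c m q *\<^sub>R Z m q)) = (\<Sum>m\<in>I. (\<lambda>q. C q (c m) *\<^sub>R Z m q))"
  using c Z
proof (induction I rule: infinite_finite_induct)
  case (insert m I)
  have cZ: "(\<lambda>q. c k q *\<^sub>R Z k q) \<in> vector_fields" if "k \<in> insert m I" for k
    using insert.prems that by (intro vector_fields_mult V_vector_field)
  have "D C (\<lambda>q. c m q *\<^sub>R Z m q) = (\<lambda>q. C q (c m) *\<^sub>R Z m q)"
    using D_scale_right[OF insert.prems(1) C V_vector_field[OF insert.prems(2)], of m m] D_vertical[OF C insert.prems(2), of m]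
    by (simp add: fun_eq_iff)
  moreover have "(\<Sum>m\<in>I. (\<lambda>q. c m q *\<^sub>R Z m q)) \<in> vector_fields"
    by (rule vector_fields_sum) (use cZ in blast)
  moreover have "D C (\<Sum>m\<in>I. (\<lambda>q. c m q *\<^sub>R Z m q)) = (\<Sum>m\<in>I. (\<lambda>q. C q (c m) *\<^sub>R Z m q))"
    by (rule insert.IH) (use insert.prems in blast)+
  ultimately show ?case
    using D_add_right[OF C cZ, of m "\<Sum>m\<in>I. (\<lambda>q. c m q *\<^sub>R Z m q)"]
    by (simp only: sum.insert[OF insert.hyps] insertI1)
qed (simp_all add: D_zero_right C)

text \<open>Brackets within \<open>V\<close> stay in \<open>V\<close>, and derivatives of the
  coefficients only add vertical terms. The case of interest is the torsion, whose components are
  functions.\<close>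

lemma vert_comb_bracket:
  assumes Y: "Y \<in> V" and c: "\<And>m. m \<in> I \<Longrightarrow> c m \<in> smooth_funs" and Z: "\<And>m. m \<in> I \<Longrightarrow> Z m \<in> V"
  shows "lie_bracket Y (\<Sum>m\<in>I. (\<lambda>q. c m q *\<^sub>R Z m q)) p \<in> vert_space p"
  using c Z
proof (induction I rule: infinite_finite_induct)
  case (insert m I)
  note Yv = V_vector_field[OF Y]
  have cZ: "(\<lambda>q. c k q *\<^sub>R Z k q) \<in> vector_fields" if "k \<in> insert m I" for k
    using insert.prems that by (intro vector_fields_mult V_vector_field)
  have S: "(\<Sum>m\<in>I. (\<lambda>q. c m q *\<^sub>R Z m q)) \<in> vector_fields"
    by (rule vector_fields_sum) (use cZ in blast)
  have "lie_bracket Y (\<lambda>q. c m q *\<^sub>R Z m q) p = Y p (c m) *\<^sub>R Z m p + c m p *\<^sub>R lie_bracket Y (Z m) p"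
    using lie_bracket_scale_right[OF Yv V_vector_field[OF insert.prems(2)] insert.prems(1), of m m] by simp
  also have "\<dots> \<in> vert_space p"
    by (intro subspace_add[OF vert_subspace] subspace_scale[OF vert_subspace] vert_space_mem V_bracket Y insert.prems) auto
  finally have "lie_bracket Y (\<lambda>q. c m q *\<^sub>R Z m q) p \<in> vert_space p" .
  moreover have "lie_bracket Y (\<Sum>m\<in>I. (\<lambda>q. c m q *\<^sub>R Z m q)) p \<in> vert_space p"
    by (rule insert.IH) (use insert.prems in blast)+
  ultimately have "lie_bracket Y (\<lambda>q. c m q *\<^sub>R Z m q) p + lie_bracket Y (\<Sum>m\<in>I. (\<lambda>q. c m q *\<^sub>R Z m q)) p \<in> vert_space p"
    by (rule subspace_add[OF vert_subspace])
  moreover have "lie_bracket Y (\<Sum>m\<in>insert m I. (\<lambda>q. c m q *\<^sub>R Z m q)) p =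
      lie_bracket Y (\<lambda>q. c m q *\<^sub>R Z m q) p + lie_bracket Y (\<Sum>m\<in>I. (\<lambda>q. c m q *\<^sub>R Z m q)) p"
    unfolding sum.insert[OF insert.hyps] lie_bracket_add_right[OF Yv cZ[OF insertI1] S] by (rule plus_fun_apply)
  ultimately show ?case by (simp only:)
qed (simp_all add: lie_bracket_zero_right V_vector_field[OF Y] subspace_0[OF vert_subspace])

text \<open>The difference of the two sides is horizontal, and by the Jacobi identity it is a combination
  of torsions and hence vertical.\<close>

lemma curvature_killing_symmetric:
  assumes Z: "Z \<in> V" and A: "A \<in> horizontal_fields H" and B: "B \<in> horizontal_fields H"
  shows "curvature D Z A B = curvature D Z B A"
proof
  fix p
  note Av = horizontal_vector_field[OF A] and Bv = horizontal_vector_field[OF B] and Zv = V_vector_field[OF Z]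
  note ZA = killing_bracket[OF Z A] and ZB = killing_bracket[OF Z B]
  have tor: "D X Y = D Y X + lie_bracket X Y + torsion D X Y" for X Y by (simp add: torsion_def)
  have br: "lie_bracket Z (D A B) - lie_bracket Z (D B A) = lie_bracket Z (lie_bracket A B) + lie_bracket Z (torsion D A B)"
    unfolding tor[of A B]
    by (simp add: lie_bracket_add_right Zv Av Bv D_vector_field lie_bracket_vector_field torsion_vector_field vector_fields_add)
  have "curvature D Z A B - curvature D Z B A =
      (lie_bracket Z (D A B) - lie_bracket Z (D B A))
      - (D A (lie_bracket Z B) - D (lie_bracket Z B) A) - (D (lie_bracket Z A) B - D B (lie_bracket Z A))"
    by (simp add: curvature_def D_killing[OF Z] A B D_horizontal_horizontal)
  also have "\<dots> = lie_bracket Z (torsion D A B) - torsion D A (lie_bracket Z B) - torsion D (lie_bracket Z A) B"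
    unfolding br lie_bracket_jacobi[OF Av Bv Zv] by (simp add: torsion_def)
  finally have "(curvature D Z A B - curvature D Z B A) p =
      (lie_bracket Z (torsion D A B) - torsion D A (lie_bracket Z B) - torsion D (lie_bracket Z A) B) p"
    by (rule fun_cong)
  then have eq: "curvature D Z A B p - curvature D Z B A p =
      lie_bracket Z (torsion D A B) p - torsion D A (lie_bracket Z B) p - torsion D (lie_bracket Z A) B p"
    by (simp only: minus_apply)
  have "lie_bracket Z (torsion D A B) p \<in> vert_space p"
    unfolding torsion_expansion[OF A B]
    by (rule vert_comb_bracket[OF Z]) (auto intro: tor_coeff_smooth Av Bv vframe_V)
  then have "curvature D Z A B p - curvature D Z B A p \<in> vert_space p"
    unfolding eq by (intro subspace_diff[OF vert_subspace] torsion_vert A B ZA ZB)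
  moreover have "curvature D Z A B p - curvature D Z B A p \<in> H p"
    by (rule subspace_diff[OF H_subspace horizontal_mem[OF curvature_horizontal[OF Zv Av B]]
          horizontal_mem[OF curvature_horizontal[OF Zv Bv A]]])
  ultimately have "curvature D Z A B p - curvature D Z B A p = 0"
    by (rule H_vert_zero[rotated])
  then show "curvature D Z A B p = curvature D Z B A p" by (rule eq_iff_diff_eq_0[THEN iffD2])
qed

text \<open>Metric compatibility expresses the second derivatives of \<open>n\<close> by
  \<open>D\<close>. On this function \<open>A\<close> and \<open>B\<close> commute up to
  \<open>lie_bracket A B\<close>, and the products of first derivatives cancel; what is left says
  that twice the curvature term is zero.\<close>

lemma curvature_skew:
  assumes A: "A \<in> vector_fields" and B: "B \<in> vector_fields" and X: "X \<in> horizontal_fields H"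
  shows "g p (curvature D A B X p) (X p) = 0"
proof -
  define n where "n q = g q (X q) (X q)" for q
  have DX: "D W X \<in> horizontal_fields H" if "W \<in> vector_fields" for W by (rule D_horizontal[OF that X])
  have s: "g q (X q) (Y q) = g q (Y q) (X q)" if "Y \<in> horizontal_fields H" for Y q
    by (rule ip_sym[OF g_ip horizontal_mem[OF X] horizontal_mem[OF that]])
  have n1: "W q n = 2 * g q (D W X q) (X q)" if "W \<in> vector_fields" for W q
    using D_metric[OF that X X, of q] s[OF DX[OF that], of q] by (simp add: n_def[abs_def])
  have sm: "(\<lambda>q. g q (D W X q) (X q)) \<in> smooth_funs" if "W \<in> vector_fields" for W
    by (rule g_smooth[OF DX[OF that] X])
  have n2: "W p (\<lambda>q. W' q n) = 2 * (g p (D W (D W' X) p) (X p) + g p (D W' X p) (D W X p))"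
    if "W \<in> vector_fields" "W' \<in> vector_fields" for W W'
    unfolding n1[OF that(2)] tangent_cmult[OF vector_field_tangent[OF that(1)] sm[OF that(2)]]
    using D_metric[OF that(1) DX[OF that(2)] X, of p] by simp
  have br: "lie_bracket A B \<in> vector_fields" by (rule lie_bracket_vector_field[OF A B])
  have "lie_bracket A B p n = A p (\<lambda>q. B q n) - B p (\<lambda>q. A q n)" by (simp add: lie_bracket_def)
  then have eq: "g p (D (lie_bracket A B) X p) (X p) = g p (D A (D B X) p) (X p) - g p (D B (D A X) p) (X p)"
    unfolding n1[OF br] n2[OF A B] n2[OF B A]
    using ip_sym[OF g_ip horizontal_mem[OF DX[OF A]] horizontal_mem[OF DX[OF B]], of p] by simp
  note m = horizontal_mem[OF D_horizontal[OF A DX[OF B]]] horizontal_mem[OF D_horizontal[OF B DX[OF A]]]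
    horizontal_mem[OF DX[OF br]] horizontal_mem[OF X]
  have "curvature D A B X p = D A (D B X) p - D B (D A X) p - D (lie_bracket A B) X p"
    by (simp only: curvature_def minus_apply)
  then have "g p (curvature D A B X p) (X p) =
      g p (D A (D B X) p) (X p) - g p (D B (D A X) p) (X p) - g p (D (lie_bracket A B) X p) (X p)"
    using ip_diff_left[OF g_ip subspace_diff[OF H_subspace m(1,2)] m(3,4)] ip_diff_left[OF g_ip m(1,2,4)]
    by (simp only:)
  then show ?thesis using eq by simp
qed

section \<open>The horizontal Hessian\<close>

context
  fixes f assumes f: "f \<in> smooth_funs"
begin

definition hess :: "'a vfield \<Rightarrow> 'a vfield \<Rightarrow> 'a \<Rightarrow> real"
  where "hess A B q = g q (D A (gradH f) q) (B q)"

lemma gradH_vector_field: "gradH f \<in> vector_fields"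
  by (rule horizontal_vector_field[OF gradH_horizontal[OF f]])

lemma D_gradH_horizontal: "A \<in> vector_fields \<Longrightarrow> D A (gradH f) \<in> horizontal_fields H"
  by (rule D_horizontal[OF _ gradH_horizontal[OF f]])

lemma hess_smooth: "A \<in> vector_fields \<Longrightarrow> B \<in> horizontal_fields H \<Longrightarrow> hess A B \<in> smooth_funs"
  unfolding hess_def[abs_def] by (intro g_smooth D_gradH_horizontal)

lemma hess_eq:
  assumes "A \<in> vector_fields" "B \<in> horizontal_fields H"
  shows "hess A B q = A q (\<lambda>q. B q f) - D A B q f"
proof -
  have "A q (\<lambda>q. g q (gradH f q) (B q)) = hess A B q + g q (gradH f q) (D A B q)"
    unfolding hess_def by (rule D_metric[OF assms(1) gradH_horizontal[OF f] assms(2)])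
  then show ?thesis
    by (simp add: gradH_ip[OF horizontal_mem[OF assms(2)]] gradH_ip[OF horizontal_mem[OF D_horizontal[OF assms]]])
qed

text \<open>The two orders of differentiation differ by a Lie bracket, and together with the
  first-order terms of \<open>hess_eq\<close> this bracket adds up to the torsion.\<close>

lemma hess_antisym:
  assumes "A \<in> horizontal_fields H" "B \<in> horizontal_fields H"
  shows "hess A B q = hess B A q - torsion D A B q f"
  by (simp add: hess_eq assms horizontal_vector_field torsion_def lie_bracket_def)

text \<open>For a Killing field the term \<open>D Z B\<close> is the bracket, which swaps the order
  of differentiation. The mixed derivatives in the torsion terms are thus Hessian entries with a
  vertical first slot.\<close>

lemma hess_killing:
  assumes "Z \<in> V" "B \<in> horizontal_fields H"
  shows "hess Z B q = B q (\<lambda>q. Z q f)"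
  by (simp add: hess_eq assms V_vector_field D_killing lie_bracket_def)

lemma hess_derivative:
  assumes "C \<in> vector_fields" "A \<in> vector_fields" "B \<in> horizontal_fields H"
  shows "C q (hess A B) = g q (D C (D A (gradH f)) q) (B q) + hess A (D C B) q"
  using D_metric[OF assms(1) D_gradH_horizontal[OF assms(2)] assms(3), of q] by (simp add: hess_def[abs_def])

lemma hess_tensorial:
  assumes "A \<in> vector_fields" "\<And>i. i \<in> I \<Longrightarrow> C i \<in> vector_fields" "A p = (\<Sum>i\<in>I. c i *\<^sub>R C i p)" "B \<in> horizontal_fields H"
  shows "hess A B p = (\<Sum>i\<in>I. c i * hess (C i) B p)"
proof -
  have DC: "D (C i) (gradH f) p \<in> H p" if "i \<in> I" for i by (rule horizontal_mem[OF D_gradH_horizontal[OF assms(2)[OF that]]])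
  have Bp: "B p \<in> H p" by (rule horizontal_mem[OF assms(4)])
  have "D A (gradH f) p = (\<Sum>i\<in>I. c i *\<^sub>R D (C i) (gradH f) p)"
    by (rule D_tensorial_sum[OF gradH_vector_field assms(1-3)])
  then have "hess A B p = g p (\<Sum>i\<in>I. c i *\<^sub>R D (C i) (gradH f) p) (B p)" by (simp add: hess_def)
  also have "\<dots> = (\<Sum>i\<in>I. g p (c i *\<^sub>R D (C i) (gradH f) p) (B p))"
    by (rule ip_sum_left[OF g_ip _ Bp]) (intro H_mem_intros DC)
  also have "\<dots> = (\<Sum>i\<in>I. c i * hess (C i) B p)"
    by (intro sum.cong refl) (simp add: ip_scale_left[OF g_ip DC Bp] hess_def)
  finally show ?thesis .
qed

lemma hess_right_sum:
  assumes "A \<in> vector_fields" "\<And>i. i \<in> I \<Longrightarrow> C i \<in> horizontal_fields H" "B p = (\<Sum>i\<in>I. c i *\<^sub>R C i p)"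
  shows "hess A B p = (\<Sum>i\<in>I. c i * hess A (C i) p)"
proof -
  have Dp: "D A (gradH f) p \<in> H p" by (rule horizontal_mem[OF D_gradH_horizontal[OF assms(1)]])
  have "hess A B p = (\<Sum>i\<in>I. g p (D A (gradH f) p) (c i *\<^sub>R C i p))"
    unfolding hess_def assms(3)
    by (rule ip_sum_right[OF g_ip _ Dp]) (intro H_mem_intros horizontal_mem assms(2))
  also have "\<dots> = (\<Sum>i\<in>I. c i * hess A (C i) p)"
    by (intro sum.cong refl) (simp add: ip_scale_right[OF g_ip Dp horizontal_mem[OF assms(2)]] hess_def)
  finally show ?thesis .
qed

context
  fixes p X assumes X: "horizontal_frame p X"
begin

lemma frame_horizontal: "i < d \<Longrightarrow> X i \<in> horizontal_fields H" and frame_vector_field: "i < d \<Longrightarrow> X i \<in> vector_fields"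
  using horizontal_frame_field[OF X] horizontal_vector_field by auto

lemma frame_derivative_skew:
  assumes A: "A \<in> vector_fields" and ij: "i < d" "j < d"
  shows "g p (D A (X i) p) (X j p) + g p (X i p) (D A (X j) p) = 0"
proof -
  obtain N where N: "open N" "p \<in> N" "\<And>q. q \<in> N \<Longrightarrow> orthonormal_family (H q) (g q) d (\<lambda>i. X i q)"
    by (rule horizontal_frame_orthonormal[OF X]) (rule that)
  have "A p (\<lambda>q. g q (X i q) (X j q)) = A p (\<lambda>q. of_bool (i = j))"
    by (rule tangent_local[OF vector_field_tangent[OF A] g_smooth[OF frame_horizontal frame_horizontal] smooth_funs_const eventually_openI[OF N(1,2)]])
      (use ij orthonormal_ip[OF g_ip N(3)] in auto)
  then show ?thesis
    using D_metric[OF A frame_horizontal[OF ij(1)] frame_horizontal[OF ij(2)], of p] tangent_const[OF vector_field_tangent[OF A]] by simp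
qed

text \<open>Connection coefficients in an orthonormal frame are skew, so rotating the frame along
  \<open>A\<close> does not change the trace of the Hessian. This disposes of the terms with
  \<open>D A (X i)\<close> in both Bochner formulas.\<close>

lemma hess_frame_skew:
  assumes A: "A \<in> vector_fields"
  shows "(\<Sum>i<d. hess (D A (X i)) (X i) p) + (\<Sum>i<d. hess (X i) (D A (X i)) p) = 0"
proof -
  define a where "a i j = g p (D A (X i) p) (X j p)" for i j
  have DX: "D A (X i) \<in> horizontal_fields H" if "i < d" for i by (rule D_horizontal[OF A frame_horizontal[OF that]])
  have ex: "D A (X i) p = (\<Sum>j<d. a i j *\<^sub>R X j p)" if "i < d" for i
    unfolding a_def by (rule horizontal_expansion[OF X horizontal_mem[OF DX[OF that]]])
  have skew: "a i j = - a j i" if "i < d" "j < d" for i j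
    using frame_derivative_skew[OF A that] ip_sym[OF g_ip horizontal_mem[OF frame_horizontal[OF that(1)]] horizontal_mem[OF DX[OF that(2)]], of p]
    by (simp add: a_def)
  have skew': "a i j * y = - (a j i * y)" if "i < d" "j < d" for i j y
    using skew[OF that] by simp
  have "(\<Sum>i<d. hess (D A (X i)) (X i) p) = (\<Sum>i<d. \<Sum>j<d. a i j * hess (X j) (X i) p)"
    by (intro sum.cong refl hess_tensorial horizontal_vector_field[OF DX] ex frame_horizontal frame_vector_field) auto
  also have "\<dots> = (\<Sum>j<d. \<Sum>i<d. a i j * hess (X j) (X i) p)" by (rule sum.swap)
  also have "\<dots> = (\<Sum>j<d. \<Sum>i<d. - (a j i * hess (X j) (X i) p))"
    by (rule sum.cong[OF refl], rule sum.cong[OF refl], rule skew') simp_all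
  also have "\<dots> = - (\<Sum>j<d. \<Sum>i<d. a j i * hess (X j) (X i) p)"
    by (simp add: sum_negf)
  also have "(\<Sum>j<d. \<Sum>i<d. a j i * hess (X j) (X i) p) = (\<Sum>i<d. hess (X i) (D A (X i)) p)"
    by (intro sum.cong refl hess_right_sum[symmetric] ex frame_horizontal frame_vector_field) auto
  finally show ?thesis by simp
qed

end

end

end

subsection \<open>The Bochner identities\<close>

text \<open>The square norm of \<open>h\<close> splits into those of its symmetric and skew parts.
  The skew part is \<open>- t i j / 2\<close>, hence the factor 1/4. Of the symmetric part only the
  diagonal is kept, and Cauchy-Schwarz brings in the dimension.\<close>

lemma trace_square_bound:
  fixes h t :: "nat \<Rightarrow> nat \<Rightarrow> real"
  assumes "\<And>i j. i < n \<Longrightarrow> j < n \<Longrightarrow> h i j - h j i = - t i j"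
  shows "(\<Sum>i<n. h i i)\<^sup>2 / n + (\<Sum>i<n. \<Sum>j<n. (t i j)\<^sup>2) / 4 \<le> (\<Sum>i<n. \<Sum>j<n. (h i j)\<^sup>2)"
proof -
  have sw: "(\<Sum>i<n. \<Sum>j<n. (h i j)\<^sup>2) = (\<Sum>i<n. \<Sum>j<n. (h j i)\<^sup>2)" by (rule sum.swap)
  have "(\<Sum>i<n. \<Sum>j<n. (h i j)\<^sup>2) = (\<Sum>i<n. \<Sum>j<n. ((h i j)\<^sup>2 + (h j i)\<^sup>2) / 2)"
    using sw by (simp add: sum.distrib flip: sum_divide_distrib)
  also have "\<dots> = (\<Sum>i<n. \<Sum>j<n. ((h i j + h j i) / 2)\<^sup>2 + (t i j)\<^sup>2 / 4)"
  proof (rule sum.cong[OF refl], rule sum.cong[OF refl])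
    fix i j assume "i \<in> {..<n}" "j \<in> {..<n}"
    then have t: "t i j = h j i - h i j" using assms[of i j] by simp
    show "((h i j)\<^sup>2 + (h j i)\<^sup>2) / 2 = ((h i j + h j i) / 2)\<^sup>2 + (t i j)\<^sup>2 / 4"
      unfolding t by (simp add: power2_eq_square field_simps)
  qed
  also have "\<dots> = (\<Sum>i<n. \<Sum>j<n. ((h i j + h j i) / 2)\<^sup>2) + (\<Sum>i<n. \<Sum>j<n. (t i j)\<^sup>2) / 4"
    by (simp add: sum.distrib sum_divide_distrib)
  finally have eq: "(\<Sum>i<n. \<Sum>j<n. (h i j)\<^sup>2) =
      (\<Sum>i<n. \<Sum>j<n. ((h i j + h j i) / 2)\<^sup>2) + (\<Sum>i<n. \<Sum>j<n. (t i j)\<^sup>2) / 4" .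
  have "(\<Sum>i<n. h i i)\<^sup>2 \<le> (\<Sum>i<n. (h i i)\<^sup>2) * n"
    using Cauchy_Schwarz_ineq_sum[of "\<lambda>i. h i i" "\<lambda>i. 1" "{..<n}"] by simp
  then have "(\<Sum>i<n. h i i)\<^sup>2 / n \<le> (\<Sum>i<n. (h i i)\<^sup>2)"
    \<comment> \<open>For \<open>n = 0\<close> the quotient is 0 by convention, so the bound also
      covers rank 0.\<close>
    by (cases "n = 0") (simp_all add: field_simps)
  also have "\<dots> \<le> (\<Sum>i<n. \<Sum>j<n. ((h i j + h j i) / 2)\<^sup>2)"
  proof (rule sum_mono)
    fix i assume i: "i \<in> {..<n}"
    show "(h i i)\<^sup>2 \<le> (\<Sum>j<n. ((h i j + h j i) / 2)\<^sup>2)"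
      using member_le_sum[of i "{..<n}" "\<lambda>j. ((h i j + h j i) / 2)\<^sup>2"] i by simp
  qed
  finally show ?thesis using eq by simp
qed

context canonical_geometry
begin

lemma hess_diff_left:
  assumes f: "f \<in> smooth_funs" and "A \<in> vector_fields" "A' \<in> vector_fields" "B \<in> horizontal_fields H"
  shows "hess f (A - A') B q = hess f A B q - hess f A' B q"
proof -
  have "D (A - A') (gradH f) q = D A (gradH f) q - D A' (gradH f) q"
    using fun_cong[OF D_diff_left[OF assms(2,3) gradH_vector_field[OF f]], of q] by (simp only: minus_apply)
  then show ?thesis
    using ip_diff_left[OF g_ip horizontal_mem[OF D_gradH_horizontal[OF f assms(2)]] horizontal_mem[OF D_gradH_horizontal[OF f assms(3)]] horizontal_mem[OF assms(4)]]
    by (simp only: hess_def[OF f])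
qed

text \<open>Tested against horizontal vectors this is \<open>hess_killing\<close>. It expresses that
  an infinitesimal isometry commutes with the horizontal gradient.\<close>

lemma gradH_killing:
  assumes f: "f \<in> smooth_funs" and Z: "Z \<in> V"
  shows "gradH (\<lambda>q. Z q f) = D Z (gradH f)"
proof
  fix q
  note DZu = D_gradH_horizontal[OF f V_vector_field[OF Z]]
  show "gradH (\<lambda>q. Z q f) q = D Z (gradH f) q"
  proof (rule ip_eqI[OF g_ip gradH_mem horizontal_mem[OF DZu]])
    fix w assume w: "w \<in> H q"
    obtain B where B: "B \<in> horizontal_fields H" "B q = w" by (rule horizontal_field_through[OF w])
    have "g q (D Z (gradH f) q) (B q) = B q (\<lambda>q. Z q f)"
      using hess_killing[OF f Z B(1), of q] by (simp only: hess_def[OF f])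
    then show "g q (gradH (\<lambda>q. Z q f) q) w = g q (D Z (gradH f) q) w"
      unfolding gradH_ip[OF w] by (simp add: B(2))
  qed
qed

text \<open>The product rule for the torsion expanded in the vertical frame. Derivatives of the
  coefficients make up the covariant derivative because the \<open>vframe m\<close> are parallel;
  derivatives of the \<open>vframe m q f\<close> are the mixed terms that Young's inequality has to
  absorb.\<close>

lemma torsion_derivative:
  assumes f: "f \<in> smooth_funs" and C: "C \<in> vector_fields" and A: "A \<in> horizontal_fields H" and B: "B \<in> horizontal_fields H"
  shows "C p (\<lambda>q. torsion D A B q f) =
    D C (torsion D A B) p f + (\<Sum>m<dim V. tor_coeff m A B p * C p (\<lambda>q. vframe m q f))"
proof -
  note Av = horizontal_vector_field[OF A] and Bv = horizontal_vector_field[OF B]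
  have ts: "tor_coeff m A B \<in> smooth_funs" if "m < dim V" for m by (rule tor_coeff_smooth[OF Av Bv that])
  have zs: "(\<lambda>q. vframe m q f) \<in> smooth_funs" if "m < dim V" for m
    by (rule vector_field_smooth[OF vframe_vector_field[OF that] f])
  have "(\<lambda>q. torsion D A B q f) = (\<lambda>q. \<Sum>m<dim V. tor_coeff m A B q * vframe m q f)"
    by (rule ext) (simp add: torsion_expansion_at[OF A B] sum_fun_app)
  then have "C p (\<lambda>q. torsion D A B q f) = C p (\<lambda>q. \<Sum>m<dim V. tor_coeff m A B q * vframe m q f)" by simp
  also have "\<dots> = (\<Sum>m<dim V. C p (\<lambda>q. tor_coeff m A B q * vframe m q f))"
    by (rule tangent_sum[OF vector_field_tangent[OF C]]) (auto intro: smooth_funs_mult ts zs)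
  also have "\<dots> = (\<Sum>m<dim V. C p (tor_coeff m A B) * vframe m p f + tor_coeff m A B p * C p (\<lambda>q. vframe m q f))"
    by (rule sum.cong[OF refl]) (simp add: tangent_mult[OF vector_field_tangent[OF C] ts zs])
  also have "\<dots> = (\<Sum>m<dim V. C p (tor_coeff m A B) * vframe m p f) + (\<Sum>m<dim V. tor_coeff m A B p * C p (\<lambda>q. vframe m q f))"
    by (rule sum.distrib)
  also have "(\<Sum>m<dim V. C p (tor_coeff m A B) * vframe m p f) = D C (torsion D A B) p f"
  proof -
    have "D C (torsion D A B) = (\<Sum>m<dim V. (\<lambda>q. C q (tor_coeff m A B) *\<^sub>R vframe m q))"
      unfolding torsion_expansion[OF A B] by (rule D_vert_comb[OF C]) (auto intro: ts vframe_V)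
    from fun_cong[OF fun_cong[OF this, of p], of f] show ?thesis by (simp add: sum_fun_app)
  qed
  finally show ?thesis .
qed

section \<open>Commutation rules and the two Bochner formulas\<close>

context
  fixes \<mu> L assumes \<mu>: "riemannian_measure \<mu>" and L: "sub_laplacian \<mu> L"
begin

text \<open>The bracket of the gradient with \<open>X i\<close> is
  \<open>D ?u (X i) - D (X i) ?u - torsion D ?u (X i)\<close>. The first term is orthogonal to
  \<open>X i\<close>, which has constant length near \<open>p\<close>, and the last is vertical.
  Pairing with \<open>X i\<close> leaves minus a diagonal Hessian entry.\<close>

lemma sub_laplacian_eq_hess:
  assumes f: "f \<in> smooth_funs" and X: "horizontal_frame p X"
  shows "L f p = (\<Sum>i<d. hess f (X i) (X i) p)"
proof -
  let ?u = "gradH f"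
  note u = gradH_horizontal[OF f] gradH_vector_field[OF f]
  have "gR p (lie_bracket ?u (X i) p) (X i p) = - hess f (X i) (X i) p" if i: "i < d" for i
  proof -
    note Xi = frame_horizontal[OF f X i] frame_vector_field[OF f X i]
    note m1 = horizontal_mem[OF D_horizontal[OF u(2) Xi(1)], of p]
    note m2 = horizontal_mem[OF D_gradH_horizontal[OF f Xi(2)], of p]
    note m3 = torsion_vert[OF u(1) Xi(1), of p]
    note mX = horizontal_mem[OF Xi(1), of p]
    have "lie_bracket ?u (X i) = D ?u (X i) - D (X i) ?u - torsion D ?u (X i)" by (simp add: torsion_def)
    then have "lie_bracket ?u (X i) p = D ?u (X i) p - D (X i) ?u p - torsion D ?u (X i) p"
      by (simp only: minus_apply)
    then have "gR p (lie_bracket ?u (X i) p) (X i p) =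
        gR p (D ?u (X i) p) (X i p) - gR p (D (X i) ?u p) (X i p) - gR p (torsion D ?u (X i) p) (X i p)"
      using ip_diff_left[OF gR_ip subspace_diff[OF subspace_tangent_space H_tangent[OF m1] H_tangent[OF m2]] vert_tangent[OF m3] H_tangent[OF mX]]
        ip_diff_left[OF gR_ip H_tangent[OF m1] H_tangent[OF m2] H_tangent[OF mX]]
      by (simp only:)
    moreover have "g p (D ?u (X i) p) (X i p) = 0"
      using frame_derivative_skew[OF f X u(2) i i] ip_sym[OF g_ip mX m1] by simp
    ultimately show ?thesis
      by (simp add: gR_HH[OF m1 mX] gR_HH[OF m2 mX] gR_VH[OF m3 mX] hess_def[OF f])
  qed
  then show ?thesis by (simp add: sub_laplacian_eq_divergence[OF \<mu> L f X] sum_negf)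
qed

lemma sub_laplacian_derivative:
  assumes f: "f \<in> smooth_funs" and X: "horizontal_frame p X" and A: "A \<in> vector_fields"
  shows "A p (L f) = (\<Sum>i<d. g p (D A (D (X i) (gradH f)) p) (X i p) + hess f (X i) (D A (X i)) p)"
proof -
  note Xh = frame_horizontal[OF f X] and Xv = frame_vector_field[OF f X]
  have hs: "hess f (X i) (X i) \<in> smooth_funs" if "i < d" for i by (rule hess_smooth[OF f Xv[OF that] Xh[OF that]])
  have "A p (L f) = A p (\<lambda>q. \<Sum>i<d. hess f (X i) (X i) q)"
  \<comment> \<open>The trace formula holds with the same frame at all points near \<open>p\<close>,
    and a derivation sees only the germ.\<close>
  proof (rule tangent_local[OF vector_field_tangent[OF A] sub_laplacian_smooth[OF L f]])
    show "(\<lambda>q. \<Sum>i<d. hess f (X i) (X i) q) \<in> smooth_funs" by (rule smooth_funs_sum) (simp add: hs)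
    show "eventually (\<lambda>q. L f q = (\<Sum>i<d. hess f (X i) (X i) q)) (nhds p)"
      using horizontal_frame_nearby[OF X] by eventually_elim (rule sub_laplacian_eq_hess[OF f])
  qed
  also have "\<dots> = (\<Sum>i<d. A p (hess f (X i) (X i)))"
    by (rule tangent_sum[OF vector_field_tangent[OF A]]) (simp add: hs)
  also have "\<dots> = (\<Sum>i<d. g p (D A (D (X i) (gradH f)) p) (X i p) + hess f (X i) (D A (X i)) p)"
    by (rule sum.cong[OF refl]) (simp add: hess_derivative[OF f A Xv Xh])
  finally show ?thesis .
qed

lemma curvature_ip:
  assumes "A \<in> vector_fields" "B \<in> vector_fields" "W \<in> horizontal_fields H" "Y \<in> horizontal_fields H"
  shows "g p (curvature D A B W p) (Y p) =
    g p (D A (D B W) p) (Y p) - g p (D B (D A W) p) (Y p) - g p (D (lie_bracket A B) W p) (Y p)"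
proof -
  note m = horizontal_mem[OF D_horizontal[OF assms(1) D_horizontal[OF assms(2,3)]], of p]
    horizontal_mem[OF D_horizontal[OF assms(2) D_horizontal[OF assms(1,3)]], of p]
    horizontal_mem[OF D_horizontal[OF lie_bracket_vector_field[OF assms(1,2)] assms(3)], of p]
    horizontal_mem[OF assms(4), of p]
  have "curvature D A B W p = D A (D B W) p - D B (D A W) p - D (lie_bracket A B) W p"
    by (simp only: curvature_def minus_apply)
  then show ?thesis
    using ip_diff_left[OF g_ip subspace_diff[OF H_subspace m(1,2)] m(3,4)] ip_diff_left[OF g_ip m(1,2,4)]
    by (simp only:)
qed

text \<open>Exchanging \<open>D Z\<close> and \<open>D (X i)\<close> on the gradient costs
  \<open>curvature D Z (X i) (gradH f)\<close>. By symmetry this is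
  \<open>curvature D Z (gradH f) (X i)\<close>, which is orthogonal to \<open>X i\<close> by
  skewness. The terms with \<open>D Z (X i)\<close> cancel in the sum over the frame.\<close>

lemma sub_laplacian_killing_commute:
  assumes f: "f \<in> smooth_funs" and Z: "Z \<in> V"
  shows "Z p (L f) = L (\<lambda>q. Z q f) p"
proof -
  obtain X where X: "horizontal_frame p X" using horizontal_frame_exists by blast
  note Zv = V_vector_field[OF Z] and u = gradH_horizontal[OF f] gradH_vector_field[OF f]
  note Xh = frame_horizontal[OF f X] and Xv = frame_vector_field[OF f X]
  have Zf: "(\<lambda>q. Z q f) \<in> smooth_funs" by (rule vector_field_smooth[OF Zv f])
  have *: "g p (D Z (D (X i) (gradH f)) p) (X i p) =
      g p (D (X i) (D Z (gradH f)) p) (X i p) + hess f (D Z (X i)) (X i) p" if i: "i < d" for i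
  proof -
    have "g p (curvature D Z (X i) (gradH f) p) (X i p) = 0"
      unfolding curvature_killing_symmetric[OF Z Xh[OF i] u(1)] by (rule curvature_skew[OF Zv u(2) Xh[OF i]])
    then show ?thesis
      unfolding curvature_ip[OF Zv Xv[OF i] u(1) Xh[OF i]] by (simp add: hess_def[OF f] D_killing[OF Z Xh[OF i]])
  qed
  have "Z p (L f) = (\<Sum>i<d. g p (D (X i) (D Z (gradH f)) p) (X i p) + hess f (D Z (X i)) (X i) p + hess f (X i) (D Z (X i)) p)"
    unfolding sub_laplacian_derivative[OF f X Zv] by (rule sum.cong[OF refl]) (simp add: *)
  also have "\<dots> = (\<Sum>i<d. g p (D (X i) (D Z (gradH f)) p) (X i p))"
    using hess_frame_skew[OF f X Zv] by (simp add: sum.distrib)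
  also have "\<dots> = L (\<lambda>q. Z q f) p"
    unfolding sub_laplacian_eq_hess[OF Zf X] by (simp add: hess_def[OF Zf] gradH_killing[OF f Z])
  finally show ?thesis .
qed

lemma sub_laplacian_sum:
  assumes "\<And>i. i \<in> I \<Longrightarrow> F i \<in> smooth_funs"
  shows "L (\<lambda>q. \<Sum>i\<in>I. F i q) p = (\<Sum>i\<in>I. L (F i) p)"
proof -
  have add: "L (\<lambda>p. f1 p + f2 p) = (\<lambda>p. L f1 p + L f2 p)" if "f1 \<in> smooth_funs" "f2 \<in> smooth_funs" for f1 f2
    using L that by (simp add: sub_laplacian_def)
  have "L (\<lambda>q. 0) = (\<lambda>p. 0)"
  proof -
    have "\<forall>c. \<forall>f\<in>smooth_funs. L (\<lambda>p. c * f p) = (\<lambda>p. c * L f p)"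
      using L unfolding sub_laplacian_def by blast
    from this[rule_format, OF smooth_funs_const[of 0], of 0] show ?thesis by simp
  qed
  then show ?thesis
    using assms
    by (induction I rule: infinite_finite_induct) (simp_all add: add smooth_funs_sum)
qed

text \<open>Applied to the square of \<open>?z m\<close>, the product rule for \<open>L\<close>
  gives twice the \<open>Gam\<close> term and twice \<open>?z m\<close> times its image under
  \<open>L\<close>. The latter cancels against \<open>2 * GamZ f (L f) p\<close>, because the
  vertical frame commutes with \<open>L\<close>.\<close>

lemma GamZ2_eq:
  assumes f: "f \<in> smooth_funs"
  shows "GamZ2 L f p = (\<Sum>m<dim V. Gam (\<lambda>q. vframe m q f) (\<lambda>q. vframe m q f) p)"
proof -
  let ?z = "\<lambda>m q. vframe m q f"
  have z: "?z m \<in> smooth_funs" if "m < dim V" for m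
    by (rule vector_field_smooth[OF vframe_vector_field[OF that] f])
  have "GamZ f f = (\<lambda>p. \<Sum>m<dim V. ?z m p * ?z m p)" by (rule ext) (rule GamZ_eq)
  then have "L (GamZ f f) p = L (\<lambda>p. \<Sum>m<dim V. ?z m p * ?z m p) p" by simp
  also have "\<dots> = (\<Sum>m<dim V. L (\<lambda>p. ?z m p * ?z m p) p)"
    by (rule sub_laplacian_sum) (auto intro: smooth_funs_mult z)
  also have "\<dots> = (\<Sum>m<dim V. 2 * (?z m p * L (?z m) p) + 2 * Gam (?z m) (?z m) p)"
    by (rule sum.cong[OF refl]) (simp add: sub_laplacian_mult[OF L z z])
  finally have 1: "L (GamZ f f) p = 2 * (\<Sum>m<dim V. ?z m p * L (?z m) p) + 2 * (\<Sum>m<dim V. Gam (?z m) (?z m) p)"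
    by (simp add: sum.distrib sum_distrib_left)
  have "GamZ f (L f) p = (\<Sum>m<dim V. ?z m p * L (?z m) p)"
    unfolding GamZ_eq by (rule sum.cong[OF refl]) (simp add: sub_laplacian_killing_commute[OF f vframe_V])
  then show ?thesis by (simp add: GamZ2_def 1)
qed

text \<open>The entry \<open>h (X i) u\<close> comes from differentiating \<open>Gam f f\<close>. It
  is turned into \<open>h u (X i)\<close>, so that its derivative along \<open>X i\<close> can be
  compared with the derivative of the trace along \<open>u\<close>. Each exchange of slots costs
  torsion, the exchange of \<open>D u\<close> and \<open>D (X i)\<close> costs curvature and a
  bracket.\<close>

lemma Gam2_eq:
  assumes f: "f \<in> smooth_funs" and X: "horizontal_frame p X"
  shows "Gam2 L f p = (\<Sum>i<d. g p (D (X i) (gradH f) p) (D (X i) (gradH f) p)) + ricci D (gradH f) (gradH f) p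
    - (\<Sum>i<d. cov_torsion D (X i) (X i) (gradH f) p f)
    - 2 * (\<Sum>i<d. \<Sum>m<dim V. tor_coeff m (X i) (gradH f) p * X i p (\<lambda>q. vframe m q f))"
proof -
  define u where "u = gradH f"
  define h where "h = hess f"
  have u: "u \<in> horizontal_fields H" "u \<in> vector_fields" unfolding u_def by (rule gradH_horizontal[OF f], rule gradH_vector_field[OF f])
  note Xh = frame_horizontal[OF f X] and Xv = frame_vector_field[OF f X]
  have hu: "h A B q = g q (D A u q) (B q)" for A B q by (simp add: h_def u_def hess_def[OF f])
  have Gu: "Gam f f = (\<lambda>q. g q (u q) (u q))" by (rule ext) (simp add: Gam_eq_g u_def)
  have Gs: "Gam f f \<in> smooth_funs" unfolding Gu by (rule g_smooth[OF u(1) u(1)])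
  have G1: "A q (Gam f f) = 2 * h A u q" if A: "A \<in> vector_fields" for A q
    unfolding Gu D_metric[OF A u(1) u(1)] hu
    using ip_sym[OF g_ip horizontal_mem[OF D_horizontal[OF A u(1)]] horizontal_mem[OF u(1)], of q] by simp
  have hs: "h A B \<in> smooth_funs" if "A \<in> vector_fields" "B \<in> horizontal_fields H" for A B
    unfolding h_def by (rule hess_smooth[OF f that])
  have DX: "D (X i) (X j) \<in> horizontal_fields H" if "i < d" "j < d" for i j
    by (rule D_horizontal[OF Xv[OF that(1)] Xh[OF that(2)]])
  have DXu: "D (X i) u \<in> horizontal_fields H" if "i < d" for i by (rule D_horizontal[OF Xv[OF that] u(1)])
  \<comment> \<open>The trace formula applied to \<open>Gam f f\<close>, whose derivative along any
    field \<open>A\<close> is \<open>2 * h A u\<close>.\<close>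
  have LG: "L (Gam f f) p = 2 * (\<Sum>i<d. X i p (h (X i) u) - h (D (X i) (X i)) u p)"
  proof -
    have "L (Gam f f) p = (\<Sum>i<d. X i p (\<lambda>q. X i q (Gam f f)) - D (X i) (X i) p (Gam f f))"
      unfolding sub_laplacian_eq_hess[OF Gs X] by (rule sum.cong[OF refl]) (simp add: hess_eq[OF Gs Xv Xh])
    also have "\<dots> = (\<Sum>i<d. 2 * (X i p (h (X i) u) - h (D (X i) (X i)) u p))"
    proof (rule sum.cong[OF refl])
      fix i assume "i \<in> {..<d}"
      then have i: "i < d" by simp
      have "X i p (\<lambda>q. X i q (Gam f f)) = X i p (\<lambda>q. 2 * h (X i) u q)"
        by (simp only: G1[OF Xv[OF i]])
      also have "\<dots> = 2 * X i p (h (X i) u)"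
        by (rule tangent_cmult[OF vector_field_tangent[OF Xv[OF i]] hs[OF Xv[OF i] u(1)]])
      finally show "X i p (\<lambda>q. X i q (Gam f f)) - D (X i) (X i) p (Gam f f) =
          2 * (X i p (h (X i) u) - h (D (X i) (X i)) u p)"
        by (simp add: G1[OF horizontal_vector_field[OF DX[OF i i]]])
    qed
    finally show ?thesis by (simp add: sum_distrib_left)
  qed
  have bracket: "h (lie_bracket u (X i)) (X i) p =
      h (D u (X i)) (X i) p - h (D (X i) u) (X i) p - h (torsion D u (X i)) (X i) p" if i: "i < d" for i
  proof -
    have "lie_bracket u (X i) = D u (X i) - D (X i) u - torsion D u (X i)" by (simp add: torsion_def)
    then show ?thesis
      using hess_diff_left[OF f vector_fields_diff[OF D_vector_field D_vector_field] torsion_vector_field, of u "X i" "X i" u u "X i" "X i" p]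
        hess_diff_left[OF f D_vector_field D_vector_field, of u "X i" "X i" u "X i" p]
      by (simp only: h_def u(2) Xv[OF i] Xh[OF i])
  qed
  \<comment> \<open>The torsion is vertical, so this entry consists of mixed derivatives. It is
    their second source besides \<open>torsion_derivative\<close>, which explains the coefficient
    2.\<close>
  have vert: "h (torsion D u (X i)) (X i) p = - (\<Sum>m<dim V. tor_coeff m (X i) u p * X i p (\<lambda>q. vframe m q f))"
    if i: "i < d" for i
  proof -
    have "h (torsion D u (X i)) (X i) p = (\<Sum>m<dim V. tor_coeff m u (X i) p * h (vframe m) (X i) p)"
      unfolding h_def
      by (rule hess_tensorial[OF f torsion_vector_field[OF u(2) Xv[OF i]] vframe_vector_field torsion_expansion_at[OF u(1) Xh[OF i]] Xh[OF i]]) simp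
    also have "\<dots> = (\<Sum>m<dim V. - (tor_coeff m (X i) u p * X i p (\<lambda>q. vframe m q f)))"
    proof (rule sum.cong[OF refl])
      fix m assume "m \<in> {..<dim V}"
      then have m: "m < dim V" by simp
      show "tor_coeff m u (X i) p * h (vframe m) (X i) p = - (tor_coeff m (X i) u p * X i p (\<lambda>q. vframe m q f))"
        unfolding h_def hess_killing[OF f vframe_V[OF m] Xh[OF i]]
        using tor_coeff_antisym[OF u(2) Xv[OF i] m, of p] by simp
    qed
    finally show ?thesis by (simp add: sum_negf)
  qed
  have anti: "h A B q = h B A q - torsion D A B q f" if "A \<in> horizontal_fields H" "B \<in> horizontal_fields H" for A B q
    unfolding h_def by (rule hess_antisym[OF f that])
  \<comment> \<open>An identity for each single index. Its last bracket is kept aside because only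
    its sum over \<open>i\<close> vanishes, by \<open>hess_frame_skew\<close>.\<close>
  have termwise: "X i p (h (X i) u) - h (D (X i) (X i)) u p - g p (D u (D (X i) u) p) (X i p) - h (X i) (D u (X i)) p
     = g p (D (X i) u p) (D (X i) u p) + g p (curvature D (X i) u u p) (X i p) - cov_torsion D (X i) (X i) u p f
       - 2 * (\<Sum>m<dim V. tor_coeff m (X i) u p * X i p (\<lambda>q. vframe m q f))
       - (h (D u (X i)) (X i) p + h (X i) (D u (X i)) p)" if i: "i < d" for i
  proof -
    note xi = Xh[OF i] Xv[OF i]
    have Ts: "(\<lambda>q. torsion D (X i) u q f) \<in> smooth_funs" by (rule vector_field_smooth[OF torsion_vector_field[OF xi(2) u(2)] f])
    have "g p (curvature D (X i) u u p) (X i p) = - g p (curvature D u (X i) u p) (X i p)"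
    proof -
      have "curvature D (X i) u u p = - curvature D u (X i) u p"
        using fun_cong[OF curvature_antisym[OF xi(2) u(2) u(2)], of p] by (simp only: uminus_apply)
      then show ?thesis
        using ip_minus_left[OF g_ip horizontal_mem[OF curvature_horizontal[OF u(2) xi(2) u(1)]] horizontal_mem[OF xi(1)]]
        by (simp only:)
    qed
    then have c: "g p (D u (D (X i) u) p) (X i p) = - g p (curvature D (X i) u u p) (X i p)
        + g p (D (X i) (D u u) p) (X i p) + h (lie_bracket u (X i)) (X i) p"
      unfolding curvature_ip[OF u(2) xi(2) u(1) xi(1)] hu by simp
    have d1: "X i p (h u (X i)) = g p (D (X i) (D u u) p) (X i p) + h u (D (X i) (X i)) p"
      unfolding h_def u_def by (rule hess_derivative[OF f xi(2) gradH_vector_field[OF f] xi(1)])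
    have "h (X i) u = (\<lambda>q. h u (X i) q - torsion D (X i) u q f)"
      by (rule ext) (rule anti[OF xi(1) u(1)])
    then have "X i p (h (X i) u) = X i p (\<lambda>q. h u (X i) q - torsion D (X i) u q f)" by simp
    also have "\<dots> = X i p (h u (X i)) - X i p (\<lambda>q. torsion D (X i) u q f)"
      by (rule tangent_diff[OF vector_field_tangent[OF xi(2)] hs[OF u(2) xi(1)] Ts])
    finally have a: "X i p (h (X i) u) = X i p (h u (X i)) - X i p (\<lambda>q. torsion D (X i) u q f)" .
    have b: "h (D (X i) (X i)) u p = h u (D (X i) (X i)) p - torsion D (D (X i) (X i)) u p f"
      by (rule anti[OF DX[OF i i] u(1)])
    have e: "h (D (X i) u) (X i) p = g p (D (X i) u p) (D (X i) u p) + torsion D (X i) (D (X i) u) p f"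
      using anti[OF DXu[OF i] xi(1), of p] fun_cong[OF fun_cong[OF torsion_antisym[of "D (X i) u" "X i"], of p], of f]
      by (simp add: hu)
    have cov: "cov_torsion D (X i) (X i) u p f = D (X i) (torsion D (X i) u) p f
        - torsion D (D (X i) (X i)) u p f - torsion D (X i) (D (X i) u) p f"
      by (simp only: cov_torsion_def minus_apply)
    show ?thesis
      using c d1 a b e cov bracket[OF i] vert[OF i] torsion_derivative[OF f xi(2) xi(1) u(1), of p] by simp
  qed
  have "Gam f (L f) p = (\<Sum>i<d. g p (D u (D (X i) u) p) (X i p) + h (X i) (D u (X i)) p)"
    unfolding Gam_eq u_def h_def by (rule sub_laplacian_derivative[OF f X gradH_vector_field[OF f]])
  then have "Gam2 L f p = (\<Sum>i<d. X i p (h (X i) u) - h (D (X i) (X i)) u p - g p (D u (D (X i) u) p) (X i p) - h (X i) (D u (X i)) p)"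
    unfolding Gam2_def LG by (simp add: sum_subtractf sum.distrib)
  also have "\<dots> = (\<Sum>i<d. g p (D (X i) u p) (D (X i) u p) + g p (curvature D (X i) u u p) (X i p) - cov_torsion D (X i) (X i) u p f
       - 2 * (\<Sum>m<dim V. tor_coeff m (X i) u p * X i p (\<lambda>q. vframe m q f))
       - (h (D u (X i)) (X i) p + h (X i) (D u (X i)) p))"
    by (rule sum.cong[OF refl]) (simp only: termwise lessThan_iff)
  also have "\<dots> = (\<Sum>i<d. g p (D (X i) u p) (D (X i) u p)) + (\<Sum>i<d. g p (curvature D (X i) u u p) (X i p))
      - (\<Sum>i<d. cov_torsion D (X i) (X i) u p f) - 2 * (\<Sum>i<d. \<Sum>m<dim V. tor_coeff m (X i) u p * X i p (\<lambda>q. vframe m q f))"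
    using hess_frame_skew[OF f X u(2), folded h_def] by (simp add: sum.distrib sum_subtractf sum_distrib_left)
  finally show ?thesis
    unfolding ricci_eq[OF X gradH_vector_field[OF f] gradH_horizontal[OF f]] u_def .
qed

section \<open>The curvature-dimension inequality\<close>

lemma torsion_norm:
  assumes "A \<in> horizontal_fields H" "B \<in> horizontal_fields H"
  shows "gR p (torsion D A B p) (torsion D A B p) = (\<Sum>m<dim V. (tor_coeff m A B p)\<^sup>2)"
proof -
  let ?w = "torsion D A B p"
  have w: "?w \<in> tangent_space p" by (rule vert_tangent[OF torsion_vert[OF assms]])
  have z: "vframe m p \<in> tangent_space p" if "m < dim V" for m by (rule vector_field_tangent[OF vframe_vector_field[OF that]])
  have "gR p ?w ?w = gR p (\<Sum>m<dim V. tor_coeff m A B p *\<^sub>R vframe m p) ?w"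
    using torsion_expansion_at[OF assms, of p] by simp
  also have "\<dots> = (\<Sum>m<dim V. gR p (tor_coeff m A B p *\<^sub>R vframe m p) ?w)"
    by (rule ip_sum_left[OF gR_ip _ w]) (auto intro: subspace_scale[OF subspace_tangent_space] z)
  also have "\<dots> = (\<Sum>m<dim V. (tor_coeff m A B p)\<^sup>2)"
    by (rule sum.cong[OF refl])
      (simp add: ip_scale_left[OF gR_ip z w] ip_sym[OF gR_ip z w] tor_coeff_def power2_eq_square)
  finally show ?thesis .
qed

theorem curvature_dimension:
  assumes R: "\<And>f p. f \<in> smooth_funs \<Longrightarrow> R_form D f p \<ge> \<rho>1 * Gam f f p + \<rho>2 * GamZ f f p"
    and T: "\<And>f p. f \<in> smooth_funs \<Longrightarrow> T_form D f p \<le> \<kappa> * Gam f f p"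
  shows "CD_inequality L \<rho>1 \<rho>2 \<kappa> d"
  unfolding CD_inequality_def
proof (intro ballI allI impI)
  fix f and \<nu> :: real and p assume f: "f \<in> smooth_funs" and \<nu>: "0 < \<nu>"
  \<comment> \<open>Both forms choose their frame by this same \<open>SOME\<close>, so they unfold
    directly into sums over \<open>X\<close>.\<close>
  define X where "X = (SOME X. horizontal_frame p X)"
  have X: "horizontal_frame p X" unfolding X_def by (rule someI_ex[OF horizontal_frame_exists])
  define u where "u = gradH f"
  note Xh = frame_horizontal[OF f X] and Xv = frame_vector_field[OF f X]
  have u: "u \<in> horizontal_fields H" "u \<in> vector_fields" unfolding u_def by (rule gradH_horizontal[OF f], rule gradH_vector_field[OF f])
  define a where "a i m = tor_coeff m (X i) u p" for i m
  define b where "b i m = X i p (\<lambda>q. vframe m q f)" for i m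
  define h where "h i j = hess f (X i) (X j) p" for i j
  define t where "t i j = torsion D (X i) (X j) p f" for i j
  have ht: "h i j - h j i = - t i j" if "i < d" "j < d" for i j
    unfolding h_def t_def using hess_antisym[OF f Xh[OF that(1)] Xh[OF that(2)], of p] by simp
  have Lf: "L f p = (\<Sum>i<d. h i i)" unfolding h_def by (rule sub_laplacian_eq_hess[OF f X])
  have norm: "g p (D (X i) u p) (D (X i) u p) = (\<Sum>j<d. (h i j)\<^sup>2)" if i: "i < d" for i
  proof -
    obtain F where F: "finite F" "H p \<subseteq> span F" by (rule H_span)
    note m = horizontal_mem[OF D_horizontal[OF Xv[OF i] u(1)], of p]
    show ?thesis
      using orthonormal_parseval[OF g_ip horizontal_frame_at[OF X] F H_dim m m]
      by (simp add: h_def hess_def[OF f] u_def power2_eq_square)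
  qed
  \<comment> \<open>The covariant torsion is function-linear in its last argument, so the gradient
    may be replaced by its frame expansion at \<open>p\<close>.\<close>
  have cov: "cov_torsion D (X l) (X l) u p f = (\<Sum>k<d. cov_torsion D (X l) (X l) (X k) p f * X k p f)" if l: "l < d" for l
  proof -
    have "u p = (\<Sum>k<d. X k p f *\<^sub>R X k p)" unfolding u_def by (rule gradH_frame[OF X])
    from tensorial_sum[where \<Phi> = "\<lambda>Y. cov_torsion D (X l) (X l) Y p f" and p = p and A = u and B = X and I = "{..<d}"
        and c = "\<lambda>k. X k p f", OF _ _ u(2) _ this]
    have "cov_torsion D (X l) (X l) u p f = (\<Sum>k<d. X k p f * cov_torsion D (X l) (X l) (X k) p f)"
      by (simp add: cov_torsion_add_right cov_torsion_scale_right Xv l)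
    then show ?thesis by (simp add: mult.commute)
  qed
  have Rf: "R_form D f p = ricci D u u p - (\<Sum>l<d. cov_torsion D (X l) (X l) u p f) + (\<Sum>l<d. \<Sum>k<d. (t l k)\<^sup>2) / 4"
  proof -
    have "R_form D f p = ricci D u u p + (\<Sum>l<d. \<Sum>k<d. - (cov_torsion D (X l) (X l) (X k) p f * X k p f) + (t l k)\<^sup>2 / 4)"
      by (simp add: R_form_def Let_def X_def[symmetric] u_def t_def)
    also have "(\<Sum>l<d. \<Sum>k<d. - (cov_torsion D (X l) (X l) (X k) p f * X k p f) + (t l k)\<^sup>2 / 4) =
        (\<Sum>l<d. - cov_torsion D (X l) (X l) u p f + (\<Sum>k<d. (t l k)\<^sup>2) / 4)"
      by (rule sum.cong[OF refl]) (simp add: cov sum.distrib sum_subtractf sum_divide_distrib)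
    finally show ?thesis by (simp add: sum.distrib sum_negf sum_subtractf sum_divide_distrib)
  qed
  have Tf: "T_form D f p = (\<Sum>i<d. \<Sum>m<dim V. (a i m)\<^sup>2)"
    unfolding T_form_def Let_def X_def[symmetric] u_def[symmetric] a_def
    by (rule sum.cong[OF refl]) (simp add: torsion_norm Xh u)
  have G2: "Gam2 L f p = (\<Sum>i<d. \<Sum>j<d. (h i j)\<^sup>2) + ricci D u u p
      - (\<Sum>l<d. cov_torsion D (X l) (X l) u p f) - 2 * (\<Sum>i<d. \<Sum>m<dim V. a i m * b i m)"
    using Gam2_eq[OF f X, folded u_def] by (simp add: norm a_def b_def)
  have GZ2: "GamZ2 L f p = (\<Sum>i<d. \<Sum>m<dim V. (b i m)\<^sup>2)"
  proof -
    have "Gam z z p = (\<Sum>i<d. (X i p z)\<^sup>2)" for z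
      by (simp add: Gam_eq gradH_frame[OF X] sum_fun_app power2_eq_square)
    then have "GamZ2 L f p = (\<Sum>m<dim V. \<Sum>i<d. (b i m)\<^sup>2)" by (simp add: GamZ2_eq[OF f] b_def)
    also have "\<dots> = (\<Sum>i<d. \<Sum>m<dim V. (b i m)\<^sup>2)" by (rule sum.swap)
    finally show ?thesis .
  qed
  \<comment> \<open>The square of \<open>a i m - \<nu> * b i m\<close> divided by
    \<open>\<nu>\<close>; after summation its two ends are \<open>T_form D f p / \<nu>\<close> and
    \<open>\<nu> * GamZ2 L f p\<close>.\<close>
  have young: "2 * (a i m * b i m) \<le> (a i m)\<^sup>2 / \<nu> + \<nu> * (b i m)\<^sup>2" for i m
  proof -
    have "0 \<le> (a i m - \<nu> * b i m)\<^sup>2 / \<nu>" using \<nu> by simp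
    also have "\<dots> = (a i m)\<^sup>2 / \<nu> + \<nu> * (b i m)\<^sup>2 - 2 * (a i m * b i m)"
      using \<nu> by (simp add: power2_eq_square field_simps)
    finally show ?thesis by simp
  qed
  have "2 * (\<Sum>i<d. \<Sum>m<dim V. a i m * b i m) = (\<Sum>i<d. \<Sum>m<dim V. 2 * (a i m * b i m))"
    by (simp add: sum_distrib_left)
  also have "\<dots> \<le> (\<Sum>i<d. \<Sum>m<dim V. (a i m)\<^sup>2 / \<nu> + \<nu> * (b i m)\<^sup>2)"
    by (intro sum_mono young)
  also have "\<dots> = T_form D f p / \<nu> + \<nu> * GamZ2 L f p"
    unfolding Tf GZ2 by (simp add: sum.distrib sum_distrib_left sum_divide_distrib)
  also have "\<dots> \<le> \<kappa> * Gam f f p / \<nu> + \<nu> * GamZ2 L f p"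
    using T[OF f, of p] \<nu> by (simp add: divide_right_mono)
  finally have mixed: "2 * (\<Sum>i<d. \<Sum>m<dim V. a i m * b i m) \<le> \<kappa> * Gam f f p / \<nu> + \<nu> * GamZ2 L f p" .
  have trace: "(L f p)\<^sup>2 / d + (\<Sum>i<d. \<Sum>j<d. (t i j)\<^sup>2) / 4 \<le> (\<Sum>i<d. \<Sum>j<d. (h i j)\<^sup>2)"
    unfolding Lf by (rule trace_square_bound[OF ht])
  \<comment> \<open>Distributed so that \<open>\<kappa> * Gam f f p / \<nu>\<close> becomes the same
    atom as in \<open>mixed\<close>; what remains is linear.\<close>
  have "(\<rho>1 - \<kappa> / \<nu>) * Gam f f p = \<rho>1 * Gam f f p - \<kappa> * Gam f f p / \<nu>" by (simp add: left_diff_distrib)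
  then show "(L f p)\<^sup>2 / d + (\<rho>1 - \<kappa> / \<nu>) * Gam f f p + \<rho>2 * GamZ f f p \<le> Gam2 L f p + \<nu> * GamZ2 L f p"
    using R[OF f, of p] mixed trace unfolding Rf G2 by linarith
qed

end

end

theorem theorem2p19:
  fixes atlas :: "('a::{t2_space, second_countable_topology} set
                   \<times> ('a \<Rightarrow> real ^ 'n::finite)) set"
    and d :: nat
    and H :: "'a \<Rightarrow> 'a tvec set"
    and g :: "'a \<Rightarrow> 'a tvec \<Rightarrow> 'a tvec \<Rightarrow> real"
    and V :: "'a vfield set"
    and vip :: "'a vfield \<Rightarrow> 'a vfield \<Rightarrow> real"
    and \<mu> :: "'a measure"
    and L :: "('a \<Rightarrow> real) \<Rightarrow> 'a \<Rightarrow> real"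
    and D :: "'a vfield \<Rightarrow> 'a vfield \<Rightarrow> 'a vfield"
    and \<rho>1 \<rho>2 \<kappa> :: real
  assumes "transverse_symmetries atlas d H g V vip"
    and "transverse_symmetries.riemannian_measure atlas H g V vip \<mu>"
    and "transverse_symmetries.sub_laplacian atlas H g V vip \<mu> L"
    and "transverse_symmetries.canonical_connection atlas H g V D"
    and "\<rho>2 > 0" and "\<kappa> \<ge> 0"
    and "\<forall>f\<in>smooth_manifold.smooth_funs atlas. \<forall>p.
           transverse_symmetries.R_form atlas d H g V vip D f p
             \<ge> \<rho>1 * transverse_symmetries.Gam atlas H g V vip f f p
               + \<rho>2 * transverse_symmetries.GamZ atlas H g V vip f f p"
    and "\<forall>f\<in>smooth_manifold.smooth_funs atlas. \<forall>p.
           transverse_symmetries.T_form atlas d H g V vip D f p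
             \<le> \<kappa> * transverse_symmetries.Gam atlas H g V vip f f p"
  shows "transverse_symmetries.CD_inequality atlas H g V vip L \<rho>1 \<rho>2 \<kappa> (real d)"
proof -
  interpret canonical_geometry atlas d H g V vip D
    by (intro canonical_geometry.intro canonical_geometry_axioms.intro assms(1,4))
  show ?thesis
    by (rule curvature_dimension[OF assms(2,3)]) (use assms(7,8) in blast)+
qed

end
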